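(* Let $\xi>0$, $\tau<0$, $\rho=\xi\tau$, and let $X_1,X_2,\ldots$ be i.i.d. with distribution function $F\in\mathcal{F}(\xi,\tau)$. Assume that, as $k,n\to\infty$ with $k/n\to0$, one has $k\sigma^2_{k,n}\to\mu>0$ and $\sqrt{k}\,a(n/k)\to\lambda\in\mathbb{R}$. Let $\hat\rho=\hat\rho_n$ be an estimator with $\hat\rho_n\to\rho$ in probability, and let $\hat\xi^{\mathcal B}_k$ be the first-order Bayesian EPD estimator of $\xi$ with prior variance $\sigma^2_{k,n}$ and external estimator $\hat\tau=\hat\rho_n/H_{k,n}$ of $\tau$. Put $\zeta=\xi^2(1-2\rho)(1-\rho)^2/\mu$. Then $\Xi_{k,n}:=\sqrt{k}\,(\hat\xi^{\mathcal B}_k-\xi)$ is asymptotically normal with asymptotic mean $$E_\infty(\Xi_{k,n})=\frac{\lambda\rho}{1-\rho}\,\frac{\zeta}{\zeta+\rho^4}$$ and asymptotic variance $$Var_\infty(\Xi_{k,n})=\frac{\xi^2}{(1+\zeta\rho^{-4})^2}\left(\left(\frac{1-\rho}{\rho}\right)^2+\frac{\zeta^2}{\rho^8}+2\,\frac{\zeta}{\rho^4}\right).$$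
   Context: Class $\mathcal{F}(\xi,\tau)$ ($\xi>0$, $\tau<0$): distribution functions $F$ whose right tail function $\bar F=1-F$ satisfies $\bar F(x)=Cx^{-1/\xi}(1+\xi^{-1}\delta(x))$ for some constant $C>0$, where $\delta(x)$ is eventually (for large $x$) nonzero and of constant sign, and $|\delta(x)|=x^{\tau}\ell_\delta(x)$ with $\ell_\delta$ slowly varying at infinity. Function $a$: with $Q(p)=\inf\{x:F(x)\ge p\}$, $a$ is defined by $Q(1-x^{-1})=C^{\xi}x^{\xi}(1+a(x))$, $x>1$. For $F\in\mathcal{F}(\xi,\tau)$, $a$ is eventually nonzero and of constant sign and $|a(x)|=x^{\rho}\ell_a(x)$ with $\rho=\xi\tau$ and $\ell_a$ slowly varying. Statistics: let $X_{1,n}\le\cdots\le X_{n,n}$ be the order statistics of $X_1,\ldots,X_n$, $Y_{j,k}=X_{n-j+1,n}/X_{n-k,n}$ for $j=1,\ldots,k$, $H_{k,n}=\frac1k\sum_{j=1}^k\log Y_{j,k}$ (the Hill estimator), and $E_{k,n}(s)=\frac1k\sum_{j=1}^kY_{j,k}^{s}$ for $s<0$. Estimators: $(\hat\xi^{\mathcal B}_k,\hat\delta^{\mathcal B}_k)$ are given by the following (implicit) system, with $\tau$ replaced everywhere by $\hat\tau=\hat\rho_n/H_{k,n}$: $$\hat\xi^{\mathcal B}_k=H_{k,n}+\hat\delta^{\mathcal B}_k\,(1-E_{k,n}(\tau)),\qquad \hat\delta^{\mathcal B}_k=\frac{1-H_{k,n}\tau}{D^{\mathcal B}_{k,n}}\left(E_{k,n}(\tau)-\frac{1}{1-H_{k,n}\tau}\right),$$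 $$D^{\mathcal B}_{k,n}=\frac{\hat\xi^{\mathcal B}_k}{k\sigma^2_{k,n}}-\Big(1-2(1-\hat\xi^{\mathcal B}_k\tau)E_{k,n}(\tau)+(1-2\hat\xi^{\mathcal B}_k\tau-\hat\xi^{\mathcal B}_k\tau^2)E_{k,n}(2\tau)-\tau(1-E_{k,n}(\tau))E_{k,n}(\tau)\Big).$$ These are the first-order approximations of the posterior-mode estimators of $(\xi,\delta)$ when the excesses $Y_{j,k}$ are modelled by the extended Pareto distribution (EPD) with right tail function $\{y(1+\delta-\delta y^\tau)\}^{-1/\xi}$, $y>1$ (with $\tau<0<\xi$, $\delta>\max(-1,1/\tau)$), with prior density proportional to $e^{-\xi}/\xi$ on $\xi$ and, on $\delta$, a normal prior with mean $0$ and variance $\sigma^2_{k,n}>0$, left-truncated at $\max(-1,1/\tau)$.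
   Formalization: The implicit system can have two solutions, one of which does not converge to ξ; the estimator is taken to be the solution with the smallest absolute value of the δ-estimate (denominator D nonzero). *)

theory Defs
  imports "HOL-Probability.Probability"
begin

definition slowly_varying :: "(real \<Rightarrow> real) \<Rightarrow> bool" where
  "slowly_varying l \<longleftrightarrow>
     l \<in> borel_measurable borel \<and>
     (\<forall>\<^sub>F x in at_top. l x > 0) \<and>
     (\<forall>t>0. ((\<lambda>x. l (t * x) / l x) \<longlongrightarrow> 1) at_top)"

(* The class F(xi, tau), with the constant C kept as a parameter because the function a
   refers to it.  C is determined by F: it is the limit of x powr (1/xi) * (1 - F x). *)
definition tail_class :: "real \<Rightarrow> real \<Rightarrow> real \<Rightarrow> (real \<Rightarrow> real) set" where
  "tail_class \<xi> \<tau> C = {F. (\<exists>N. real_distribution N \<and> F = cdf N) \<and>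
     (\<exists>\<delta> l. slowly_varying l \<and>
        (\<forall>x>0. 1 - F x = C * x powr (- (1 / \<xi>)) * (1 + \<delta> x / \<xi>)) \<and>
        ((\<forall>\<^sub>F x in at_top. \<delta> x > 0) \<or> (\<forall>\<^sub>F x in at_top. \<delta> x < 0)) \<and>
        (\<forall>x>0. \<bar>\<delta> x\<bar> = x powr \<tau> * l x))}"

definition quantile :: "(real \<Rightarrow> real) \<Rightarrow> real \<Rightarrow> real" where
  "quantile F p = Inf {x. F x \<ge> p}"

definition a_fun :: "real \<Rightarrow> real \<Rightarrow> (real \<Rightarrow> real) \<Rightarrow> real \<Rightarrow> real" where
  "a_fun \<xi> C F x = quantile F (1 - 1 / x) / (C powr \<xi> * x powr \<xi>) - 1"

definition conv_in_prob :: "'a measure \<Rightarrow> (nat \<Rightarrow> 'a \<Rightarrow> real) \<Rightarrow> real \<Rightarrow> bool" where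
  "conv_in_prob M Z c \<longleftrightarrow>
     (\<forall>\<epsilon>>0. (\<lambda>n. measure M {\<omega> \<in> space M. \<bar>Z n \<omega> - c\<bar> > \<epsilon>}) \<longlonglongrightarrow> 0)"

(* The j-th smallest of x 1, ..., x n, for 1 \<le> j \<le> n. *)
definition order_stat :: "(nat \<Rightarrow> real) \<Rightarrow> nat \<Rightarrow> nat \<Rightarrow> real" where
  "order_stat x n j = sort (map x [1..<n + 1]) ! (j - 1)"

definition rel_excess :: "(nat \<Rightarrow> real) \<Rightarrow> nat \<Rightarrow> nat \<Rightarrow> nat \<Rightarrow> real" where
  "rel_excess x n k j = order_stat x n (n - j + 1) / order_stat x n (n - k)"

definition hill :: "(nat \<Rightarrow> real) \<Rightarrow> nat \<Rightarrow> nat \<Rightarrow> real" where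
  "hill x n k = (\<Sum>j = 1..k. ln (rel_excess x n k j)) / real k"

definition E_stat :: "(nat \<Rightarrow> real) \<Rightarrow> nat \<Rightarrow> nat \<Rightarrow> real \<Rightarrow> real" where
  "E_stat x n k s = (\<Sum>j = 1..k. rel_excess x n k j powr s) / real k"

(* s2 is the prior variance of delta, z the value of the estimator of xi. *)
definition D_B :: "real \<Rightarrow> (nat \<Rightarrow> real) \<Rightarrow> nat \<Rightarrow> nat \<Rightarrow> real \<Rightarrow> real \<Rightarrow> real" where
  "D_B s2 x n k \<tau> z = z / (real k * s2) -
     (1 - 2 * (1 - z * \<tau>) * E_stat x n k \<tau>
        + (1 - 2 * z * \<tau> - z * \<tau>\<^sup>2) * E_stat x n k (2 * \<tau>)
        - \<tau> * (1 - E_stat x n k \<tau>) * E_stat x n k \<tau>)"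

(* (z, d) solves the implicit system for the estimators of (xi, delta).  The condition on D_B
   excludes spurious solutions created by the convention y / 0 = 0. *)
definition EPD_system ::
  "real \<Rightarrow> (nat \<Rightarrow> real) \<Rightarrow> nat \<Rightarrow> nat \<Rightarrow> real \<Rightarrow> real \<Rightarrow> real \<Rightarrow> bool" where
  "EPD_system s2 x n k \<tau> z d \<longleftrightarrow>
     D_B s2 x n k \<tau> z \<noteq> 0 \<and>
     z = hill x n k + d * (1 - E_stat x n k \<tau>) \<and>
     d = (1 - hill x n k * \<tau>) / D_B s2 x n k \<tau> z
           * (E_stat x n k \<tau> - 1 / (1 - hill x n k * \<tau>))"

(* Eliminating d turns the system into a quadratic equation for z.  For large samples it has two
   real roots: one with d near 0, and one at which D_B is close to 0 and which does not converge
   to xi.  As the system is a first-order expansion around d = 0, the estimator is the solution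
   with the smallest absolute value of d. *)
definition EPD_bayes_estimate ::
  "real \<Rightarrow> (nat \<Rightarrow> real) \<Rightarrow> nat \<Rightarrow> nat \<Rightarrow> real \<Rightarrow> real \<Rightarrow> real \<Rightarrow> bool" where
  "EPD_bayes_estimate s2 x n k \<tau> z d \<longleftrightarrow>
     EPD_system s2 x n k \<tau> z d \<and>
     (\<forall>z' d'. EPD_system s2 x n k \<tau> z' d' \<longrightarrow> \<bar>d\<bar> \<le> \<bar>d'\<bar>)"

end

theory Submission
  imports Defs "HOL-Real_Asymp.Real_Asymp"
begin

text \<open>
  Write \<open>t\<close> for \<open>(C n / k) powr \<xi>\<close>, \<open>T\<close> for the order statistic \<open>X\<^bsub>n-k,n\<^esub>\<close>, and \<open>N w\<close> for
  the number of observations above \<open>t exp w\<close>.  The event \<open>T \<le> t exp w\<close> is \<open>N w \<le> k\<close>, so second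
  moments of the counts alone give \<open>\<surd>k ln (T / t) = \<xi> (N 0 - k) / \<surd>k + o(1)\<close> in probability, and no
  distribution theory of order statistics is needed.  Replacing \<open>T\<close> by \<open>t\<close> then turns the Hill
  estimator and \<open>E_stat\<close> into integrals of the tail process \<open>(N w - exp (- w / \<xi>) N 0) / \<surd>k\<close> against
  \<open>exp (s w)\<close>.  The \<open>L\<^sup>1\<close> norm of this process is tight, so the dependence on \<open>s\<close> is uniformly
  Lipschitz and the random \<open>\<tau>hat\<close> may be replaced by \<open>\<tau>\<close>.  What is left is a sum of i.i.d. terms, for
  which characteristic functions give a central limit theorem; its bias comes from the regularly
  varying remainder \<open>\<delta>\<close>, which at \<open>t\<close> is asymptotically equal to \<open>a (n / k)\<close>.  Finally, eliminating \<open>\<delta>hat\<close>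
  from the system gives a quadratic equation, whose small root is linearised.
\<close>

subsection \<open>Slowly varying functions\<close>

text \<open>The obstacle is that a random threshold, a random exponent and an implicitly defined
  estimator interact. They are separated by one family of statistics: the means of
  \<open>exp_primitive s\<close> over the log excesses, where s = 0 is the Hill estimator and other
  s give \<open>E_stat\<close>, so that a single expansion, robust enough for a random s, covers all
  of them. Moving the threshold by h on the log scale perturbs such a mean at order h, and the
  change in the number of exceedances compensates this to first order, because an exponential
  variable has no memory; only the centred sum over exceedances of the fixed threshold survives.
  That sum has a random number of nonzero terms, but it is an i.i.d. sum over all n observations.
  Its terms have mean zero under the exponential limit law, so it picks up the deviation of the true
  tail from the exponential one at scale 1 / sqrt k, which is where L enters. F may jump, hence ties
  among observations and jumps at quantiles are carried along as inequalities.\<close>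

lemma additive_uniform_convergence_seq:
  fixes f :: "real \<Rightarrow> real" and x u :: "nat \<Rightarrow> real"
  assumes meas: "f \<in> borel_measurable borel"
    and lim: "\<And>h. ((\<lambda>y. f (y + h) - f y) \<longlongrightarrow> 0) at_top"
    and x: "filterlim x at_top sequentially"
    and u: "\<And>n. u n \<in> {0..1}"
  shows "(\<lambda>n. f (x n + u n) - f (x n)) \<longlonglongrightarrow> 0"
proof -
  \<comment> \<open>Pointwise convergence says that these sets increase to \<open>{0..2}\<close>;
    continuity of measure makes their measure exceed 3/2 from some n on.\<close>
  have large: "\<forall>\<^sub>F n in sequentially. 3/2 <
      measure lborel {y\<in>{0..2}. \<forall>m\<ge>n. \<bar>f (z m + y) - f (z m)\<bar> \<le> e}"
    if z: "filterlim z at_top sequentially" and e: "e > 0" for z and e :: real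
  proof -
    define V where "V n = {y\<in>{0..2}. \<forall>m\<ge>n. \<bar>f (z m + y) - f (z m)\<bar> \<le> e}" for n
    have V_meas: "V n \<in> sets lborel" for n
    proof -
      have "V n = {0..2} \<inter> (\<Inter>m\<in>{n..}. {y. \<bar>f (z m + y) - f (z m)\<bar> \<le> e})"
        by (auto simp: V_def)
      moreover have "{y. \<bar>f (z m + y) - f (z m)\<bar> \<le> e} \<in> sets lborel" for m
        using meas by measurable
      ultimately show ?thesis
        by (auto intro!: sets.Int sets.countable_INT)
    qed
    have "(\<Union>n. V n) = {0..2}"
    proof safe
      fix y :: real assume y: "y \<in> {0..2}"
      have "(\<lambda>m. f (z m + y) - f (z m)) \<longlonglongrightarrow> 0"
        using filterlim_compose[OF lim z] .
      then have "\<forall>\<^sub>F m in sequentially. dist (f (z m + y) - f (z m)) 0 < e"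
        using e by (rule tendstoD)
      then obtain n where "\<And>m. m \<ge> n \<Longrightarrow> dist (f (z m + y) - f (z m)) 0 < e"
        by (auto simp: eventually_sequentially)
      then have "y \<in> V n"
        using y by (force simp: V_def dist_real_def)
      then show "y \<in> (\<Union>n. V n)" by blast
    qed (auto simp: V_def)
    moreover have "(\<lambda>n. measure lborel (V n)) \<longlonglongrightarrow> measure lborel (\<Union>n. V n)"
    proof (rule Lim_measure_incseq)
      show "range V \<subseteq> sets lborel" using V_meas by auto
      show "incseq V" by (auto simp: incseq_def V_def)
      have "emeasure lborel (\<Union>n. V n) = ennreal 2"
        unfolding calculation by simp
      then show "emeasure lborel (\<Union>n. V n) \<noteq> \<infinity>" by simp
    qed
    ultimately have "(\<lambda>n. measure lborel (V n)) \<longlonglongrightarrow> 2" by simp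
    from order_tendstoD(1)[OF this, of "3/2"] show ?thesis
      by (simp add: V_def)
  qed
  show ?thesis
  proof (rule tendstoI)
    fix e :: real assume "e > 0"
    then have e: "e / 3 > 0" by simp
    \<comment> \<open>Steinhaus argument: a point y that is good for the base point
      \<open>x n\<close>, and whose translate \<open>y - u n\<close> is good for \<open>z n\<close>,
      makes \<open>f (x n + y)\<close> a common comparison value for \<open>f (x n)\<close> and
      \<open>f (z n)\<close>.\<close>
    define z where "z n = x n + u n" for n
    have z: "filterlim z at_top sequentially"
      by (rule filterlim_at_top_mono[OF x]) (use u in \<open>auto simp: z_def\<close>)
    define V where "V n = {y\<in>{0..2}. \<forall>m\<ge>n. \<bar>f (x m + y) - f (x m)\<bar> \<le> e / 3}" for n
    define W where "W n = {y\<in>{0..2}. \<forall>m\<ge>n. \<bar>f (z m + y) - f (z m)\<bar> \<le> e / 3}" for n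
    have "\<forall>\<^sub>F n in sequentially. 3/2 < measure lborel (V n) \<and> 3/2 < measure lborel (W n)"
      using large[OF x e] large[OF z e] by (simp add: V_def W_def eventually_conj)
    then show "\<forall>\<^sub>F n in sequentially. dist (f (x n + u n) - f (x n)) 0 < e"
    proof (eventually_elim, elim conjE)
      fix n
      assume V: "3/2 < measure lborel (V n)" and W: "3/2 < measure lborel (W n)"
      define W' where "W' = (+) (u n) ` W n"
      have V_sets: "V n \<in> sets lborel" and W_sets: "W n \<in> sets lborel"
        using V W measure_notin_sets by fastforce+
      have W'_eq: "W' = (\<lambda>y. y - u n) -` W n"
      proof safe
        fix y assume "y - u n \<in> W n"
        then show "y \<in> W'" unfolding W'_def by (intro image_eqI[of _ _ "y - u n"]) auto
      qed (auto simp: W'_def)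
      have W'_sets: "W' \<in> sets lborel"
      proof -
        have "(\<lambda>y. y - u n) \<in> borel_measurable borel" by simp
        from measurable_sets[OF this, of "W n"] W_sets show ?thesis
          by (simp add: W'_eq)
      qed
      have "measure lborel W' = measure lebesgue W'"
        using W'_sets by simp
      also have "\<dots> = measure lebesgue (W n)"
        unfolding W'_def by (rule measure_translation)
      finally have mW': "measure lborel W' = measure lborel (W n)"
        using W_sets by simp
      have sub: "V n \<subseteq> {0..3}" "W' \<subseteq> {0..3}"
        using u[of n] by (auto simp: V_def W'_def W_def)
      have fmI: "{0..3::real} \<in> fmeasurable lborel" by (auto simp: fmeasurable_def)
      have fm: "V n \<in> fmeasurable lborel" "W' \<in> fmeasurable lborel"
        using fmeasurableI2[OF fmI] sub V_sets W'_sets by auto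
      \<comment> \<open>As \<open>u n \<le> 1\<close>, both sets lie in \<open>{0..3}\<close>, which
        is too short for two disjoint sets of measure above 3/2.\<close>
      have "V n \<inter> W' \<noteq> {}"
      proof
        assume "V n \<inter> W' = {}"
        then have "measure lborel (V n \<union> W') = measure lborel (V n) + measure lborel W'"
          using fm V_sets W'_sets by (intro measure_Union) (auto simp: fmeasurable_def top.not_eq_extremum)
        moreover have "measure lborel (V n \<union> W') \<le> measure lborel {0..3::real}"
          using sub V_sets W'_sets by (intro measure_mono_fmeasurable) (auto intro: fmI)
        ultimately show False using V W mW' by simp
      qed
      then obtain y where y: "y \<in> V n" "y - u n \<in> W n" by (auto simp: W'_eq)
      have "\<bar>f (x n + y) - f (x n)\<bar> \<le> e / 3" "\<bar>f (z n + (y - u n)) - f (z n)\<bar> \<le> e / 3"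
        using y by (auto simp: V_def W_def)
      then show "dist (f (x n + u n) - f (x n)) 0 < e"
        using \<open>e > 0\<close> unfolding z_def dist_real_def by (simp add: algebra_simps) (smt (verit))
    qed
  qed
qed

text \<open>Uniform convergence theorem of Karamata theory. In logarithmic coordinates slow
  variation says that increments of \<open>ln (l (exp y))\<close> vanish; a failure of uniformity
  would produce bad points \<open>y n \<ge> real n\<close> with bounded shifts, against the
  sequential version.\<close>

lemma slowly_varying_locally_uniform:
  assumes l: "slowly_varying l" and e: "e > 0"
  shows "\<exists>x0>0. \<forall>x\<ge>x0. l x > 0 \<and> (\<forall>u\<in>{0..1}. \<bar>ln (l (x * exp u)) - ln (l x)\<bar> \<le> e)"
proof -
  define f where "f y = ln (l (exp y))" for y
  obtain b where b: "\<And>x. x \<ge> b \<Longrightarrow> l x > 0"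
    using l by (auto simp: slowly_varying_def eventually_at_top_linorder)
  have meas: "f \<in> borel_measurable borel"
  proof -
    have [measurable]: "l \<in> borel_measurable borel" using l by (simp add: slowly_varying_def)
    show ?thesis unfolding f_def by measurable
  qed
  have lim: "((\<lambda>y. f (y + h) - f y) \<longlongrightarrow> 0) at_top" for h
  proof -
    have "((\<lambda>x. l (exp h * x) / l x) \<longlongrightarrow> 1) at_top"
      using l by (simp add: slowly_varying_def)
    then have "((\<lambda>y. l (exp h * exp y) / l (exp y)) \<longlongrightarrow> 1) at_top"
      using exp_at_top by (rule filterlim_compose)
    then have "((\<lambda>y. ln (l (exp h * exp y) / l (exp y))) \<longlongrightarrow> ln 1) at_top"
      by (intro tendsto_ln) auto
    moreover have "\<forall>\<^sub>F y in at_top. ln (l (exp h * exp y) / l (exp y)) = f (y + h) - f y"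
    proof -
      have "\<forall>\<^sub>F y in at_top. exp y \<ge> b"
        using exp_at_top by (simp add: filterlim_at_top)
      moreover have "\<forall>\<^sub>F y in at_top. exp (y + h) \<ge> b"
        using filterlim_compose[OF exp_at_top filterlim_tendsto_add_at_top[OF tendsto_const[of h] filterlim_ident]]
        by (auto simp: filterlim_at_top add.commute)
      ultimately show ?thesis
      proof eventually_elim
        case (elim y)
        then show ?case
          using b[of "exp y"] b[of "exp (y + h)"] by (simp add: f_def ln_div exp_add mult.commute)
      qed
    qed
    ultimately show ?thesis
      by (simp add: tendsto_cong)
  qed
  have "\<exists>y0. \<forall>y\<ge>y0. \<forall>u\<in>{0..1}. \<bar>f (y + u) - f y\<bar> \<le> e"
  proof (rule ccontr)
    assume "\<not> ?thesis"
    then have "\<forall>n::nat. \<exists>y u. y \<ge> real n \<and> u \<in> {0..1} \<and> \<bar>f (y + u) - f y\<bar> > e"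
      by (meson not_le)
    then obtain y u where yu: "\<And>n. y n \<ge> real n" "\<And>n. u n \<in> {0..1}"
        "\<And>n::nat. \<bar>f (y n + u n) - f (y n)\<bar> > e"
      by metis
    have "filterlim y at_top sequentially"
      by (rule filterlim_at_top_mono[OF filterlim_real_sequentially]) (use yu in auto)
    from tendstoD[OF additive_uniform_convergence_seq[OF meas lim this yu(2)] e]
    have "\<forall>\<^sub>F n in sequentially. \<bar>f (y n + u n) - f (y n)\<bar> < e"
      by (simp add: dist_real_def)
    then show False
      using yu(3) by (auto simp: eventually_sequentially dest: less_asym)
  qed
  then obtain y0 where y0: "\<And>y u. y \<ge> y0 \<Longrightarrow> u \<in> {0..1} \<Longrightarrow> \<bar>f (y + u) - f y\<bar> \<le> e"
    by blast
  show ?thesis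
  proof (intro exI[of _ "max b (exp y0)"] conjI allI impI ballI)
    show "0 < max b (exp y0)" by (simp add: max.strict_coboundedI2)
    fix x assume x: "max b (exp y0) \<le> x"
    then have x': "x > 0" by (smt (verit) exp_gt_zero)
    show "0 < l x" using x b by simp
    fix u :: real assume u: "u \<in> {0..1}"
    have "ln x \<ge> y0"
      using x x' by (simp add: ln_ge_iff)
    from y0[OF this u] show "\<bar>ln (l (x * exp u)) - ln (l x)\<bar> \<le> e"
      using x' by (simp add: f_def exp_add)
  qed
qed

text \<open>Delta method. Caratheodory's factorisation \<open>f x = g x * x\<close> with g
  continuous at 0 avoids dividing by \<open>z n\<close>, which may vanish.\<close>

lemma tendsto_scaled_deriv:
  fixes f :: "'c \<Rightarrow> 'c::real_normed_field"
  assumes f: "(f has_field_derivative c) (at 0)" "f 0 = 0"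
    and z: "(z \<longlongrightarrow> 0) G" and sz: "((\<lambda>n. s n * z n) \<longlongrightarrow> L) G"
  shows "((\<lambda>n. s n * f (z n)) \<longlongrightarrow> c * L) G"
proof -
  obtain g where g: "\<And>x. f x = g x * x" "isCont g 0" "g 0 = c"
    using f unfolding CARAT_DERIV by auto
  have "((\<lambda>n. g (z n) * (s n * z n)) \<longlongrightarrow> c * L) G"
    using isCont_tendsto_compose[OF g(2) z] sz unfolding g(3) by (rule tendsto_mult)
  then show ?thesis by (simp add: g(1) mult_ac)
qed

text \<open>A negative shift from x is a positive one from \<open>x * exp u\<close>, provided that
  this point is still above x0; hence the extra factor \<open>exp 1\<close> in the
  threshold.\<close>

lemma slowly_varying_locally_uniform2:
  assumes l: "slowly_varying l" and e: "e > 0"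
  shows "\<forall>\<^sub>F x in at_top. \<forall>u. \<bar>u\<bar> \<le> 1 \<longrightarrow> \<bar>ln (l (x * exp u)) - ln (l x)\<bar> \<le> e"
proof -
  obtain x0 where x0: "x0 > 0" "\<And>x u. x \<ge> x0 \<Longrightarrow> u \<in> {0..1} \<Longrightarrow> \<bar>ln (l (x * exp u)) - ln (l x)\<bar> \<le> e"
    using slowly_varying_locally_uniform[OF l e] by blast
  show ?thesis
    using eventually_ge_at_top[of "x0 * exp 1"]
  proof eventually_elim
    case (elim x)
    have "x0 \<le> x" using elim x0(1) by (smt (verit) mult_le_cancel_left1 one_le_exp_iff)
    show ?case
    proof (intro allI impI)
      fix u :: real assume u: "\<bar>u\<bar> \<le> 1"
      have "x0 = x0 * exp 1 * exp (-1)" by (simp add: exp_minus)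
      also have "\<dots> \<le> x * exp u"
        using elim u x0(1) \<open>x0 \<le> x\<close> by (intro mult_mono) auto
      finally have le: "x0 \<le> x * exp u" .
      show "\<bar>ln (l (x * exp u)) - ln (l x)\<bar> \<le> e"
      proof (cases "u \<ge> 0")
        case True
        then show ?thesis using x0(2)[OF \<open>x0 \<le> x\<close>, of u] u by simp
      next
        case False
        have "\<bar>ln (l (x * exp u * exp (- u))) - ln (l (x * exp u))\<bar> \<le> e"
          using x0(2)[OF le, of "- u"] u False by simp
        then show ?thesis by (simp add: mult.assoc exp_minus_inverse abs_minus_commute)
      qed
    qed
  qed
qed

section \<open>The regularly varying remainder: a uniform bound and ratio limits\<close>

locale regular_remainder =
  fixes \<delta> l :: "real \<Rightarrow> real" and \<tau> :: real
  assumes sv: "slowly_varying l" and \<tau>: "\<tau> < 0"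
    and \<delta>_eq: "\<And>x. x > 0 \<Longrightarrow> \<bar>\<delta> x\<bar> = x powr \<tau> * l x"
    and \<delta>_sign: "(\<forall>\<^sub>F x in at_top. \<delta> x > 0) \<or> (\<forall>\<^sub>F x in at_top. \<delta> x < 0)"
begin

text \<open>Potter bound. Half of the exponent is spent on slow variation: a unit step on the log
  scale raises \<open>ln l\<close> by at most \<open>- \<tau> / 2\<close>, and at most u + 1 steps
  are taken, so \<open>exp (\<tau> * u)\<close> weakens to \<open>exp (\<tau> * u / 2)\<close> at
  the price of the factor \<open>exp (- \<tau> / 2)\<close>. Unlike the ratio limits, the bound is
  uniform over all \<open>u \<ge> 0\<close>.\<close>

lemma abs_remainder_bound:
  "\<exists>x0>0. \<forall>x\<ge>x0. \<delta> x \<noteq> 0 \<and> (\<forall>u\<ge>0. \<bar>\<delta> (x * exp u)\<bar> \<le> exp (- \<tau> / 2) * exp (\<tau> * u / 2) * \<bar>\<delta> x\<bar>)"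
proof -
  obtain x0 where x0: "x0 > 0" "\<And>x. x \<ge> x0 \<Longrightarrow> l x > 0"
    "\<And>x u. x \<ge> x0 \<Longrightarrow> u \<in> {0..1} \<Longrightarrow> \<bar>ln (l (x * exp u)) - ln (l x)\<bar> \<le> - \<tau> / 2"
    using slowly_varying_locally_uniform[OF sv, of "- \<tau> / 2"] \<tau> by auto
  have ln_bound: "ln (l (x * exp u)) - ln (l x) \<le> (real m + 1) * (- \<tau> / 2)"
    if "x \<ge> x0" "0 \<le> u" "u \<le> real m + 1" for x u m
    using that
  proof (induction m arbitrary: x u)
    case 0
    then show ?case using x0(3)[of x u] by (auto simp: abs_le_iff)
  next
    case (Suc m)
    show ?case
    proof (cases "u \<le> 1")
      case True
      have "ln (l (x * exp u)) - ln (l x) \<le> - \<tau> / 2"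
        using x0(3)[of x u] Suc.prems True by (auto simp: abs_le_iff)
      also have "\<dots> \<le> (real (Suc m) + 1) * (- \<tau> / 2)"
        using mult_right_mono[of 1 "real (Suc m) + 1" "- \<tau> / 2"] \<tau> by simp
      finally show ?thesis .
    next
      case False
      have ge: "x * exp 1 \<ge> x0"
        using Suc.prems x0(1) by (smt (verit) mult_le_cancel_left1 one_le_exp_iff)
      have "ln (l (x * exp 1 * exp (u - 1))) - ln (l (x * exp 1)) \<le> (real m + 1) * (- \<tau> / 2)"
        using False Suc.prems by (intro Suc.IH ge) auto
      moreover have "ln (l (x * exp 1)) - ln (l x) \<le> - \<tau> / 2"
        using x0(3)[of x 1] Suc.prems by (auto simp: abs_le_iff)
      ultimately show ?thesis by (simp add: mult_exp_exp mult.assoc algebra_simps add_divide_distrib)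
    qed
  qed
  show ?thesis
  proof (intro exI[of _ x0] conjI allI impI x0(1))
    fix x assume x: "x \<ge> x0"
    then have xpos: "x > 0" using x0(1) by simp
    then show "\<delta> x \<noteq> 0" using \<delta>_eq[of x] x0(2)[OF x] by auto
    fix u :: real assume u: "u \<ge> 0"
    have ge: "x * exp u \<ge> x0"
      using x u xpos by (smt (verit) mult_le_cancel_left1 one_le_exp_iff)
    have "ln (l (x * exp u)) - ln (l x) \<le> (real (nat \<lfloor>u\<rfloor>) + 1) * (- \<tau> / 2)"
      using u by (intro ln_bound x) linarith+
    also have "\<dots> \<le> (u + 1) * (- \<tau> / 2)"
      using u \<tau> by (intro mult_right_mono) auto
    finally have "ln (l (x * exp u)) \<le> ln (l x) + (u + 1) * (- \<tau> / 2)" by simp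
    then have "l (x * exp u) \<le> l x * exp ((u + 1) * (- \<tau> / 2))"
      using x0(2)[OF x] x0(2)[OF ge] by (metis exp_add exp_le_cancel_iff exp_ln)
    then have "\<bar>\<delta> (x * exp u)\<bar> \<le> (x * exp u) powr \<tau> * (l x * exp ((u + 1) * (- \<tau> / 2)))"
      using \<delta>_eq[of "x * exp u"] xpos by (simp add: mult_left_mono)
    also have "\<dots> = exp (- \<tau> / 2) * exp (\<tau> * u / 2) * \<bar>\<delta> x\<bar>"
      using \<delta>_eq[OF xpos] xpos
      by (simp add: powr_mult exp_powr_real algebra_simps flip: exp_add)
    finally show "\<bar>\<delta> (x * exp u)\<bar> \<le> exp (- \<tau> / 2) * exp (\<tau> * u / 2) * \<bar>\<delta> x\<bar>" .
  qed
qed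

text \<open>Only the modulus of \<delta> is tied to l; the eventual constant sign turns signed
  ratios into ratios of moduli.\<close>

lemma remainder_ratio_pos:
  assumes "filterlim x at_top G" "filterlim y at_top G"
  shows "\<forall>\<^sub>F n in G. \<delta> (x n) / \<delta> (y n) = \<bar>\<delta> (x n)\<bar> / \<bar>\<delta> (y n)\<bar>"
proof -
  have "\<forall>\<^sub>F z in at_top. \<delta> z > 0 \<Longrightarrow> ?thesis"
    using eventually_compose_filterlim[OF _ assms(1), of "\<lambda>z. \<delta> z > 0"]
      eventually_compose_filterlim[OF _ assms(2), of "\<lambda>z. \<delta> z > 0"]
    by (auto elim: eventually_elim2)
  moreover have "\<forall>\<^sub>F z in at_top. \<delta> z < 0 \<Longrightarrow> ?thesis"
    using eventually_compose_filterlim[OF _ assms(1), of "\<lambda>z. \<delta> z < 0"]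
      eventually_compose_filterlim[OF _ assms(2), of "\<lambda>z. \<delta> z < 0"]
    by (auto elim: eventually_elim2)
  ultimately show ?thesis using \<delta>_sign by blast
qed

lemma remainder_ratio_fixed:
  assumes x: "filterlim x at_top G"
  shows "((\<lambda>n. \<delta> (x n * exp u) / \<delta> (x n)) \<longlongrightarrow> exp (\<tau> * u)) G"
proof -
  have xu: "filterlim (\<lambda>n. x n * exp u) at_top G"
    by (rule filterlim_at_top_mult_tendsto_pos[OF tendsto_const _ x]) simp
  have "((\<lambda>n. exp (\<tau> * u) * (l (exp u * x n) / l (x n))) \<longlongrightarrow> exp (\<tau> * u) * 1) G"
    using sv by (intro tendsto_mult tendsto_const filterlim_compose[OF _ x])
      (auto simp: slowly_varying_def)
  moreover have "\<forall>\<^sub>F n in G. \<delta> (x n * exp u) / \<delta> (x n) = exp (\<tau> * u) * (l (exp u * x n) / l (x n))"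
    using remainder_ratio_pos[OF xu x] eventually_compose_filterlim[OF eventually_gt_at_top[of 0] x]
  proof eventually_elim
    case (elim n)
    then show ?case
      by (simp add: \<delta>_eq powr_mult exp_powr_real mult.commute)
  qed
  ultimately show ?thesis by (simp add: tendsto_cong)
qed

text \<open>For shifts that move with n the pointwise limit does not suffice; local uniformity of l
  enters here. Such shifts arise at the quantile and in windows of width 1 / sqrt k.\<close>

lemma remainder_ratio_local:
  assumes x: "filterlim x at_top G" and u: "(u \<longlongrightarrow> 0) G"
  shows "((\<lambda>n. \<delta> (x n * exp (u n)) / \<delta> (x n)) \<longlongrightarrow> 1) G"
proof -
  have xu: "filterlim (\<lambda>n. x n * exp (u n)) at_top G"
    by (rule filterlim_at_top_mult_tendsto_pos[OF _ _ x, of _ "exp 0"]) (use tendsto_exp[OF u] in simp_all)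
  have lpos: "\<forall>\<^sub>F z in at_top. l z > 0" using sv by (simp add: slowly_varying_def)
  have ln0: "((\<lambda>n. ln (l (x n * exp (u n))) - ln (l (x n))) \<longlongrightarrow> 0) G"
  proof (rule tendstoI)
    fix e :: real assume "e > 0"
    then have e: "e / 2 > 0" by simp
    have "\<forall>\<^sub>F n in G. \<bar>u n\<bar> < 1" using tendstoD[OF u, of 1] by (simp add: dist_real_def)
    with eventually_compose_filterlim[OF slowly_varying_locally_uniform2[OF sv e] x]
    show "\<forall>\<^sub>F n in G. dist (ln (l (x n * exp (u n))) - ln (l (x n))) 0 < e"
    proof eventually_elim
      case (elim n)
      then have "\<bar>ln (l (x n * exp (u n))) - ln (l (x n))\<bar> \<le> e / 2" by simp
      then show ?case using \<open>e > 0\<close> by (simp add: dist_real_def)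
    qed
  qed
  have "((\<lambda>n. exp (\<tau> * u n) * exp (ln (l (x n * exp (u n))) - ln (l (x n)))) \<longlongrightarrow> exp (\<tau> * 0) * exp 0) G"
    by (intro tendsto_intros u ln0)
  moreover have "\<forall>\<^sub>F n in G. \<delta> (x n * exp (u n)) / \<delta> (x n) = exp (\<tau> * u n) * exp (ln (l (x n * exp (u n))) - ln (l (x n)))"
    using remainder_ratio_pos[OF xu x] eventually_compose_filterlim[OF eventually_gt_at_top[of 0] x]
      eventually_compose_filterlim[OF lpos x] eventually_compose_filterlim[OF lpos xu]
  proof eventually_elim
    case (elim n)
    then show ?case
      by (simp add: \<delta>_eq powr_mult exp_powr_real exp_diff mult.commute)
  qed
  ultimately show ?thesis by (simp add: tendsto_cong)
qed

end

subsection \<open>The tail at the intermediate threshold\<close>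

lemma tendsto_0_of_scaled:
  fixes s z :: "'b \<Rightarrow> real"
  assumes "((\<lambda>n. s n * z n) \<longlongrightarrow> L) G" "filterlim s at_top G"
  shows "(z \<longlongrightarrow> 0) G"
proof -
  have "((\<lambda>n. (s n * z n) / s n) \<longlongrightarrow> 0) G"
    using assms by (rule real_tendsto_divide_at_top)
  moreover have "\<forall>\<^sub>F n in G. (s n * z n) / s n = z n"
    using eventually_compose_filterlim[OF eventually_gt_at_top[of 0] assms(2)]
    by eventually_elim simp
  ultimately show ?thesis by (simp add: tendsto_cong)
qed

text \<open>\<open>Inf\<close> needs a nonempty set that is bounded below; the limits of the cdf at
  both ends provide this. The strict inequalities on y match the later use, where the quantile is
  approached from both sides.\<close>

lemma quantile_cdf:
  assumes N: "real_distribution N" and p: "0 < p" "p < 1"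
  shows "y > quantile (cdf N) p \<Longrightarrow> cdf N y \<ge> p"
    and "y < quantile (cdf N) p \<Longrightarrow> cdf N y < p"
proof -
  interpret real_distribution N by (rule N)
  have "\<forall>\<^sub>F x in at_top. cdf N x > p"
    using cdf_lim_at_top_prob p(2) by (rule order_tendstoD)
  then obtain b where b: "cdf N b \<ge> p"
    by (metis eventually_at_top_linorder less_imp_le order_refl)
  have "\<forall>\<^sub>F x in at_bot. cdf N x < p"
    using cdf_lim_at_bot p(1) by (rule order_tendstoD)
  then obtain c where c: "\<And>x. x \<le> c \<Longrightarrow> cdf N x < p"
    by (auto simp: eventually_at_bot_linorder)
  have bdd: "bdd_below {x. cdf N x \<ge> p}"
    by (rule bdd_belowI[of _ c]) (use c in \<open>force simp: not_less[symmetric]\<close>)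
  show "cdf N y \<ge> p" if "y > quantile (cdf N) p"
  proof -
    have "\<exists>x\<in>{x. cdf N x \<ge> p}. x < y"
      using that bdd b unfolding quantile_def by (subst (asm) cInf_less_iff) auto
    then show ?thesis using cdf_nondecreasing[of _ y] by (auto intro: order_trans)
  qed
  show "cdf N y < p" if "y < quantile (cdf N) p"
  proof (rule ccontr)
    assume "\<not> cdf N y < p"
    then have "quantile (cdf N) p \<le> y"
      unfolding quantile_def by (intro cInf_lower bdd) auto
    with that show False by simp
  qed
qed

text \<open>The point at which the leading term \<open>C x powr (- 1 / \<xi>)\<close> of the tail equals \<open>k / n\<close>.\<close>
definition threshold :: "real \<Rightarrow> real \<Rightarrow> (nat \<Rightarrow> nat) \<Rightarrow> nat \<Rightarrow> real" where
  "threshold \<xi> C k n = (C * (real n / real (k n))) powr \<xi>"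

locale heavy_tail = regular_remainder +
  fixes \<xi> C L :: real and N :: "real measure" and k :: "nat \<Rightarrow> nat"
  assumes \<xi>: "\<xi> > 0" and C: "C > 0" and N: "real_distribution N"
    and tail: "\<And>x. x > 0 \<Longrightarrow> 1 - cdf N x = C * x powr (- (1 / \<xi>)) * (1 + \<delta> x / \<xi>)"
    and k: "filterlim k at_top sequentially"
    and kn: "(\<lambda>n. real (k n) / real n) \<longlonglongrightarrow> 0"
    and a_lim: "(\<lambda>n. sqrt (real (k n)) * a_fun \<xi> C (cdf N) (real n / real (k n))) \<longlonglongrightarrow> L"
begin

abbreviation t where "t n \<equiv> threshold \<xi> C k n"

abbreviation root_k where "root_k n \<equiv> sqrt (real (k n))"

text \<open>The expected number of exceedances of \<open>t n * exp w\<close> among n observations,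
  in units of \<open>k n\<close>. Its limit \<open>exp (- (w / \<xi>))\<close> is the tail of an
  exponential variable with mean \<xi>.\<close>

definition scaled_tail :: "nat \<Rightarrow> real \<Rightarrow> real" where
  "scaled_tail n w = real n / real (k n) * (1 - cdf N (t n * exp w))"

lemma sqrt_k: "filterlim (\<lambda>n. root_k n) at_top sequentially"
  by (intro filterlim_compose[OF sqrt_at_top] filterlim_compose[OF filterlim_real_sequentially k])

lemma k_pos: "\<forall>\<^sub>F n in sequentially. k n > 0"
  using eventually_compose_filterlim[OF eventually_gt_at_top[of 0] k] .

lemma k_less: "\<forall>\<^sub>F n in sequentially. k n < n"
  using order_tendstoD(2)[OF kn zero_less_one] eventually_gt_at_top[of 0]
  by eventually_elim (simp add: field_simps)

lemma n_over_k: "filterlim (\<lambda>n. real n / real (k n)) at_top sequentially"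
proof -
  have "filterlim (\<lambda>n. inverse (real (k n) / real n)) at_top sequentially"
  proof (rule filterlim_inverse_at_top[OF kn])
    show "\<forall>\<^sub>F n in sequentially. 0 < real (k n) / real n"
      using k_pos eventually_gt_at_top[of 0] by eventually_elim simp
  qed
  then show ?thesis by simp
qed

lemma threshold_at_top: "filterlim t at_top sequentially"
proof -
  have "filterlim (\<lambda>x. (C * x) powr \<xi>) at_top at_top"
    using \<xi> C by real_asymp
  from filterlim_compose[OF this n_over_k] show ?thesis
    unfolding threshold_def .
qed

lemma threshold_pos: "k n > 0 \<Longrightarrow> k n < n \<Longrightarrow> t n > 0"
  using C by (simp add: threshold_def)

lemma scaled_tail_eq:
  assumes "k n > 0" "k n < n"
  shows "scaled_tail n w = exp (- (w / \<xi>)) * (1 + \<delta> (t n * exp w) / \<xi>)"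
proof -
  have "t n powr (- (1 / \<xi>)) = (C * (real n / real (k n))) powr (- 1)"
    using \<xi> by (simp add: threshold_def powr_powr)
  also have "\<dots> = real (k n) / (C * real n)"
    using assms C by (simp add: powr_minus_divide)
  finally have 1: "t n powr (- (1 / \<xi>)) = real (k n) / (C * real n)" .
  have "scaled_tail n w = real n / real (k n) *
      (C * (t n * exp w) powr (- (1 / \<xi>)) * (1 + \<delta> (t n * exp w) / \<xi>))"
    using threshold_pos[OF assms] by (simp add: scaled_tail_def tail)
  also have "(t n * exp w) powr (- (1 / \<xi>)) = real (k n) / (C * real n) * exp (- (w / \<xi>))"
    using threshold_pos[OF assms] by (simp add: powr_mult exp_powr_real 1)
  finally show ?thesis using assms C by simp
qed

text \<open>The quantile at level 1 - k/n is \<open>t n * exp (v n)\<close> with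
  \<open>v n = ln (1 + a n)\<close>. If the tail there were exactly k/n,
  \<open>scaled_tail_eq\<close> would give \<open>1 + \<delta> / \<xi> = exp (v / \<xi>)\<close>,
  that is, \<delta> close to v and so to a. A possible jump of F leaves two inequalities at
  neighbouring points, between which the claim is squeezed.\<close>

lemma remainder_threshold_lim: "(\<lambda>n. root_k n * \<delta> (t n)) \<longlonglongrightarrow> L"
proof -
  define s where "s n = root_k n" for n
  define a where "a n = a_fun \<xi> C (cdf N) (real n / real (k n))" for n
  define v where "v n = ln (1 + a n)" for n
  \<comment> \<open>Positive for \<open>k n > 0\<close>, so that the quantile is passed strictly,
    and negligible even after multiplication by sqrt k.\<close>
  define h where "h n = 1 / real (k n)" for n
  define U where "U n = quantile (cdf N) (1 - 1 / (real n / real (k n)))" for n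
  have s: "filterlim s at_top sequentially" using sqrt_k unfolding s_def .
  have sa: "(\<lambda>n. s n * a n) \<longlonglongrightarrow> L" using a_lim by (simp add: s_def a_def)
  have a0: "a \<longlonglongrightarrow> 0" by (rule tendsto_0_of_scaled[OF sa s])
  have sv: "(\<lambda>n. s n * v n) \<longlonglongrightarrow> L"
  proof -
    have "((\<lambda>x::real. ln (1 + x)) has_real_derivative 1) (at 0)"
      by (auto intro!: derivative_eq_intros)
    from tendsto_scaled_deriv[OF this _ a0 sa] show ?thesis by (simp add: v_def)
  qed
  have sh: "(\<lambda>n. s n * h n) \<longlonglongrightarrow> 0"
  proof -
    have "(\<lambda>n. inverse (s n)) \<longlonglongrightarrow> 0" using s by (rule tendsto_inverse_0_at_top)
    moreover have "s n * h n = inverse (s n)" for n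
      by (cases "k n = 0") (auto simp: s_def h_def field_simps simp flip: power2_eq_square)
    ultimately show ?thesis by simp
  qed
  have svp: "(\<lambda>n. s n * (v n + h n)) \<longlonglongrightarrow> L" and svm: "(\<lambda>n. s n * (v n - h n)) \<longlonglongrightarrow> L"
    using tendsto_add[OF sv sh] tendsto_diff[OF sv sh] by (simp_all add: algebra_simps)
  have lim0: "(\<lambda>n. v n + h n) \<longlonglongrightarrow> 0" "(\<lambda>n. v n - h n) \<longlonglongrightarrow> 0"
    by (rule tendsto_0_of_scaled[OF svp s], rule tendsto_0_of_scaled[OF svm s])
  have E: "(\<lambda>n. s n * (\<xi> * (exp (z n / \<xi>) - 1))) \<longlonglongrightarrow> L"
    if "(\<lambda>n. s n * z n) \<longlonglongrightarrow> L" "z \<longlonglongrightarrow> 0" for z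
  proof -
    have "((\<lambda>x. \<xi> * (exp (x / \<xi>) - 1)) has_real_derivative 1) (at 0)"
      using \<xi> by (auto intro!: derivative_eq_intros)
    from tendsto_scaled_deriv[OF this _ that(2,1)] show ?thesis by simp
  qed
  \<comment> \<open>These ratios carry the inequalities from the shifted points back to
    \<open>t n\<close>.\<close>
  define rp where "rp n = \<delta> (t n * exp (v n + h n)) / \<delta> (t n)" for n
  define rm where "rm n = \<delta> (t n * exp (v n - h n)) / \<delta> (t n)" for n
  have rp: "rp \<longlonglongrightarrow> 1" and rm: "rm \<longlonglongrightarrow> 1"
    unfolding rp_def rm_def by (intro remainder_ratio_local[OF threshold_at_top] lim0)+
  have up: "(\<lambda>n. s n * (\<xi> * (exp ((v n + h n) / \<xi>) - 1)) / rp n) \<longlonglongrightarrow> L"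
    using tendsto_divide[OF E[OF svp lim0(1)] rp] by simp
  have lo: "(\<lambda>n. s n * (\<xi> * (exp ((v n - h n) / \<xi>) - 1)) / rm n) \<longlonglongrightarrow> L"
    using tendsto_divide[OF E[OF svm lim0(2)] rm] by simp
  obtain x0 where x0: "\<And>x. x \<ge> x0 \<Longrightarrow> \<delta> x \<noteq> 0" using abs_remainder_bound by blast
  have ev: "\<forall>\<^sub>F n in sequentially. k n > 0 \<and> k n < n \<and> \<delta> (t n) \<noteq> 0 \<and> rp n > 0 \<and> rm n > 0 \<and> \<bar>a n\<bar> < 1"
    using k_pos k_less eventually_compose_filterlim[OF eventually_ge_at_top[of x0] threshold_at_top]
      order_tendstoD(1)[OF rp zero_less_one] order_tendstoD(1)[OF rm zero_less_one] tendstoD[OF a0 zero_less_one]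
    by (simp, eventually_elim) (use x0 in auto)
  have "\<forall>\<^sub>F n in sequentially. s n * (\<xi> * (exp ((v n - h n) / \<xi>) - 1)) / rm n \<le> s n * \<delta> (t n)
      \<and> s n * \<delta> (t n) \<le> s n * (\<xi> * (exp ((v n + h n) / \<xi>) - 1)) / rp n"
    using ev
  proof eventually_elim
    case (elim n)
    then have k0: "k n > 0" "k n < n" by auto
    have tpos: "t n > 0" by (rule threshold_pos[OF k0])
    have "U n = t n * (1 + a n)"
      using k0 C by (simp add: U_def a_def a_fun_def threshold_def powr_mult powr_divide)
    moreover have "1 + a n > 0" using elim by (auto simp: abs_less_iff)
    ultimately have Un: "U n = t n * exp (v n)" by (simp add: v_def)
    have hpos: "h n > 0" using k0 by (simp add: h_def)
    have spos: "s n > 0" using k0 by (simp add: s_def)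
    have p: "0 < 1 - 1 / (real n / real (k n))" "1 - 1 / (real n / real (k n)) < 1"
      using k0 by (simp_all add: field_simps)
    have "cdf N (t n * exp (v n + h n)) \<ge> 1 - 1 / (real n / real (k n))"
      using hpos tpos Un by (intro quantile_cdf(1)[OF N p]) (simp add: U_def)
    then have "scaled_tail n (v n + h n) \<le> 1"
      using k0 by (simp add: scaled_tail_def field_simps)
    then have "1 + \<delta> (t n * exp (v n + h n)) / \<xi> \<le> exp ((v n + h n) / \<xi>)"
      using k0 by (simp add: scaled_tail_eq exp_minus field_simps)
    then have "rp n * \<delta> (t n) \<le> \<xi> * (exp ((v n + h n) / \<xi>) - 1)"
      using elim \<xi> by (simp add: rp_def field_simps)
    then have 1: "s n * (\<delta> (t n) * rp n) \<le> s n * (\<xi> * (exp ((v n + h n) / \<xi>) - 1))"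
      using spos by (intro mult_left_mono) (auto simp: mult.commute)
    have "cdf N (t n * exp (v n - h n)) < 1 - 1 / (real n / real (k n))"
      using hpos tpos Un by (intro quantile_cdf(2)[OF N p]) (simp add: U_def)
    then have "scaled_tail n (v n - h n) \<ge> 1"
      using k0 by (simp add: scaled_tail_def field_simps)
    then have "1 + \<delta> (t n * exp (v n - h n)) / \<xi> \<ge> exp ((v n - h n) / \<xi>)"
      using k0 by (simp add: scaled_tail_eq exp_minus field_simps)
    then have "rm n * \<delta> (t n) \<ge> \<xi> * (exp ((v n - h n) / \<xi>) - 1)"
      using elim \<xi> by (simp add: rm_def field_simps)
    then have "s n * (\<delta> (t n) * rm n) \<ge> s n * (\<xi> * (exp ((v n - h n) / \<xi>) - 1))"
      using spos by (intro mult_left_mono) (auto simp: mult.commute)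
    with 1 show ?case
      using elim by (simp add: pos_divide_le_eq pos_le_divide_eq mult.assoc)
  qed
  then have "\<forall>\<^sub>F n in sequentially. s n * (\<xi> * (exp ((v n - h n) / \<xi>) - 1)) / rm n \<le> s n * \<delta> (t n)"
    "\<forall>\<^sub>F n in sequentially. s n * \<delta> (t n) \<le> s n * (\<xi> * (exp ((v n + h n) / \<xi>) - 1)) / rp n"
    by (auto elim: eventually_mono)
  from tendsto_sandwich[OF this lo up] show ?thesis by (simp add: s_def)
qed

text \<open>The Potter bound makes the deviation uniform in w, with the decay of the exponential
  tail itself. This is the majorant for dominated convergence and for the moments of the tail
  process.\<close>

lemma scaled_tail_bound:
  "\<exists>K\<ge>0. \<forall>\<^sub>F n in sequentially. \<forall>w\<ge>0.
     root_k n * \<bar>scaled_tail n w - exp (- (w / \<xi>))\<bar> \<le> K * exp (- (w / \<xi>))"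
proof -
  obtain x0 where x0: "\<And>x u. x \<ge> x0 \<Longrightarrow> u \<ge> 0 \<Longrightarrow> \<bar>\<delta> (x * exp u)\<bar> \<le> exp (- \<tau> / 2) * exp (\<tau> * u / 2) * \<bar>\<delta> x\<bar>"
    using abs_remainder_bound by blast
  have "\<forall>\<^sub>F n in sequentially. \<bar>root_k n * \<delta> (t n)\<bar> < \<bar>L\<bar> + 1"
    by (rule order_tendstoD(2)[OF tendsto_rabs[OF remainder_threshold_lim]]) simp
  then have "\<forall>\<^sub>F n in sequentially. \<forall>w\<ge>0. root_k n * \<bar>scaled_tail n w - exp (- (w / \<xi>))\<bar>
      \<le> (exp (- \<tau> / 2) * (\<bar>L\<bar> + 1) / \<xi>) * exp (- (w / \<xi>))"
    using k_pos k_less eventually_compose_filterlim[OF eventually_ge_at_top[of x0] threshold_at_top]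
  proof eventually_elim
    case (elim n)
    show ?case
    proof (intro allI impI)
      fix w :: real assume w: "w \<ge> 0"
      have "exp (\<tau> * w / 2) \<le> 1" using w \<tau> by (simp add: mult_nonpos_nonneg)
      then have "\<bar>\<delta> (t n * exp w)\<bar> \<le> exp (- \<tau> / 2) * 1 * \<bar>\<delta> (t n)\<bar>"
        using elim w by (intro order_trans[OF x0[of "t n" w]] mult_right_mono mult_left_mono) auto
      then have "root_k n * \<bar>\<delta> (t n * exp w)\<bar> \<le> root_k n * (exp (- \<tau> / 2) * \<bar>\<delta> (t n)\<bar>)"
        by (intro mult_left_mono) auto
      also have "\<dots> = exp (- \<tau> / 2) * \<bar>root_k n * \<delta> (t n)\<bar>"
        by (simp add: abs_mult)
      also have "\<dots> \<le> exp (- \<tau> / 2) * (\<bar>L\<bar> + 1)"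
        using elim by (intro mult_left_mono) auto
      finally have *: "root_k n * \<bar>\<delta> (t n * exp w)\<bar> \<le> exp (- \<tau> / 2) * (\<bar>L\<bar> + 1)" .
      have "root_k n * \<bar>scaled_tail n w - exp (- (w / \<xi>))\<bar>
          = (root_k n * \<bar>\<delta> (t n * exp w)\<bar>) / \<xi> * exp (- (w / \<xi>))"
        using elim \<xi> by (simp add: scaled_tail_eq algebra_simps abs_mult)
      also have "\<dots> \<le> (exp (- \<tau> / 2) * (\<bar>L\<bar> + 1)) / \<xi> * exp (- (w / \<xi>))"
        using * \<xi> by (intro mult_right_mono divide_right_mono) auto
      finally show "root_k n * \<bar>scaled_tail n w - exp (- (w / \<xi>))\<bar>
          \<le> (exp (- \<tau> / 2) * (\<bar>L\<bar> + 1)) / \<xi> * exp (- (w / \<xi>))" .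
    qed
  qed
  then show ?thesis using \<xi> by (intro exI[of _ "exp (- \<tau> / 2) * (\<bar>L\<bar> + 1) / \<xi>"]) auto
qed

text \<open>Two factors combine: \<delta> at the threshold, of order 1 / sqrt k, and the ratio
  \<open>\<delta> (t n * exp w) / \<delta> (t n)\<close>, which tends to
  \<open>exp (\<tau> * w)\<close>.\<close>

lemma scaled_tail_bias:
  "(\<lambda>n. root_k n * (scaled_tail n w - exp (- (w / \<xi>)))) \<longlonglongrightarrow> L / \<xi> * exp (- (w / \<xi>)) * exp (\<tau> * w)"
proof -
  have "(\<lambda>n. exp (- (w / \<xi>)) / \<xi> * ((root_k n * \<delta> (t n)) * (\<delta> (t n * exp w) / \<delta> (t n))))
      \<longlonglongrightarrow> exp (- (w / \<xi>)) / \<xi> * (L * exp (\<tau> * w))"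
    by (intro tendsto_intros remainder_threshold_lim remainder_ratio_fixed threshold_at_top)
  moreover obtain x0 where x0: "\<And>x. x \<ge> x0 \<Longrightarrow> \<delta> x \<noteq> 0" using abs_remainder_bound by blast
  have "\<forall>\<^sub>F n in sequentially. exp (- (w / \<xi>)) / \<xi> * ((root_k n * \<delta> (t n)) * (\<delta> (t n * exp w) / \<delta> (t n)))
    = root_k n * (scaled_tail n w - exp (- (w / \<xi>)))"
    using k_pos k_less eventually_compose_filterlim[OF eventually_ge_at_top[of x0] threshold_at_top]
    by eventually_elim (use x0 in \<open>auto simp: scaled_tail_eq algebra_simps\<close>)
  ultimately show ?thesis by (simp add: tendsto_cong mult_ac)
qed

text \<open>In a window of width 1 / sqrt k the exponential tail contributes its slope
  \<open>- 1 / \<xi>\<close> at 0, and the remainder contributes its value at the threshold.\<close>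

lemma scaled_tail_local:
  "(\<lambda>n. root_k n * (scaled_tail n (x / root_k n) - 1)) \<longlonglongrightarrow> (L - x) / \<xi>"
proof -
  define s where "s n = root_k n" for n
  have s: "filterlim s at_top sequentially" using sqrt_k unfolding s_def .
  define u where "u n = x / s n" for n
  have u0: "u \<longlonglongrightarrow> 0"
    unfolding u_def by (rule real_tendsto_divide_at_top[OF tendsto_const s])
  have "\<forall>\<^sub>F n in sequentially. x = s n * u n"
    using eventually_compose_filterlim[OF eventually_gt_at_top[of 0] s]
    by eventually_elim (simp add: u_def)
  then have su: "(\<lambda>n. s n * u n) \<longlonglongrightarrow> x" by (rule Lim_transform_eventually[OF tendsto_const])
  have "(\<lambda>n. s n * (exp (- (u n / \<xi>)) - 1)) \<longlonglongrightarrow> (- 1 / \<xi>) * x"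
  proof -
    have "((\<lambda>x. exp (- (x / \<xi>)) - 1) has_real_derivative (- 1 / \<xi>)) (at 0)"
      using \<xi> by (auto intro!: derivative_eq_intros)
    from tendsto_scaled_deriv[OF this _ u0 su] show ?thesis by simp
  qed
  moreover have "(\<lambda>n. exp (- (u n / \<xi>)) / \<xi> * ((s n * \<delta> (t n)) * (\<delta> (t n * exp (u n)) / \<delta> (t n))))
      \<longlonglongrightarrow> exp (- (0 / \<xi>)) / \<xi> * (L * 1)"
    using \<xi> remainder_threshold_lim
    by (intro tendsto_intros u0 remainder_ratio_local threshold_at_top) (auto simp: s_def)
  ultimately have "(\<lambda>n. s n * (exp (- (u n / \<xi>)) - 1)
      + exp (- (u n / \<xi>)) / \<xi> * ((s n * \<delta> (t n)) * (\<delta> (t n * exp (u n)) / \<delta> (t n))))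
      \<longlonglongrightarrow> (- 1 / \<xi>) * x + exp (- (0 / \<xi>)) / \<xi> * (L * 1)"
    by (rule tendsto_add)
  moreover obtain x0 where x0: "\<And>x. x \<ge> x0 \<Longrightarrow> \<delta> x \<noteq> 0" using abs_remainder_bound by blast
  have "\<forall>\<^sub>F n in sequentially. s n * (exp (- (u n / \<xi>)) - 1)
      + exp (- (u n / \<xi>)) / \<xi> * ((s n * \<delta> (t n)) * (\<delta> (t n * exp (u n)) / \<delta> (t n)))
    = s n * (scaled_tail n (u n) - 1)"
    using k_pos k_less eventually_compose_filterlim[OF eventually_ge_at_top[of x0] threshold_at_top]
    by eventually_elim (use x0 in \<open>auto simp: scaled_tail_eq algebra_simps\<close>)
  ultimately have "(\<lambda>n. s n * (scaled_tail n (u n) - 1)) \<longlonglongrightarrow> (- 1 / \<xi>) * x + exp (- (0 / \<xi>)) / \<xi> * (L * 1)"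
    by (simp add: tendsto_cong)
  then show ?thesis by (simp add: s_def u_def diff_divide_distrib)
qed

end

subsection \<open>Convergence in probability as a filter\<close>

abbreviation (input) nearly_all :: "'a measure \<Rightarrow> real \<Rightarrow> (nat \<times> 'a \<Rightarrow> bool) \<Rightarrow> bool" where
  "nearly_all M e P \<equiv> \<forall>\<^sub>F n in sequentially.
     \<exists>B\<in>sets M. measure M B < e \<and> (\<forall>\<omega>\<in>space M - B. P (n, \<omega>))"

text \<open>A property of pairs \<open>(n, \<omega>)\<close> holds eventually if the outer probability of its failure
  tends to 0.  Convergence in probability is then convergence along this filter, and the calculus of
  limits is available for it, without measurability side conditions.\<close>
definition in_prob :: "'a measure \<Rightarrow> (nat \<times> 'a) filter" where
  "in_prob M = Abs_filter (\<lambda>P. \<forall>e>0. nearly_all M e P)"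

definition tight_in_prob :: "'a measure \<Rightarrow> (nat \<times> 'a \<Rightarrow> real) \<Rightarrow> bool" where
  "tight_in_prob M Z \<longleftrightarrow> (\<forall>e>0. \<exists>K. nearly_all M e (\<lambda>p. \<bar>Z p\<bar> \<le> K))"

context prob_space
begin

lemma union_small:
  assumes "nearly_all M (e / 2) P"
    and "nearly_all M (e / 2) Q"
    and "\<And>p. P p \<Longrightarrow> Q p \<Longrightarrow> R p"
  shows "nearly_all M e R"
  using assms(1,2)
proof eventually_elim
  case (elim n)
  then obtain A B where "A \<in> sets M" "B \<in> sets M" "measure M A < e / 2" "measure M B < e / 2"
    "\<forall>\<omega>\<in>space M - A. P (n, \<omega>)" "\<forall>\<omega>\<in>space M - B. Q (n, \<omega>)" by blast
  then show ?case
    using measure_Un_le[of A M B] assms(3) by (intro bexI[of _ "A \<union> B"]) auto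
qed

text \<open>\<open>Abs_filter\<close> can be unfolded only for a genuine filter. For closure under
  conjunction each conjunct gets half of the error probability.\<close>

lemma eventually_in_prob:
  "eventually P (in_prob M) \<longleftrightarrow> (\<forall>e>0. nearly_all M e P)"
  unfolding in_prob_def
proof (rule eventually_Abs_filter, rule is_filter.intro)
  show "\<forall>e>0. nearly_all M e (\<lambda>p. True)"
    by (auto intro!: always_eventually bexI[of _ "{}"])
next
  fix P Q :: "nat \<times> 'a \<Rightarrow> bool"
  assume P: "\<forall>e>0. nearly_all M e P"
    and Q: "\<forall>e>0. nearly_all M e Q"
  show "\<forall>e>0. nearly_all M e (\<lambda>p. P p \<and> Q p)"
  proof (intro allI impI)
    fix e :: real assume "e > 0"
    then have e: "e / 2 > 0" by simp
    show "nearly_all M e (\<lambda>p. P p \<and> Q p)"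
    proof (rule union_small[where P = P and Q = Q and R = "\<lambda>p. P p \<and> Q p"])
      show "nearly_all M (e / 2) P"
        by (rule P[THEN spec, THEN mp, OF e])
      show "nearly_all M (e / 2) Q"
        by (rule Q[THEN spec, THEN mp, OF e])
    qed simp
  qed
next
  fix P Q :: "nat \<times> 'a \<Rightarrow> bool"
  assume PQ: "\<forall>p. P p \<longrightarrow> Q p"
    and P: "\<forall>e>0. nearly_all M e P"
  show "\<forall>e>0. nearly_all M e Q"
  proof (intro allI impI)
    fix e :: real assume "e > 0"
    from P[THEN spec, THEN mp, OF this]
    show "nearly_all M e Q"
    proof eventually_elim
      case (elim n)
      then obtain B where "B \<in> sets M" "measure M B < e" "\<forall>\<omega>\<in>space M - B. P (n, \<omega>)" by (elim bexE conjE)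
      with PQ show ?case by (intro bexI[of _ B]) auto
    qed
  qed
qed

lemma filterlim_fst_in_prob: "filterlim fst sequentially (in_prob M)"
  unfolding filterlim_iff eventually_in_prob
  by (auto elim!: eventually_mono intro!: bexI[of _ "{}"])

lemma eventually_snd_in_prob: "\<forall>\<^sub>F p in in_prob M. snd p \<in> space M"
  unfolding eventually_in_prob by (auto intro!: always_eventually bexI[of _ "{}"])

lemma eventually_fst_in_prob: "eventually P sequentially \<Longrightarrow> \<forall>\<^sub>F p in in_prob M. P (fst p)"
  by (rule eventually_compose_filterlim[OF _ filterlim_fst_in_prob])

lemma tendsto_fst_in_prob: "filterlim c G sequentially \<Longrightarrow> filterlim (\<lambda>p. c (fst p)) G (in_prob M)"
  by (rule filterlim_compose[OF _ filterlim_fst_in_prob])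

lemma tendsto_in_probI:
  assumes "\<And>n. Z n \<in> borel_measurable M" "conv_in_prob M Z c"
  shows "((\<lambda>p. Z (fst p) (snd p)) \<longlongrightarrow> c) (in_prob M)"
proof (rule tendstoI)
  fix e :: real assume e: "e > 0"
  show "\<forall>\<^sub>F p in in_prob M. dist (Z (fst p) (snd p)) c < e"
    unfolding eventually_in_prob
  proof (intro allI impI)
    fix d :: real assume d: "d > 0"
    have "(\<lambda>n. measure M {\<omega> \<in> space M. \<bar>Z n \<omega> - c\<bar> > e / 2}) \<longlonglongrightarrow> 0"
      using assms(2) half_gt_zero[OF e] unfolding conv_in_prob_def by blast
    from order_tendstoD(2)[OF this d]
    show "nearly_all M d (\<lambda>p. dist (Z (fst p) (snd p)) c < e)"
    proof eventually_elim
      case (elim n)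
      have "{\<omega> \<in> space M. \<bar>Z n \<omega> - c\<bar> > e / 2} \<in> sets M" using assms(1)[of n] by measurable
      with elim e show ?case by (intro bexI) (auto simp: dist_real_def)
    qed
  qed
qed

lemma square_tendsto_0_in_prob:
  fixes Z :: "nat \<Rightarrow> 'a \<Rightarrow> real"
  assumes "\<And>n. Z n \<in> borel_measurable M" "\<And>n. integrable M (\<lambda>\<omega>. (Z n \<omega>)\<^sup>2)"
    and lim: "(\<lambda>n. expectation (\<lambda>\<omega>. (Z n \<omega>)\<^sup>2)) \<longlonglongrightarrow> 0"
  shows "((\<lambda>p. Z (fst p) (snd p)) \<longlongrightarrow> 0) (in_prob M)"
proof (rule tendsto_in_probI[where Z = Z and c = 0])
  show "Z n \<in> borel_measurable M" for n by (rule assms)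
  show "conv_in_prob M Z 0"
    unfolding conv_in_prob_def
  proof (intro allI impI)
    fix e :: real assume e: "e > 0"
    show "(\<lambda>n. measure M {\<omega> \<in> space M. \<bar>Z n \<omega> - 0\<bar> > e}) \<longlonglongrightarrow> 0"
    proof (rule tendsto_sandwich[OF _ _ tendsto_const])
      show "\<forall>\<^sub>F n in sequentially. 0 \<le> measure M {\<omega> \<in> space M. \<bar>Z n \<omega> - 0\<bar> > e}" by simp
      show "(\<lambda>n. expectation (\<lambda>\<omega>. (Z n \<omega>)\<^sup>2) / e\<^sup>2) \<longlonglongrightarrow> 0"
        using tendsto_divide[OF lim tendsto_const[of "e\<^sup>2"]] e by simp
      show "\<forall>\<^sub>F n in sequentially. measure M {\<omega> \<in> space M. \<bar>Z n \<omega> - 0\<bar> > e} \<le> expectation (\<lambda>\<omega>. (Z n \<omega>)\<^sup>2) / e\<^sup>2"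
      proof (intro always_eventually allI)
        fix n
        have [measurable]: "Z n \<in> borel_measurable M" by (rule assms)
        have "measure M {\<omega> \<in> space M. \<bar>Z n \<omega> - 0\<bar> > e} \<le> measure M {\<omega> \<in> space M. \<bar>Z n \<omega>\<bar> \<ge> e}"
          by (intro finite_measure_mono) auto
        also have "\<dots> \<le> expectation (\<lambda>\<omega>. (Z n \<omega>)\<^sup>2) / e\<^sup>2"
          by (rule second_moment_method) (use assms(2)[of n] e in auto)
        finally show "measure M {\<omega> \<in> space M. \<bar>Z n \<omega> - 0\<bar> > e} \<le> expectation (\<lambda>\<omega>. (Z n \<omega>)\<^sup>2) / e\<^sup>2" .
      qed
    qed
  qed
qed

text \<open>Markov's inequality. The nonnegative integral is used so that the bound can be checked
  by Tonelli's theorem.\<close>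

lemma tight_in_probI_nn_integral:
  assumes Z: "\<And>n. Z n \<in> borel_measurable M" and K: "K < \<infinity>"
    and bound: "\<forall>\<^sub>F n in sequentially. (\<integral>\<^sup>+\<omega>. ennreal (Z n \<omega>) \<partial>M) \<le> K"
    and nonneg: "\<And>n \<omega>. Z n \<omega> \<ge> 0"
  shows "tight_in_prob M (\<lambda>p. Z (fst p) (snd p))"
  unfolding tight_in_prob_def
proof (intro allI impI)
  fix e :: real assume e: "e > 0"
  obtain c where c: "K = ennreal c" "c \<ge> 0" using K by (cases K) auto
  \<comment> \<open>The probability of exceeding b is at most c / b, which is below e; adding 1 to c
    keeps b positive when c = 0.\<close>
  define b where "b = 2 * (c + 1) / e"
  have b: "b > 0" using c e by (simp add: b_def)
  show "\<exists>K. nearly_all M e (\<lambda>p. \<bar>Z (fst p) (snd p)\<bar> \<le> K)"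
  proof (rule exI[of _ b], use bound in eventually_elim)
    case (elim n)
    note [measurable] = Z[of n]
    define B where "B = {\<omega>\<in>space M. 1 \<le> ennreal (1 / b) * ennreal (Z n \<omega>)}"
    have "emeasure M B \<le> ennreal (1 / b) * (\<integral>\<^sup>+\<omega>. ennreal (Z n \<omega>) * indicator (space M) \<omega> \<partial>M)"
      unfolding B_def by (intro nn_integral_Markov_inequality) auto
    also have "(\<integral>\<^sup>+\<omega>. ennreal (Z n \<omega>) * indicator (space M) \<omega> \<partial>M) = (\<integral>\<^sup>+\<omega>. ennreal (Z n \<omega>) \<partial>M)"
      by (intro nn_integral_cong) auto
    also have "ennreal (1 / b) * \<dots> \<le> ennreal (1 / b) * ennreal c"
      using elim c by (intro mult_left_mono) auto
    also have "\<dots> = ennreal (1 / b * c)" using b c by (simp flip: ennreal_mult)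
    finally have "measure M B \<le> 1 / b * c"
      using b c by (simp add: emeasure_eq_measure)
    also have "\<dots> < e" using c(2) e by (simp add: b_def field_simps add_nonneg_pos)
    finally have "measure M B < e" .
    moreover have "\<bar>Z n \<omega>\<bar> \<le> b" if "\<omega> \<in> space M - B" for \<omega>
    proof (rule ccontr)
      assume "\<not> \<bar>Z n \<omega>\<bar> \<le> b"
      then have "1 \<le> 1 / b * Z n \<omega>" using nonneg[of n \<omega>] b by (simp add: field_simps)
      then have "1 \<le> ennreal (1 / b) * ennreal (Z n \<omega>)"
        using b nonneg[of n \<omega>] by (simp flip: ennreal_mult)
      with that show False by (simp add: B_def)
    qed
    moreover have "B \<in> sets M" unfolding B_def by measurable
    ultimately show ?case by auto
  qed
qed

text \<open>The common pattern behind sums, products and domination: W is bounded wherever Y and Z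
  are, and each of the two gets half of the error probability.\<close>

lemma tight_combine:
  assumes "tight_in_prob M Y" "tight_in_prob M Z"
    and "\<And>a b. \<exists>K. \<forall>p. \<bar>Y p\<bar> \<le> a \<longrightarrow> \<bar>Z p\<bar> \<le> b \<longrightarrow> \<bar>W p\<bar> \<le> K"
  shows "tight_in_prob M W"
  unfolding tight_in_prob_def
proof (intro allI impI)
  fix e :: real assume "e > 0"
  then have "e / 2 > 0" by simp
  from assms(1) this obtain a where
    a: "nearly_all M (e / 2) (\<lambda>p. \<bar>Y p\<bar> \<le> a)"
    unfolding tight_in_prob_def by (elim allE[of _ "e / 2"] impE exE)
  from assms(2) \<open>e / 2 > 0\<close> obtain b where
    b: "nearly_all M (e / 2) (\<lambda>p. \<bar>Z p\<bar> \<le> b)"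
    unfolding tight_in_prob_def by (elim allE[of _ "e / 2"] impE exE)
  obtain K where K: "\<And>p. \<bar>Y p\<bar> \<le> a \<Longrightarrow> \<bar>Z p\<bar> \<le> b \<Longrightarrow> \<bar>W p\<bar> \<le> K"
    using assms(3)[of a b] by auto
  show "\<exists>K. nearly_all M e (\<lambda>p. \<bar>W p\<bar> \<le> K)"
    by (rule exI[of _ K], rule union_small[OF a b K])
qed

lemma tight_add:
  assumes "tight_in_prob M Y" "tight_in_prob M Z"
  shows "tight_in_prob M (\<lambda>p. Y p + Z p)"
proof (rule tight_combine[OF assms])
  show "\<exists>K. \<forall>p. \<bar>Y p\<bar> \<le> a \<longrightarrow> \<bar>Z p\<bar> \<le> b \<longrightarrow> \<bar>Y p + Z p\<bar> \<le> K" for a b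
    by (rule exI[of _ "a + b"]) (auto intro: order_trans[OF abs_triangle_ineq] add_mono)
qed

lemma tight_mult:
  assumes "tight_in_prob M Y" "tight_in_prob M Z"
  shows "tight_in_prob M (\<lambda>p. Y p * Z p)"
proof (rule tight_combine[OF assms])
  show "\<exists>K. \<forall>p. \<bar>Y p\<bar> \<le> a \<longrightarrow> \<bar>Z p\<bar> \<le> b \<longrightarrow> \<bar>Y p * Z p\<bar> \<le> K" for a b
  proof (intro exI[of _ "a * b"] allI impI)
    fix p assume "\<bar>Y p\<bar> \<le> a" "\<bar>Z p\<bar> \<le> b"
    then show "\<bar>Y p * Z p\<bar> \<le> a * b"
      unfolding abs_mult using abs_ge_zero[of "Y p"] by (intro mult_mono) linarith+
  qed
qed

lemma tight_mono:
  assumes "tight_in_prob M Y" "\<And>p. \<bar>Z p\<bar> \<le> \<bar>Y p\<bar>"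
  shows "tight_in_prob M Z"
proof (rule tight_combine[OF assms(1,1)])
  show "\<exists>K. \<forall>p. \<bar>Y p\<bar> \<le> a \<longrightarrow> \<bar>Y p\<bar> \<le> b \<longrightarrow> \<bar>Z p\<bar> \<le> K" for a b
    using assms(2) by (intro exI[of _ a]) (auto intro: order_trans)
qed

lemma tight_of_tendsto:
  assumes "(Z \<longlongrightarrow> c) (in_prob M)"
  shows "tight_in_prob M Z"
proof -
  have "\<forall>\<^sub>F p in in_prob M. \<bar>Z p\<bar> \<le> \<bar>c\<bar> + 1"
    using tendstoD[OF assms zero_less_one] by eventually_elim (auto simp: dist_real_def)
  then show ?thesis
    unfolding tight_in_prob_def eventually_in_prob by (intro allI impI exI[of _ "\<bar>c\<bar> + 1"]) simp
qed

text \<open>Localisation: an eventual property may be proved as if Z were bounded by a fixed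
  constant K.\<close>

lemma tight_eventually:
  assumes "tight_in_prob M Z"
    and "\<And>K. \<forall>\<^sub>F p in in_prob M. \<bar>Z p\<bar> \<le> K \<longrightarrow> P p"
  shows "eventually P (in_prob M)"
  unfolding eventually_in_prob
proof (intro allI impI)
  fix e :: real assume "e > 0"
  then have e: "e / 2 > 0" by simp
  from assms(1) this obtain K where
    K: "nearly_all M (e / 2) (\<lambda>p. \<bar>Z p\<bar> \<le> K)"
    unfolding tight_in_prob_def by (elim allE[of _ "e / 2"] impE exE)
  have "nearly_all M (e / 2) (\<lambda>p. \<bar>Z p\<bar> \<le> K \<longrightarrow> P p)"
    by (rule assms(2)[of K, unfolded eventually_in_prob, THEN spec, THEN mp, OF e])
  from union_small[where R = P, OF K this]
  show "nearly_all M e P" by simp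
qed

lemma tight_mult_null:
  assumes Z: "tight_in_prob M Z" and W: "(W \<longlongrightarrow> 0) (in_prob M)"
  shows "((\<lambda>p. Z p * W p) \<longlongrightarrow> 0) (in_prob M)"
proof (rule tendstoI, rule tight_eventually[OF Z])
  fix e K :: real assume e: "e > 0"
  have "\<forall>\<^sub>F p in in_prob M. dist (W p) 0 < e / (\<bar>K\<bar> + 1)"
    using W e by (intro tendstoD) auto
  then show "\<forall>\<^sub>F p in in_prob M. \<bar>Z p\<bar> \<le> K \<longrightarrow> dist (Z p * W p) 0 < e"
  proof eventually_elim
    case (elim p)
    show ?case
    proof
      assume "\<bar>Z p\<bar> \<le> K"
      then have "\<bar>Z p * W p\<bar> \<le> (\<bar>K\<bar> + 1) * \<bar>W p\<bar>"
        unfolding abs_mult by (intro mult_right_mono) auto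
      also have "\<dots> < e" using elim by (simp add: dist_real_def field_simps)
      finally show "dist (Z p * W p) 0 < e" by (simp add: dist_real_def)
    qed
  qed
qed

text \<open>Slutsky's lemma for characteristic functions: off an exceptional set the integrands
  differ by at most \<open>\<bar>t\<bar> * \<bar>Z - Y\<bar>\<close>, on it by at most 2.\<close>

lemma char_tendsto_of_null_diff:
  assumes Y: "\<And>n. Y n \<in> borel_measurable M" and Z: "\<And>n. Z n \<in> borel_measurable M"
    and null: "((\<lambda>p. Z (fst p) (snd p) - Y (fst p) (snd p)) \<longlongrightarrow> 0) (in_prob M)"
    and lim: "(\<lambda>n. char (distr M borel (Y n)) t) \<longlonglongrightarrow> c"
  shows "(\<lambda>n. char (distr M borel (Z n)) t) \<longlonglongrightarrow> c"
proof -
  have char_eq: "char (distr M borel (V n)) t = (CLINT \<omega>|M. iexp (t * V n \<omega>))"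
    if "\<And>n. V n \<in> borel_measurable M" for V :: "nat \<Rightarrow> 'a \<Rightarrow> real" and n
  proof -
    have [measurable]: "V n \<in> borel_measurable M" by (rule that)
    show ?thesis unfolding char_def by (rule integral_distr) auto
  qed
  have "(\<lambda>n. char (distr M borel (Z n)) t - char (distr M borel (Y n)) t) \<longlonglongrightarrow> 0"
  proof (rule tendstoI)
    fix e :: real assume e: "e > 0"
    \<comment> \<open>The error e splits into e/2 from closeness and less than e/2 from an
      exceptional set of probability below e/4; \<open>\<bar>t\<bar> + 1\<close> instead of
      \<open>\<bar>t\<bar>\<close> covers t = 0.\<close>
    have "\<forall>\<^sub>F p in in_prob M. dist (Z (fst p) (snd p) - Y (fst p) (snd p)) 0 < e / (2 * (\<bar>t\<bar> + 1))"
      using e by (intro tendstoD[OF null]) auto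
    then have "\<forall>\<^sub>F n in sequentially. \<exists>B\<in>sets M. measure M B < e / 4 \<and>
        (\<forall>\<omega>\<in>space M - B. \<bar>Z n \<omega> - Y n \<omega>\<bar> < e / (2 * (\<bar>t\<bar> + 1)))"
      using e unfolding eventually_in_prob
      by (elim allE[of _ "e / 4"] impE) (simp_all add: dist_real_def)
    then show "\<forall>\<^sub>F n in sequentially. dist (char (distr M borel (Z n)) t - char (distr M borel (Y n)) t) 0 < e"
    proof eventually_elim
      case (elim n)
      note [measurable] = Y[of n] Z[of n]
      obtain B where B [measurable]: "B \<in> sets M" and mB: "measure M B < e / 4"
        and close: "\<And>\<omega>. \<omega> \<in> space M - B \<Longrightarrow> \<bar>Z n \<omega> - Y n \<omega>\<bar> < e / (2 * (\<bar>t\<bar> + 1))"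
        using elim by blast
      have int: "integrable M (\<lambda>\<omega>. iexp (t * Z n \<omega>))" "integrable M (\<lambda>\<omega>. iexp (t * Y n \<omega>))"
        by (intro integrable_const_bound[of _ 1]; simp)+
      have "norm (char (distr M borel (Z n)) t - char (distr M borel (Y n)) t)
          = norm (CLINT \<omega>|M. iexp (t * Z n \<omega>) - iexp (t * Y n \<omega>))"
        using int by (simp add: char_eq Y Z)
      also have "\<dots> \<le> (LINT \<omega>|M. norm (iexp (t * Z n \<omega>) - iexp (t * Y n \<omega>)))"
        by (rule integral_norm_bound)
      also have "\<dots> \<le> (LINT \<omega>|M. e / 2 + 2 * indicator B \<omega>)"
      proof (rule integral_mono)
        show "integrable M (\<lambda>\<omega>. norm (iexp (t * Z n \<omega>) - iexp (t * Y n \<omega>)))"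
          using int by auto
        show "integrable M (\<lambda>\<omega>. e / 2 + 2 * indicator B \<omega>)"
          using e by (intro integrable_const_bound[of _ "e / 2 + 2"]) (auto simp: indicator_def)
        fix \<omega> assume \<omega>: "\<omega> \<in> space M"
        show "norm (iexp (t * Z n \<omega>) - iexp (t * Y n \<omega>)) \<le> e / 2 + 2 * indicator B \<omega>"
        proof (cases "\<omega> \<in> B")
          case True
          have "norm (iexp (t * Z n \<omega>) - iexp (t * Y n \<omega>)) \<le> 1 + 1"
            by (rule order_trans[OF norm_triangle_ineq4]) simp
          then show ?thesis using True e by simp
        next
          case False
          have "iexp (t * Z n \<omega>) - iexp (t * Y n \<omega>)
              = iexp (t * Y n \<omega>) * (iexp (t * (Z n \<omega> - Y n \<omega>)) - 1)"
            by (simp add: algebra_simps flip: exp_add)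
          then have "norm (iexp (t * Z n \<omega>) - iexp (t * Y n \<omega>)) = norm (iexp (t * (Z n \<omega> - Y n \<omega>)) - 1)"
            by (simp add: norm_mult)
          also have "\<dots> \<le> \<bar>t * (Z n \<omega> - Y n \<omega>)\<bar>"
            using iexp_approx1[of "t * (Z n \<omega> - Y n \<omega>)" 0] by simp
          also have "\<dots> \<le> (\<bar>t\<bar> + 1) * (e / (2 * (\<bar>t\<bar> + 1)))"
            using close[of \<omega>] False \<omega> unfolding abs_mult by (intro mult_mono) auto
          also have "\<dots> = e / 2" by (simp add: field_simps)
          finally show ?thesis using False by simp
        qed
      qed
      also have "\<dots> = e / 2 + 2 * measure M B"
        using B by (simp add: prob_space emeasure_eq_measure)
      also have "\<dots> < e" using mB by simp
      finally show ?case by (simp add: dist_norm)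
    qed
  qed
  from tendsto_add[OF this lim] show ?thesis by simp
qed

end

subsection \<open>Sums over an i.i.d. sample\<close>

locale iid_sample = prob_space M for M :: "'a measure" +
  fixes X :: "nat \<Rightarrow> 'a \<Rightarrow> real" and N :: "real measure"
  assumes indep: "indep_vars (\<lambda>_. borel) X {1..}"
    and distr_X: "\<And>i. i \<ge> 1 \<Longrightarrow> distr M borel (X i) = N"
begin

lemma measurable_X [measurable]: "i \<ge> 1 \<Longrightarrow> X i \<in> borel_measurable M"
  using indep unfolding indep_vars_def by auto

lemma prob_space_N: "prob_space N"
  using prob_space_distr[OF measurable_X[of 1]] distr_X[of 1] by simp

lemma sets_N [measurable_cong, simp]: "sets N = sets borel"
  using distr_X[of 1] by (metis order_refl sets_distr)

lemma space_N [simp]: "space N = UNIV"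
  using sets_eq_imp_space_eq[OF sets_N] by simp

lemma measurable_N: "f \<in> borel_measurable borel \<Longrightarrow> f \<in> borel_measurable N"
  by measurable

lemma integral_X:
  fixes f :: "real \<Rightarrow> 'b::{banach, second_countable_topology}"
  assumes "i \<ge> 1" "f \<in> borel_measurable borel"
  shows "expectation (\<lambda>\<omega>. f (X i \<omega>)) = (LINT x|N. f x)"
    and "integrable M (\<lambda>\<omega>. f (X i \<omega>)) \<longleftrightarrow> integrable N f"
  using integral_distr[of "X i" M borel f] integrable_distr_eq[of "X i" M borel f] assms distr_X[of i]
  by auto

lemma measurable_sum_X:
  "f \<in> borel_measurable borel \<Longrightarrow> (\<lambda>\<omega>. \<Sum>i=1..n. f (X i \<omega>)) \<in> borel_measurable M"
  for f :: "real \<Rightarrow> real"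
  by (intro borel_measurable_sum) (auto intro!: measurable_compose[OF measurable_X])

text \<open>The deviation from c is a centred sum plus the constant \<open>real n * m - c\<close>.
  By independence only the diagonal of the squared centred sum has nonzero expectation, and the
  variance is bounded by the raw second moment.\<close>

lemma second_moment_sum:
  fixes f :: "real \<Rightarrow> real"
  assumes f [measurable]: "f \<in> borel_measurable borel" and sq: "integrable N (\<lambda>x. (f x)\<^sup>2)"
  shows "integrable M (\<lambda>\<omega>. ((\<Sum>i=1..n. f (X i \<omega>)) - c)\<^sup>2)"
    and "expectation (\<lambda>\<omega>. ((\<Sum>i=1..n. f (X i \<omega>)) - c)\<^sup>2)
      \<le> real n * (LINT x|N. (f x)\<^sup>2) + (real n * (LINT x|N. f x) - c)\<^sup>2"
proof -
  interpret N: prob_space N by (rule prob_space_N)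
  define m where "m = (LINT x|N. f x)"
  have f_int: "integrable N f"
    by (rule N.square_integrable_imp_integrable[OF _ sq]) simp
  define g where "g x = f x - m" for x
  have g [measurable]: "g \<in> borel_measurable borel" unfolding g_def by measurable
  have g_int: "integrable N g" unfolding g_def using f_int by simp
  have g_mean: "(LINT x|N. g x) = 0" unfolding g_def using f_int by (simp add: m_def N.prob_space[unfolded space_N])
  have g_sq: "integrable N (\<lambda>x. (g x)\<^sup>2)"
    unfolding g_def power2_diff using f_int sq by (intro Bochner_Integration.integrable_add Bochner_Integration.integrable_diff) auto
  have g_var: "(LINT x|N. (g x)\<^sup>2) \<le> (LINT x|N. (f x)\<^sup>2)"
    using N.variance_eq[OF f_int sq] by (simp add: g_def m_def)
  have prod: "integrable M (\<lambda>\<omega>. g (X i \<omega>) * g (X j \<omega>)) \<and>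
      expectation (\<lambda>\<omega>. g (X i \<omega>) * g (X j \<omega>)) = (if i = j then LINT x|N. (g x)\<^sup>2 else 0)"
    if ij: "i \<in> {1..n}" "j \<in> {1..n}" for i j
  proof (cases "i = j")
    case True
    then show ?thesis
      using ij g_sq integral_X[of i "\<lambda>x. (g x)\<^sup>2"] by (simp add: power2_eq_square)
  next
    case False
    have 1: "indep_vars (\<lambda>_. borel) (\<lambda>i \<omega>. g (X i \<omega>)) {i, j}"
      using ij by (intro indep_vars_compose2[OF indep_vars_subset[OF indep]]) auto
    have 2: "integrable M (\<lambda>\<omega>. g (X l \<omega>))" "expectation (\<lambda>\<omega>. g (X l \<omega>)) = 0" if "l \<in> {i, j}" for l
      using integral_X[of l g] that ij g_int g_mean by auto
    show ?thesis
      using indep_vars_lebesgue_integral[OF _ 1 2(1)] indep_vars_integrable[OF _ 1 2(1)] 2(2) False by simp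
  qed
  have eq: "((\<Sum>i=1..n. f (X i \<omega>)) - c)\<^sup>2 =
      (\<Sum>i=1..n. \<Sum>j=1..n. g (X i \<omega>) * g (X j \<omega>)) + (2 * (real n * m - c)) * (\<Sum>i=1..n. g (X i \<omega>)) + (real n * m - c)\<^sup>2" for \<omega>
  proof -
    have "(\<Sum>i=1..n. f (X i \<omega>)) - c = (\<Sum>i=1..n. g (X i \<omega>)) + (real n * m - c)"
      by (simp add: g_def sum_subtractf)
    then show ?thesis
      by (simp add: power2_eq_square sum_product[symmetric] algebra_simps)
  qed
  have int1: "integrable M (\<lambda>\<omega>. \<Sum>i=1..n. \<Sum>j=1..n. g (X i \<omega>) * g (X j \<omega>))"
    using prod by (intro Bochner_Integration.integrable_sum) auto
  have int2: "integrable M (\<lambda>\<omega>. \<Sum>i=1..n. g (X i \<omega>))"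
    using integral_X(2)[of _ g] g_int by (intro Bochner_Integration.integrable_sum) auto
  show "integrable M (\<lambda>\<omega>. ((\<Sum>i=1..n. f (X i \<omega>)) - c)\<^sup>2)"
    unfolding eq using int1 int2 by (intro Bochner_Integration.integrable_add integrable_mult_right) auto
  have "expectation (\<lambda>\<omega>. ((\<Sum>i=1..n. f (X i \<omega>)) - c)\<^sup>2)
      = expectation (\<lambda>\<omega>. \<Sum>i=1..n. \<Sum>j=1..n. g (X i \<omega>) * g (X j \<omega>))
        + (2 * (real n * m - c)) * expectation (\<lambda>\<omega>. \<Sum>i=1..n. g (X i \<omega>)) + (real n * m - c)\<^sup>2"
    unfolding eq using int1 int2 by (simp add: prob_space)
  also have "expectation (\<lambda>\<omega>. \<Sum>i=1..n. g (X i \<omega>)) = (\<Sum>i=1..n. expectation (\<lambda>\<omega>. g (X i \<omega>)))"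
    using integral_X(2)[of _ g] g_int by (intro Bochner_Integration.integral_sum) auto
  also have "\<dots> = 0"
    using integral_X(1)[of _ g] g_mean by (intro sum.neutral) auto
  also have "expectation (\<lambda>\<omega>. \<Sum>i=1..n. \<Sum>j=1..n. g (X i \<omega>) * g (X j \<omega>))
      = (\<Sum>i=1..n. \<Sum>j=1..n. expectation (\<lambda>\<omega>. g (X i \<omega>) * g (X j \<omega>)))"
    using prod by (subst Bochner_Integration.integral_sum, force)+ (auto intro!: sum.cong)
  also have "\<dots> = (\<Sum>i=1..n. \<Sum>j=1..n. if i = j then LINT x|N. (g x)\<^sup>2 else 0)"
    using prod by (intro sum.cong) auto
  also have "\<dots> = real n * (LINT x|N. (g x)\<^sup>2)" by simp
  finally show "expectation (\<lambda>\<omega>. ((\<Sum>i=1..n. f (X i \<omega>)) - c)\<^sup>2)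
      \<le> real n * (LINT x|N. (f x)\<^sup>2) + (real n * (LINT x|N. f x) - c)\<^sup>2"
    using mult_left_mono[OF g_var, of "real n"] by (simp add: m_def)
qed

text \<open>Weak law for triangular arrays, by Chebyshev's inequality: variance and squared bias
  both vanish.\<close>

lemma sum_tendsto_0_in_prob:
  fixes f :: "nat \<Rightarrow> real \<Rightarrow> real" and c :: "nat \<Rightarrow> real"
  assumes f: "\<And>n. f n \<in> borel_measurable borel" and sq: "\<And>n. integrable N (\<lambda>x. (f n x)\<^sup>2)"
    and var: "(\<lambda>n. real n * (LINT x|N. (f n x)\<^sup>2)) \<longlonglongrightarrow> 0"
    and mean: "(\<lambda>n. real n * (LINT x|N. f n x) - c n) \<longlonglongrightarrow> 0"
  shows "((\<lambda>p. (\<Sum>i=1..fst p. f (fst p) (X i (snd p))) - c (fst p)) \<longlongrightarrow> 0) (in_prob M)"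
proof (rule square_tendsto_0_in_prob[of "\<lambda>n \<omega>. (\<Sum>i=1..n. f n (X i \<omega>)) - c n"])
  show "(\<lambda>\<omega>. (\<Sum>i=1..n. f n (X i \<omega>)) - c n) \<in> borel_measurable M" for n
    using measurable_sum_X[OF f[of n]] by measurable
  show "integrable M (\<lambda>\<omega>. ((\<Sum>i=1..n. f n (X i \<omega>)) - c n)\<^sup>2)" for n
    by (rule second_moment_sum[OF f sq])
  have "(\<lambda>n. real n * (LINT x|N. (f n x)\<^sup>2) + (real n * (LINT x|N. f n x) - c n)\<^sup>2) \<longlonglongrightarrow> 0 + 0\<^sup>2"
    by (intro tendsto_intros var mean)
  then have lim: "(\<lambda>n. real n * (LINT x|N. (f n x)\<^sup>2) + (real n * (LINT x|N. f n x) - c n)\<^sup>2) \<longlonglongrightarrow> 0"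
    by simp
  show "(\<lambda>n. expectation (\<lambda>\<omega>. ((\<Sum>i=1..n. f n (X i \<omega>)) - c n)\<^sup>2)) \<longlonglongrightarrow> 0"
    by (rule tendsto_sandwich[OF always_eventually[OF allI[OF Bochner_Integration.integral_nonneg]]
        always_eventually[OF allI[OF second_moment_sum(2)[OF f sq]]] tendsto_const lim]) simp
qed

text \<open>Central limit theorem for rows of identically distributed terms, with a third moment
  condition. The terms are not centred: their means are of order 1/n, so raw second moments do the
  work of variances, and \<open>n * (\<phi> n - 1)\<close> tends to the exponent c of the limit.
  Then \<open>\<phi> n ^ n\<close> is compared with \<open>exp (c / n) ^ n\<close>, since n-th
  powers in the closed unit disc differ by at most n times the difference of the bases.\<close>

lemma char_sum_tendsto_normal:
  fixes f :: "nat \<Rightarrow> real \<Rightarrow> real"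
  assumes f: "\<And>n. f n \<in> borel_measurable borel"
    and cube: "\<And>n. integrable N (\<lambda>x. \<bar>f n x\<bar> ^ 3)"
    and mean: "(\<lambda>n. real n * (LINT x|N. f n x)) \<longlonglongrightarrow> m"
    and var: "(\<lambda>n. real n * (LINT x|N. (f n x)\<^sup>2)) \<longlonglongrightarrow> v"
    and third: "(\<lambda>n. real n * (LINT x|N. \<bar>f n x\<bar> ^ 3)) \<longlonglongrightarrow> 0"
  shows "(\<lambda>n. char (distr M borel (\<lambda>\<omega>. \<Sum>i=1..n. f n (X i \<omega>))) t) \<longlonglongrightarrow> exp (\<i> * complex_of_real t * complex_of_real m - (complex_of_real t)\<^sup>2 * complex_of_real v / 2)"
proof -
  interpret N: prob_space N by (rule prob_space_N)
  \<comment> \<open>Nonnegativity of v puts \<open>exp (c / of_nat n)\<close> into the closed unit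
    disc, where the estimate for powers applies.\<close>
  have v0: "v \<ge> 0"
    by (rule tendsto_lowerbound[OF var]) (auto intro!: always_eventually Bochner_Integration.integral_nonneg)
  define c :: complex where "c = \<i> * complex_of_real t * complex_of_real m - (complex_of_real t)\<^sup>2 * complex_of_real v / 2"
  define \<phi> where "\<phi> n = char (distr N borel (f n)) t" for n
  have fN: "f n \<in> borel_measurable N" for n using measurable_N[OF f] .
  have char_eq: "char (distr M borel (\<lambda>\<omega>. \<Sum>i=1..n. f n (X i \<omega>))) t = \<phi> n ^ n" for n
  proof -
    have ind: "indep_vars (\<lambda>_. borel) (\<lambda>i \<omega>. f n (X i \<omega>)) {1..n}"
      using f by (intro indep_vars_compose2[OF indep_vars_subset[OF indep]]) auto
    have "distr M borel (\<lambda>\<omega>. f n (X i \<omega>)) = distr N borel (f n)" if "i \<in> {1..n}" for i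
      using that distr_distr[of "f n" borel borel "X i" M] f[of n] distr_X[of i]
      by (simp add: comp_def measurable_X)
    then have "(\<Prod>i\<in>{1..n}. char (distr M borel (\<lambda>\<omega>. f n (X i \<omega>))) t) = (\<Prod>i\<in>{1..n}. \<phi> n)"
      by (intro prod.cong) (auto simp: \<phi>_def)
    then show ?thesis
      unfolding char_distr_sum[OF ind] by simp
  qed
  have int: "integrable N (\<lambda>x. f n x ^ j)" if "j \<le> 3" for n j
  proof (rule Bochner_Integration.integrable_bound[of _ "\<lambda>x. 1 + \<bar>f n x\<bar> ^ 3"])
    show "integrable N (\<lambda>x. 1 + \<bar>f n x\<bar> ^ 3)" using cube[of n] by simp
    show "(\<lambda>x. f n x ^ j) \<in> borel_measurable N" using fN[of n] by measurable
    show "AE x in N. norm (f n x ^ j) \<le> norm (1 + \<bar>f n x\<bar> ^ 3)"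
    proof (intro always_eventually allI)
      fix x
      have "\<bar>f n x\<bar> ^ j \<le> 1 + \<bar>f n x\<bar> ^ 3"
      proof (cases "\<bar>f n x\<bar> \<le> 1")
        case True
        then show ?thesis using power_le_one[of "\<bar>f n x\<bar>" j] by (simp add: add_increasing2)
      next
        case False
        then show ?thesis using power_increasing[OF that, of "\<bar>f n x\<bar>"] by linarith
      qed
      then show "norm (f n x ^ j) \<le> norm (1 + \<bar>f n x\<bar> ^ 3)"
        by (simp add: power_abs)
    qed
  qed
  define z where "z n = complex_of_real (real n) * (\<phi> n - 1)" for n
  have z_lim: "z \<longlonglongrightarrow> c"
  proof -
    define q where "q n = \<i> * complex_of_real t * complex_of_real (real n * (LINT x|N. f n x)) - (complex_of_real t)\<^sup>2 * complex_of_real (real n * (LINT x|N. (f n x)\<^sup>2)) / 2" for n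
    have q: "q \<longlonglongrightarrow> c"
      unfolding q_def c_def by (intro tendsto_intros tendsto_of_real mean var) simp_all
    have bound: "norm (z n - q n) \<le> \<bar>t\<bar> ^ 3 / 2 * (real n * (LINT x|N. \<bar>f n x\<bar> ^ 3))" for n
    proof -
      \<comment> \<open>The expansion runs to third order. In units of
        \<open>\<bar>t\<bar> ^ 3\<close> times the third absolute moment, the cubic term T costs 1/6
        and the remainder 2/6, together 1/2.\<close>
      define S where "S = (\<Sum>j\<le>3. ((\<i> * t) ^ j / fact j) * (LINT x|N. f n x ^ j))"
      have A: "norm (\<phi> n - S) \<le> (2 * \<bar>t\<bar> ^ 3 / fact 3) * (LINT x|N. \<bar>f n x\<bar> ^ 3)"
        unfolding \<phi>_def S_def by (intro N.char_approx1') (use int fN in auto)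
      define T where "T = (\<i> * t) ^ 3 / fact 3 * complex_of_real (LINT x|N. f n x ^ 3)"
      have S_eq: "S = 1 + \<i> * t * (LINT x|N. f n x) - t\<^sup>2 * (LINT x|N. (f n x)\<^sup>2) / 2 + T"
        by (simp add: S_def T_def numeral_eq_Suc N.prob_space[unfolded space_N] power2_eq_square algebra_simps)
      have "norm (LINT x|N. f n x ^ 3) \<le> (LINT x|N. \<bar>f n x\<bar> ^ 3)"
        using integral_norm_bound[of N "\<lambda>x. f n x ^ 3"] by (simp add: power_abs)
      then have "norm T \<le> \<bar>t\<bar> ^ 3 / fact 3 * (LINT x|N. \<bar>f n x\<bar> ^ 3)"
        unfolding T_def by (simp add: norm_mult norm_power norm_divide mult_left_mono divide_right_mono)
      with A have B: "norm (\<phi> n - S) + norm T \<le> \<bar>t\<bar> ^ 3 / 2 * (LINT x|N. \<bar>f n x\<bar> ^ 3)"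
        by (simp add: fact_numeral)
      have "z n - q n = complex_of_real (real n) * ((\<phi> n - S) + T)"
        by (simp add: z_def q_def S_eq algebra_simps)
      then have "norm (z n - q n) = real n * norm ((\<phi> n - S) + T)"
        by (simp only: norm_mult norm_of_real abs_of_nat)
      also have "\<dots> \<le> real n * (\<bar>t\<bar> ^ 3 / 2 * (LINT x|N. \<bar>f n x\<bar> ^ 3))"
        using B norm_triangle_ineq[of "\<phi> n - S" T] by (intro mult_left_mono) auto
      finally show ?thesis by (simp add: mult_ac)
    qed
    have "(\<lambda>n. \<bar>t\<bar> ^ 3 / 2 * (real n * (LINT x|N. \<bar>f n x\<bar> ^ 3))) \<longlonglongrightarrow> \<bar>t\<bar> ^ 3 / 2 * 0"
      by (intro tendsto_intros third)
    then have "(\<lambda>n. z n - q n) \<longlonglongrightarrow> 0"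
      by (intro Lim_null_comparison[OF always_eventually[OF allI[OF bound]]]) simp
    from tendsto_add[OF this q] show ?thesis by simp
  qed
  have e_lim: "(\<lambda>n. complex_of_real (real n) * (exp (c / of_nat n) - 1)) \<longlonglongrightarrow> c"
  proof -
    have "((\<lambda>x::complex. exp x - 1) has_field_derivative 1) (at 0)"
      by (auto intro!: derivative_eq_intros)
    moreover have "(\<lambda>n. c / of_nat n) \<longlonglongrightarrow> 0"
      using tendsto_mult[OF tendsto_const[of c] lim_inverse_n] by (simp add: divide_inverse)
    moreover have "(\<lambda>n. complex_of_real (real n) * (c / of_nat n)) \<longlonglongrightarrow> c"
      by (rule Lim_transform_eventually[OF tendsto_const])
         (use eventually_gt_at_top[of 0] in eventually_elim, simp)
    ultimately have "(\<lambda>n. complex_of_real (real n) * (exp (c / of_nat n) - 1)) \<longlonglongrightarrow> 1 * c"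
      by (intro tendsto_scaled_deriv) auto
    then show ?thesis by simp
  qed
  have "(\<lambda>n. \<phi> n ^ n - exp (c / of_nat n) ^ n) \<longlonglongrightarrow> 0"
  proof (rule Lim_null_comparison[OF always_eventually, OF allI])
    show "(\<lambda>n. norm (z n - complex_of_real (real n) * (exp (c / of_nat n) - 1))) \<longlonglongrightarrow> 0"
      using tendsto_norm[OF tendsto_diff[OF z_lim e_lim]] by simp
    fix n
    have 1: "norm (\<phi> n) \<le> 1"
      unfolding \<phi>_def using real_distribution.cmod_char_le_1[of "distr N borel (f n)"] N.real_distribution_distr[OF fN] by auto
    have 2: "norm (exp (c / of_nat n)) \<le> 1"
      using v0 by (cases "n = 0") (auto simp: c_def norm_exp_eq_Re Re_divide_of_nat divide_le_0_iff)
    have "norm (\<phi> n ^ n - exp (c / of_nat n) ^ n) \<le> real n * norm (\<phi> n - exp (c / of_nat n))"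
      by (rule norm_power_diff[OF 1 2])
    also have "\<dots> = norm (complex_of_real (real n) * (\<phi> n - exp (c / of_nat n)))"
      by (simp add: norm_mult)
    also have "complex_of_real (real n) * (\<phi> n - exp (c / of_nat n)) = z n - complex_of_real (real n) * (exp (c / of_nat n) - 1)"
      by (simp add: z_def algebra_simps)
    finally show "norm (\<phi> n ^ n - exp (c / of_nat n) ^ n) \<le> norm (z n - complex_of_real (real n) * (exp (c / of_nat n) - 1))" .
  qed
  moreover have "\<forall>\<^sub>F n in sequentially. \<phi> n ^ n - exp (c / of_nat n) ^ n = \<phi> n ^ n - exp c"
    using eventually_gt_at_top[of 0] by eventually_elim (simp flip: exp_of_nat_mult)
  ultimately have "(\<lambda>n. \<phi> n ^ n - exp c) \<longlonglongrightarrow> 0"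
    by (rule Lim_transform_eventually)
  from tendsto_add[OF this tendsto_const[of "exp c"]]
  have "(\<lambda>n. \<phi> n ^ n) \<longlonglongrightarrow> exp c" by simp
  then show ?thesis
    unfolding char_eq c_def .
qed

end

subsection \<open>Moments of exceedances\<close>

lemma has_bochner_integral_exp_Ici:
  fixes p :: real assumes p: "p > 0"
  shows "has_bochner_integral lborel (\<lambda>w. exp (- p * w) * indicator {0..} w) (1 / p)"
proof (rule has_bochner_integral_nn_integral)
  have "(\<integral>\<^sup>+w. ennreal (exp (- p * w)) * indicator {0..} w \<partial>lborel) = ennreal (0 - (- exp (- p * 0) / p))"
  proof (rule nn_integral_FTC_atLeast)
    show "((\<lambda>w. - exp (- p * w) / p) \<longlongrightarrow> 0) at_top" using p by real_asymp
  qed (use p in \<open>auto intro!: derivative_eq_intros\<close>)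
  then show "(\<integral>\<^sup>+w. ennreal (exp (- p * w) * indicator {0..} w) \<partial>lborel) = ennreal (1 / p)"
    by (simp add: ennreal_mult ennreal_indicator)
qed (use p in auto)

lemma has_bochner_integral_id_exp_Ici:
  fixes p :: real assumes p: "p > 0"
  shows "has_bochner_integral lborel (\<lambda>w. w * exp (- p * w) * indicator {0..} w) (1 / p\<^sup>2)"
proof (rule has_bochner_integral_nn_integral)
  have "(\<integral>\<^sup>+w. ennreal (w * exp (- p * w)) * indicator {0..} w \<partial>lborel)
      = ennreal (0 - (- (0 / p + 1 / p\<^sup>2) * exp (- p * 0)))"
  proof (rule nn_integral_FTC_atLeast)
    show "((\<lambda>w. - (w / p + 1 / p\<^sup>2) * exp (- p * w)) \<longlongrightarrow> 0) at_top" using p by real_asymp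
    show "((\<lambda>w. - (w / p + 1 / p\<^sup>2) * exp (- p * w)) has_real_derivative x * exp (- p * x)) (at x)" for x
      using p by (auto intro!: derivative_eq_intros simp: field_simps power2_eq_square)
  qed auto
  then have "(\<integral>\<^sup>+w. ennreal (w * exp (- p * w)) * indicator {0..} w \<partial>lborel) = ennreal (1 / p\<^sup>2)"
    by simp
  moreover have "(\<integral>\<^sup>+w. ennreal (w * exp (- p * w) * indicator {0..} w) \<partial>lborel)
      = (\<integral>\<^sup>+w. ennreal (w * exp (- p * w)) * indicator {0..} w \<partial>lborel)"
    by (intro nn_integral_cong) (auto simp: indicator_def)
  ultimately show "(\<integral>\<^sup>+w. ennreal (w * exp (- p * w) * indicator {0..} w) \<partial>lborel) = ennreal (1 / p\<^sup>2)"
    by simp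
qed (use p in \<open>auto simp: indicator_def\<close>)

text \<open>The half-open interval is the one that the strict exceedance condition
  \<open>t * exp w < x\<close> cuts out for w.\<close>

lemma integral_FTC_Ico:
  fixes G g :: "real \<Rightarrow> real"
  assumes G: "\<And>w. (G has_real_derivative g w) (at w)" and g: "\<And>w. isCont g w" and u: "u \<ge> 0"
  shows "has_bochner_integral lborel (\<lambda>w. g w * indicator {0..<u} w) (G u - G 0)"
proof (rule has_bochner_integral_cong_AE[THEN iffD1])
  show "has_bochner_integral lborel (\<lambda>w. g w * indicator {0..u} w) (G u - G 0)"
    using u G g by (intro has_bochner_integral_FTC_Icc_real) auto
  have "g \<in> borel_measurable borel"
    using g by (intro borel_measurable_continuous_onI) (simp add: continuous_on_eq_continuous_at)
  then show "(\<lambda>w. g w * indicator {0..u} w) \<in> borel_measurable lborel"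
    "(\<lambda>w. g w * indicator {0..<u} w) \<in> borel_measurable lborel" by measurable
  show "AE w in lborel. g w * indicator {0..u} w = g w * indicator {0..<u} w"
    using AE_lborel_singleton[of u] by eventually_elim (auto simp: indicator_def)
qed

text \<open>Layer-cake formula: \<open>G (ln (x / t)) - G 0\<close> is the integral of g over those
  w \<ge> 0 with \<open>t * exp w < x\<close>. Fubini then turns moments of exceedances into
  integrals of the tail, for which uniform bounds are available.\<close>

lemma integral_exceedance:
  fixes G g :: "real \<Rightarrow> real"
  assumes N: "real_distribution N" and t: "t > 0"
    and G: "\<And>w. (G has_real_derivative g w) (at w)" and g: "\<And>w. isCont g w"
    and int: "integrable lborel (\<lambda>w. \<bar>g w\<bar> * (1 - cdf N (t * exp w)) * indicator {0..} w)"
  shows "integrable N (\<lambda>x. G (ln (x / t)) * indicator {t<..} x)"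
    and "(LINT x|N. G (ln (x / t)) * indicator {t<..} x) =
      G 0 * (1 - cdf N t) + (LINT w|lborel. g w * (1 - cdf N (t * exp w)) * indicator {0..} w)"
proof -
  interpret N: real_distribution N by (rule N)
  interpret P: pair_sigma_finite lborel N ..
  have [measurable]: "g \<in> borel_measurable borel"
    using g by (intro borel_measurable_continuous_onI) (simp add: continuous_on_eq_continuous_at)
  have [measurable]: "G \<in> borel_measurable borel"
    using G by (intro borel_measurable_continuous_onI) (auto simp: continuous_on_eq_continuous_at intro: DERIV_isCont)
  have tail: "measure N {y<..} = 1 - cdf N y" for y
  proof -
    have "{y<..} = UNIV - {..y}" by auto
    then show ?thesis using N.prob_compl[of "{..y}"] by (simp add: cdf_def)
  qed
  have tail_int: "integrable N (indicat_real {y<..})" for y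
    by (intro N.integrable_const_bound[of _ 1]) (auto simp: indicator_def)
  define \<Phi> where "\<Phi> w x = g w * indicator {0..} w * indicator {t * exp w<..} x" for w x :: real
  have \<Phi>_meas: "(\<lambda>(w, x). \<Phi> w x) \<in> borel_measurable (lborel \<Otimes>\<^sub>M N)"
  proof -
    have "(\<lambda>p. g (fst p) * indicator {0..} (fst p) * indicator {p. t * exp (fst p) < snd p} p)
        \<in> borel_measurable (lborel \<Otimes>\<^sub>M N)" by measurable
    moreover have "(\<lambda>(w, x). \<Phi> w x) = (\<lambda>p. g (fst p) * indicator {0..} (fst p) * indicator {p. t * exp (fst p) < snd p} p)"
      by (auto simp: \<Phi>_def indicator_def fun_eq_iff)
    ultimately show ?thesis by simp
  qed
  have \<Phi>_int: "integrable (lborel \<Otimes>\<^sub>M N) (\<lambda>(w, x). \<Phi> w x)"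
  proof (rule P.Fubini_integrable[OF \<Phi>_meas])
    have "(LINT x|N. norm (\<Phi> w x)) = \<bar>g w\<bar> * (1 - cdf N (t * exp w)) * indicator {0..} w" for w
    proof -
      have "norm (\<Phi> w x) = \<bar>g w\<bar> * indicator {0..} w * indicator {t * exp w<..} x" for x
        by (simp add: \<Phi>_def abs_mult)
      then show ?thesis by (simp add: tail)
    qed
    then show "integrable lborel (\<lambda>w. LINT x|N. norm (case (w, x) of (w, x) \<Rightarrow> \<Phi> w x))"
      using int by simp
    show "AE w in lborel. integrable N (\<lambda>x. case (w, x) of (w, x) \<Rightarrow> \<Phi> w x)"
      using tail_int by (auto simp: \<Phi>_def)
  qed
  have inner_N: "(LINT x|N. \<Phi> w x) = g w * (1 - cdf N (t * exp w)) * indicator {0..} w" for w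
    by (simp add: \<Phi>_def tail)
  have inner_L: "(LINT w|lborel. \<Phi> w x) = (G (ln (x / t)) - G 0) * indicator {t<..} x" for x
  proof (cases "x > t")
    case True
    then have x: "x > 0" using t by simp
    have "(t * exp w < x) = (w < ln (x / t))" for w
      using t x by (metis divide_pos_pos exp_less_cancel_iff exp_ln mult.commute pos_less_divide_eq)
    then have "\<Phi> w x = g w * indicator {0..<ln (x / t)} w" for w
      by (auto simp: \<Phi>_def indicator_def)
    then show ?thesis
      using has_bochner_integral_integral_eq[OF integral_FTC_Ico[OF G g, of "ln (x / t)"]] True t by simp
  next
    case False
    have "t * exp w \<ge> x" if "w \<ge> 0" for w
      using False that t by (smt (verit) mult_le_cancel_left1 one_le_exp_iff)
    then have "\<Phi> w x = 0" for w
      by (force simp: \<Phi>_def indicator_def)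
    then show ?thesis using False by simp
  qed
  have "integrable N (\<lambda>x. LINT w|lborel. \<Phi> w x)"
    using P.integrable_snd[OF \<Phi>_int] by simp
  then have 1: "integrable N (\<lambda>x. (G (ln (x / t)) - G 0) * indicator {t<..} x)"
    by (simp add: inner_L)
  have eq: "G (ln (x / t)) * indicator {t<..} x = (G (ln (x / t)) - G 0) * indicator {t<..} x + G 0 * indicator {t<..} x" for x
    by (simp add: indicator_def)
  show "integrable N (\<lambda>x. G (ln (x / t)) * indicator {t<..} x)"
    unfolding eq using 1 tail_int by (intro Bochner_Integration.integrable_add integrable_mult_right)
  have "(LINT x|N. (G (ln (x / t)) - G 0) * indicator {t<..} x) = (LINT w|lborel. g w * (1 - cdf N (t * exp w)) * indicator {0..} w)"
    using P.Fubini_integral[OF \<Phi>_int] by (simp add: inner_L inner_N)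
  then show "(LINT x|N. G (ln (x / t)) * indicator {t<..} x) =
      G 0 * (1 - cdf N t) + (LINT w|lborel. g w * (1 - cdf N (t * exp w)) * indicator {0..} w)"
    unfolding eq using 1 tail_int tail by (subst Bochner_Integration.integral_add) auto
qed

context heavy_tail
begin

text \<open>\<open>SOME\<close> fixes one constant for the whole context, so that
  \<open>good\<close> can refer to it.\<close>

definition tail_const :: real where
  "tail_const = (SOME K. K \<ge> 0 \<and> (\<forall>\<^sub>F n in sequentially. \<forall>w\<ge>0.
     root_k n * \<bar>scaled_tail n w - exp (- (w / \<xi>))\<bar> \<le> K * exp (- (w / \<xi>))))"

text \<open>Bundles the eventual facts into one condition on a single n, so that estimates can be
  stated without asymptotic quantifiers.\<close>

definition good :: "nat \<Rightarrow> bool" where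
  "good n \<longleftrightarrow> 0 < k n \<and> k n < n \<and>
     (\<forall>w\<ge>0. root_k n * \<bar>scaled_tail n w - exp (- (w / \<xi>))\<bar> \<le> tail_const * exp (- (w / \<xi>)))"

lemma tail_const: "tail_const \<ge> 0" and eventually_good: "eventually good sequentially"
proof -
  have "tail_const \<ge> 0 \<and> (\<forall>\<^sub>F n in sequentially. \<forall>w\<ge>0.
     root_k n * \<bar>scaled_tail n w - exp (- (w / \<xi>))\<bar> \<le> tail_const * exp (- (w / \<xi>)))"
    unfolding tail_const_def using scaled_tail_bound by (rule someI_ex)
  then show "tail_const \<ge> 0" "eventually good sequentially"
    using k_pos k_less unfolding good_def by (auto intro: eventually_conj)
qed

lemma good_pos: "good n \<Longrightarrow> 0 < k n" "good n \<Longrightarrow> 0 < n" "good n \<Longrightarrow> t n > 0"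
  by (auto simp: good_def intro: threshold_pos)

lemma good_dev:
  "good n \<Longrightarrow> w \<ge> 0 \<Longrightarrow> \<bar>root_k n * (scaled_tail n w - exp (- (w / \<xi>)))\<bar> \<le> tail_const * exp (- (w / \<xi>))"
  by (simp add: good_def abs_mult)

lemma good_bound:
  assumes "good n" "w \<ge> 0"
  shows "0 \<le> scaled_tail n w" "scaled_tail n w \<le> (1 + tail_const) * exp (- (w / \<xi>))"
proof -
  interpret N: real_distribution N by (rule N)
  show "0 \<le> scaled_tail n w" by (simp add: scaled_tail_def N.cdf_bounded_prob)
  have "1 * \<bar>scaled_tail n w - exp (- (w / \<xi>))\<bar> \<le> root_k n * \<bar>scaled_tail n w - exp (- (w / \<xi>))\<bar>"
    using good_pos[OF assms(1)] by (intro mult_right_mono) auto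
  also have "\<dots> \<le> tail_const * exp (- (w / \<xi>))" using good_dev[OF assms] by (simp add: abs_mult)
  finally show "scaled_tail n w \<le> (1 + tail_const) * exp (- (w / \<xi>))"
    by (simp add: algebra_simps abs_le_iff)
qed

lemma measurable_scaled_tail [measurable]: "scaled_tail n \<in> borel_measurable borel"
proof -
  interpret N: real_distribution N by (rule N)
  have "mono (cdf N)" by (intro monoI N.cdf_nondecreasing)
  then have [measurable]: "cdf N \<in> borel_measurable borel" by (rule borel_measurable_mono)
  show ?thesis unfolding scaled_tail_def by measurable
qed

text \<open>Any growth rate below \<open>1 / \<xi>\<close> is tolerated by the exponential
  tail.\<close>

lemma integrable_exp_bound:
  fixes g h :: "real \<Rightarrow> real"
  assumes [measurable]: "g \<in> borel_measurable borel" "h \<in> borel_measurable borel"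
    and g: "\<And>w. w \<ge> 0 \<Longrightarrow> \<bar>g w\<bar> \<le> B * exp (\<theta> * w)" and \<theta>: "\<theta> < 1 / \<xi>"
    and h: "\<And>w. w \<ge> 0 \<Longrightarrow> \<bar>h w\<bar> \<le> c * exp (- (w / \<xi>))"
  shows "integrable lborel (\<lambda>w. g w * h w * indicator {0..} w)"
proof (rule Bochner_Integration.integrable_bound)
  show "integrable lborel (\<lambda>w. B * c * (exp (- (1 / \<xi> - \<theta>) * w) * indicator {0..} w))"
    using has_bochner_integral_exp_Ici[of "1 / \<xi> - \<theta>"] \<theta>
    by (intro integrable_mult_right) (auto simp: has_bochner_integral_iff)
  show "AE w in lborel. norm (g w * h w * indicator {0..} w) \<le> norm (B * c * (exp (- (1 / \<xi> - \<theta>) * w) * indicator {0..} w))"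
  proof (intro always_eventually allI)
    fix w
    show "norm (g w * h w * indicator {0..} w) \<le> norm (B * c * (exp (- (1 / \<xi> - \<theta>) * w) * indicator {0..} w))"
    proof (cases "w \<ge> 0")
      case True
      have "\<bar>g w\<bar> * \<bar>h w\<bar> \<le> (B * exp (\<theta> * w)) * (c * exp (- (w / \<xi>)))"
        using g[OF True] h[OF True] by (intro mult_mono) auto
      also have "\<dots> = B * c * exp (- (1 / \<xi> - \<theta>) * w)"
        by (simp add: algebra_simps flip: exp_add)
      also have "\<dots> \<le> \<bar>B * c * exp (- (1 / \<xi> - \<theta>) * w)\<bar>" by (rule abs_ge_self)
      finally show ?thesis using True by (simp add: abs_mult)
    qed simp
  qed
qed measurable

text \<open>The layer-cake formula is linear in the tail. Hence the moment of G is its value under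
  the exponential law plus, at scale 1 / sqrt k, the same functional of the limiting bias of the
  tail.\<close>

lemma exceedance_moment_bias:
  fixes G g :: "real \<Rightarrow> real"
  assumes G: "\<And>w. (G has_real_derivative g w) (at w)" and g: "\<And>w. isCont g w"
    and B: "\<And>w. w \<ge> 0 \<Longrightarrow> \<bar>g w\<bar> \<le> B * exp (\<theta> * w)" and \<theta>: "\<theta> < 1 / \<xi>"
  shows "good n \<Longrightarrow> integrable N (\<lambda>x. G (ln (x / t n)) * indicator {t n<..} x)"
    and "(\<lambda>n. root_k n * (real n / real (k n) * (LINT x|N. G (ln (x / t n)) * indicator {t n<..} x)
        - (G 0 + (LINT w|lborel. g w * exp (- (w / \<xi>)) * indicator {0..} w))))
      \<longlonglongrightarrow> L / \<xi> * (G 0 + (LINT w|lborel. g w * exp (- (w / \<xi>)) * exp (\<tau> * w) * indicator {0..} w))"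
proof -
  have g_meas [measurable]: "g \<in> borel_measurable borel"
    using g by (intro borel_measurable_continuous_onI) (simp add: continuous_on_eq_continuous_at)
  have tail_eq: "1 - cdf N (t n * exp w) = real (k n) / real n * scaled_tail n w" if "good n" for n w
    using good_pos[OF that] by (simp add: scaled_tail_def)
  have int1: "integrable lborel (\<lambda>w. \<bar>g w\<bar> * (1 - cdf N (t n * exp w)) * indicator {0..} w)" if "good n" for n
  proof -
    have "integrable lborel (\<lambda>w. \<bar>g w\<bar> * scaled_tail n w * indicator {0..} w)"
      using B \<theta> good_bound[OF that] by (intro integrable_exp_bound[where c = "1 + tail_const"]) auto
    then have "integrable lborel (\<lambda>w. real (k n) / real n * (\<bar>g w\<bar> * scaled_tail n w * indicator {0..} w))"
      by (rule integrable_mult_right)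
    then show ?thesis
      unfolding tail_eq[OF that] by (simp add: mult_ac)
  qed
  note exc = integral_exceedance[OF N good_pos(3) G g int1]
  show "integrable N (\<lambda>x. G (ln (x / t n)) * indicator {t n<..} x)" if "good n"
    by (rule exc(1)[OF that that])
  \<comment> \<open>Zero outside \<open>good n\<close>, since dominated convergence asks for the
    majorant at every n.\<close>
  define e where "e n w = (if good n then root_k n * (scaled_tail n w - exp (- (w / \<xi>))) else 0)" for n w
  have [measurable]: "e n \<in> borel_measurable borel" for n unfolding e_def by measurable
  have e_bound: "\<bar>e n w\<bar> \<le> tail_const * exp (- (w / \<xi>))" if "w \<ge> 0" for n w
    using good_dev[of n w] that tail_const by (simp add: e_def)
  have lim: "(\<lambda>n. LINT w|lborel. g w * e n w * indicator {0..} w) \<longlonglongrightarrow>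
      (LINT w|lborel. g w * (L / \<xi> * exp (- (w / \<xi>)) * exp (\<tau> * w)) * indicator {0..} w)"
  proof (rule integral_dominated_convergence[where w = "\<lambda>w. \<bar>g w\<bar> * (tail_const * exp (- (w / \<xi>))) * indicator {0..} w"])
    show "integrable lborel (\<lambda>w. \<bar>g w\<bar> * (tail_const * exp (- (w / \<xi>))) * indicator {0..} w)"
      using B \<theta> tail_const by (intro integrable_exp_bound[where c = tail_const]) auto
    show "AE w in lborel. norm (g w * e n w * indicator {0..} w) \<le> \<bar>g w\<bar> * (tail_const * exp (- (w / \<xi>))) * indicator {0..} w" for n
      using e_bound[of _ n] by (auto simp: abs_mult indicator_def intro!: mult_left_mono)
    show "AE w in lborel. (\<lambda>n. g w * e n w * indicator {0..} w) \<longlonglongrightarrow> g w * (L / \<xi> * exp (- (w / \<xi>)) * exp (\<tau> * w)) * indicator {0..} w"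
    proof (intro always_eventually allI)
      fix w
      have "(\<lambda>n. e n w) \<longlonglongrightarrow> L / \<xi> * exp (- (w / \<xi>)) * exp (\<tau> * w)"
        by (rule Lim_transform_eventually[OF scaled_tail_bias])
           (use eventually_good in eventually_elim, simp add: e_def)
      then show "(\<lambda>n. g w * e n w * indicator {0..} w) \<longlonglongrightarrow> g w * (L / \<xi> * exp (- (w / \<xi>)) * exp (\<tau> * w)) * indicator {0..} w"
        by (intro tendsto_intros)
    qed
  qed auto
  have "(\<lambda>n. G 0 * (root_k n * (scaled_tail n 0 - exp (- (0 / \<xi>)))) + (LINT w|lborel. g w * e n w * indicator {0..} w))
      \<longlonglongrightarrow> G 0 * (L / \<xi> * exp (- (0 / \<xi>)) * exp (\<tau> * 0))
        + (LINT w|lborel. g w * (L / \<xi> * exp (- (w / \<xi>)) * exp (\<tau> * w)) * indicator {0..} w)"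
    by (intro tendsto_add tendsto_mult tendsto_const lim scaled_tail_bias)
  also have "(LINT w|lborel. g w * (L / \<xi> * exp (- (w / \<xi>)) * exp (\<tau> * w)) * indicator {0..} w)
      = L / \<xi> * (LINT w|lborel. g w * exp (- (w / \<xi>)) * exp (\<tau> * w) * indicator {0..} w)"
    by (subst integral_mult_right_zero[symmetric]) (simp add: mult_ac)
  finally have lim2: "(\<lambda>n. G 0 * (root_k n * (scaled_tail n 0 - 1)) + (LINT w|lborel. g w * e n w * indicator {0..} w))
      \<longlonglongrightarrow> L / \<xi> * (G 0 + (LINT w|lborel. g w * exp (- (w / \<xi>)) * exp (\<tau> * w) * indicator {0..} w))"
    by (simp add: algebra_simps)
  have "\<forall>\<^sub>F n in sequentially. G 0 * (root_k n * (scaled_tail n 0 - 1)) + (LINT w|lborel. g w * e n w * indicator {0..} w)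
    = root_k n * (real n / real (k n) * (LINT x|N. G (ln (x / t n)) * indicator {t n<..} x)
        - (G 0 + (LINT w|lborel. g w * exp (- (w / \<xi>)) * indicator {0..} w)))"
    using eventually_good
  proof eventually_elim
    case (elim n)
    have i1: "integrable lborel (\<lambda>w. g w * scaled_tail n w * indicator {0..} w)"
      using B \<theta> good_bound[OF elim] by (intro integrable_exp_bound[where c = "1 + tail_const"]) auto
    have i2: "integrable lborel (\<lambda>w. g w * exp (- (w / \<xi>)) * indicator {0..} w)"
      using B \<theta> by (intro integrable_exp_bound[where c = 1]) auto
    have "(LINT w|lborel. g w * e n w * indicator {0..} w)
        = (LINT w|lborel. root_k n * (g w * scaled_tail n w * indicator {0..} w - g w * exp (- (w / \<xi>)) * indicator {0..} w))"
      using elim by (intro Bochner_Integration.integral_cong) (auto simp: e_def algebra_simps)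
    also have "\<dots> = root_k n * ((LINT w|lborel. g w * scaled_tail n w * indicator {0..} w)
        - (LINT w|lborel. g w * exp (- (w / \<xi>)) * indicator {0..} w))"
      using i1 i2 by simp
    finally have A: "(LINT w|lborel. g w * e n w * indicator {0..} w) = root_k n * ((LINT w|lborel. g w * scaled_tail n w * indicator {0..} w)
        - (LINT w|lborel. g w * exp (- (w / \<xi>)) * indicator {0..} w))" .
    have "(LINT w|lborel. g w * (1 - cdf N (t n * exp w)) * indicator {0..} w)
        = (LINT w|lborel. real (k n) / real n * (g w * scaled_tail n w * indicator {0..} w))"
      unfolding tail_eq[OF elim] by (simp add: mult_ac)
    also have "\<dots> = real (k n) / real n * (LINT w|lborel. g w * scaled_tail n w * indicator {0..} w)"
      by (rule integral_mult_right_zero)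
    finally have "real n / real (k n) * (LINT x|N. G (ln (x / t n)) * indicator {t n<..} x)
        = G 0 * scaled_tail n 0 + (LINT w|lborel. g w * scaled_tail n w * indicator {0..} w)"
      unfolding exc(2)[OF elim elim] using good_pos[OF elim] tail_eq[OF elim, of 0] by (simp add: distrib_left)
    then show ?case unfolding A by (simp add: algebra_simps)
  qed
  from Lim_transform_eventually[OF lim2 this]
  show "(\<lambda>n. root_k n * (real n / real (k n) * (LINT x|N. G (ln (x / t n)) * indicator {t n<..} x)
        - (G 0 + (LINT w|lborel. g w * exp (- (w / \<xi>)) * indicator {0..} w))))
      \<longlonglongrightarrow> L / \<xi> * (G 0 + (LINT w|lborel. g w * exp (- (w / \<xi>)) * exp (\<tau> * w) * indicator {0..} w))" .
qed

lemma exceedance_moment_lim: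
  fixes G g :: "real \<Rightarrow> real"
  assumes "\<And>w. (G has_real_derivative g w) (at w)" "\<And>w. isCont g w"
    and "\<And>w. w \<ge> 0 \<Longrightarrow> \<bar>g w\<bar> \<le> B * exp (\<theta> * w)" "\<theta> < 1 / \<xi>"
  shows "(\<lambda>n. real n / real (k n) * (LINT x|N. G (ln (x / t n)) * indicator {t n<..} x))
      \<longlonglongrightarrow> G 0 + (LINT w|lborel. g w * exp (- (w / \<xi>)) * indicator {0..} w)"
  by (rule LIM_zero_cancel[OF tendsto_0_of_scaled[OF exceedance_moment_bias(2)[OF assms] sqrt_k]])

end

section \<open>Moments of the influence function and its central limit theorem\<close>

locale tail_sample = heavy_tail \<delta> l \<tau> \<xi> C L N k + iid_sample M X N
  for \<delta> l \<tau> \<xi> C L N k and M :: "'a measure" and X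
begin

text \<open>The influence function of the combination of the Hill estimator (\<open>a0\<close>) and of
  \<open>(E_stat - 1 / (1 - \<xi> * \<tau>)) / \<tau>\<close> (\<open>a1\<close>), on the logarithmic scale.\<close>
definition influence :: "real \<Rightarrow> real \<Rightarrow> real \<Rightarrow> real" where
  "influence a0 a1 u = a0 * (u - \<xi>) + a1 * ((exp (\<tau> * u) - 1) / \<tau> - \<xi> / (1 - \<xi> * \<tau>))"

definition exceedance_sum :: "(real \<Rightarrow> real) \<Rightarrow> nat \<Rightarrow> 'a \<Rightarrow> real" where
  "exceedance_sum h n \<omega> = (\<Sum>i=1..n. h (ln (X i \<omega> / t n)) * indicator {t n<..} (X i \<omega>)) / root_k n"

text \<open>The functional of the limiting bias of the tail. Under the exponential law itself the
  influence function has mean 0, which is what the constants subtracted in \<open>influence\<close>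
  achieve.\<close>

definition influence_mean :: "real \<Rightarrow> real \<Rightarrow> real" where
  "influence_mean a0 a1 = L * (a0 * (1 / (1 - \<xi> * \<tau>) - 1) + a1 * (1 / (1 - 2 * (\<xi> * \<tau>)) - 1 / (1 - \<xi> * \<tau>)))"

text \<open>The second moment of the influence function under the exponential law with mean \<xi>;
  it equals the variance there, as the mean is 0.\<close>

definition influence_var :: "real \<Rightarrow> real \<Rightarrow> real" where
  "influence_var a0 a1 = \<xi>\<^sup>2 * (a0\<^sup>2 + 2 * a0 * a1 / (1 - \<xi> * \<tau>)\<^sup>2 + a1\<^sup>2 / ((1 - 2 * (\<xi> * \<tau>)) * (1 - \<xi> * \<tau>)\<^sup>2))"

lemma one_minus_pos: "1 - \<xi> * \<tau> > 0" "1 - 2 * (\<xi> * \<tau>) > 0"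
  using mult_pos_neg[OF \<xi> \<tau>] by simp_all

lemma rate_pos: "1 / \<xi> > 0" "1 / \<xi> - \<tau> > 0" "1 / \<xi> - 2 * \<tau> > 0"
proof -
  show "1 / \<xi> > 0" using \<xi> by simp
  then show "1 / \<xi> - \<tau> > 0" "1 / \<xi> - 2 * \<tau> > 0" using \<tau> by linarith+
qed

lemma
  shows influence_deriv: "(influence a0 a1 has_real_derivative a0 + a1 * exp (\<tau> * w)) (at w)"
    and influence_cont: "isCont (\<lambda>w. a0 + a1 * exp (\<tau> * w)) w"
  unfolding influence_def using \<tau> by (auto intro!: derivative_eq_intros)

lemma exp_le_1: "w \<ge> 0 \<Longrightarrow> exp (\<tau> * w) \<le> 1"
  using \<tau> by (simp add: mult_nonpos_nonneg)

lemma influence_deriv_bound: "w \<ge> 0 \<Longrightarrow> \<bar>a0 + a1 * exp (\<tau> * w)\<bar> \<le> \<bar>a0\<bar> + \<bar>a1\<bar>"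
  using exp_le_1[of w] mult_left_mono[of "exp (\<tau> * w)" 1 "\<bar>a1\<bar>"]
  by (intro order_trans[OF abs_triangle_ineq]) (simp add: abs_mult)

text \<open>The growth rate \<open>1 / (4 * \<xi>)\<close> is chosen so that the third power, at
  rate \<open>3 / (4 * \<xi>)\<close>, is still integrable against the exponential tail.\<close>

lemma influence_bound:
  "\<exists>B\<ge>0. \<forall>w\<ge>0. \<bar>influence a0 a1 w\<bar> \<le> B * exp (w / (4 * \<xi>))"
proof (intro exI[of _ "\<bar>a0\<bar> * (4 * \<xi>) + \<bar>influence a0 a1 0\<bar> + \<bar>a1\<bar> * (- 1 / \<tau>)"] conjI allI impI)
  show "0 \<le> \<bar>a0\<bar> * (4 * \<xi>) + \<bar>influence a0 a1 0\<bar> + \<bar>a1\<bar> * (- 1 / \<tau>)"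
    using \<xi> \<tau> by (intro add_nonneg_nonneg mult_nonneg_nonneg) auto
  fix w :: real assume w: "w \<ge> 0"
  have e1: "exp (w / (4 * \<xi>)) \<ge> 1" using w \<xi> by simp
  have ew: "w \<le> (4 * \<xi>) * exp (w / (4 * \<xi>))"
    using exp_ge_add_one_self[of "w / (4 * \<xi>)"] \<xi> by (simp add: field_simps)
  have eq: "influence a0 a1 w = a0 * w + influence a0 a1 0 + a1 * ((exp (\<tau> * w) - 1) / \<tau>)"
    by (simp add: influence_def algebra_simps)
  have "0 \<le> (exp (\<tau> * w) - 1) / \<tau>"
    using exp_le_1[OF w] \<tau> by (intro divide_nonpos_neg) auto
  moreover have "(exp (\<tau> * w) - 1) / \<tau> \<le> - 1 / \<tau>"
    using \<tau> by (intro divide_right_mono_neg) auto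
  ultimately have psi: "\<bar>a1 * ((exp (\<tau> * w) - 1) / \<tau>)\<bar> \<le> \<bar>a1\<bar> * (- 1 / \<tau>)"
    unfolding abs_mult by (intro mult_left_mono) auto
  have "\<bar>influence a0 a1 w\<bar> \<le> \<bar>a0\<bar> * w + \<bar>influence a0 a1 0\<bar> + \<bar>a1\<bar> * (- 1 / \<tau>)"
    unfolding eq using w psi by (intro order_trans[OF abs_triangle_ineq] add_mono order_trans[OF abs_triangle_ineq]) (auto simp: abs_mult)
  also have "\<dots> \<le> \<bar>a0\<bar> * ((4 * \<xi>) * exp (w / (4 * \<xi>))) + \<bar>influence a0 a1 0\<bar> * exp (w / (4 * \<xi>)) + \<bar>a1\<bar> * (- 1 / \<tau>) * exp (w / (4 * \<xi>))"
    using ew e1 \<tau> by (intro add_mono mult_left_mono) (auto simp: mult_le_cancel_left1 divide_nonneg_neg mult_nonneg_nonpos divide_nonpos_neg intro!: divide_right_mono_neg)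
  also have "\<dots> = (\<bar>a0\<bar> * (4 * \<xi>) + \<bar>influence a0 a1 0\<bar> + \<bar>a1\<bar> * (- 1 / \<tau>)) * exp (w / (4 * \<xi>))"
    by (simp add: algebra_simps)
  finally show "\<bar>influence a0 a1 w\<bar> \<le> (\<bar>a0\<bar> * (4 * \<xi>) + \<bar>influence a0 a1 0\<bar> + \<bar>a1\<bar> * (- 1 / \<tau>)) * exp (w / (4 * \<xi>))" .
qed

lemma integral_influence_mean:
  "influence a0 a1 0 + (LINT w|lborel. (a0 + a1 * exp (\<tau> * w)) * exp (- (w / \<xi>)) * indicator {0..} w) = 0"
proof -
  have "has_bochner_integral lborel (\<lambda>w. a0 * (exp (- (1 / \<xi>) * w) * indicator {0..} w)
      + a1 * (exp (- (1 / \<xi> - \<tau>) * w) * indicator {0..} w)) (a0 * (1 / (1 / \<xi>)) + a1 * (1 / (1 / \<xi> - \<tau>)))"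
    using rate_pos by (intro has_bochner_integral_add has_bochner_integral_mult_right has_bochner_integral_exp_Ici)
  moreover have "(a0 + a1 * exp (\<tau> * w)) * exp (- (w / \<xi>)) * indicator {0..} w =
      a0 * (exp (- (1 / \<xi>) * w) * indicator {0..} w) + a1 * (exp (- (1 / \<xi> - \<tau>) * w) * indicator {0..} w)" for w
    by (simp add: algebra_simps flip: exp_add)
  ultimately have "(LINT w|lborel. (a0 + a1 * exp (\<tau> * w)) * exp (- (w / \<xi>)) * indicator {0..} w)
      = a0 * (1 / (1 / \<xi>)) + a1 * (1 / (1 / \<xi> - \<tau>))"
    by (simp only: has_bochner_integral_integral_eq)
  moreover have "1 / (1 / \<xi> - \<tau>) = \<xi> / (1 - \<xi> * \<tau>)" using \<xi> one_minus_pos by (simp add: field_simps)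
  ultimately show ?thesis by (simp add: influence_def)
qed

lemma integral_influence_bias:
  "L / \<xi> * (influence a0 a1 0 + (LINT w|lborel. (a0 + a1 * exp (\<tau> * w)) * exp (- (w / \<xi>)) * exp (\<tau> * w) * indicator {0..} w))
    = influence_mean a0 a1"
proof -
  have "has_bochner_integral lborel (\<lambda>w. a0 * (exp (- (1 / \<xi> - \<tau>) * w) * indicator {0..} w)
      + a1 * (exp (- (1 / \<xi> - 2 * \<tau>) * w) * indicator {0..} w)) (a0 * (1 / (1 / \<xi> - \<tau>)) + a1 * (1 / (1 / \<xi> - 2 * \<tau>)))"
    using rate_pos by (intro has_bochner_integral_add has_bochner_integral_mult_right has_bochner_integral_exp_Ici)
  moreover have "(a0 + a1 * exp (\<tau> * w)) * exp (- (w / \<xi>)) * exp (\<tau> * w) * indicator {0..} w =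
      a0 * (exp (- (1 / \<xi> - \<tau>) * w) * indicator {0..} w) + a1 * (exp (- (1 / \<xi> - 2 * \<tau>) * w) * indicator {0..} w)" for w
    by (simp add: algebra_simps flip: exp_add)
  ultimately have 1: "(LINT w|lborel. (a0 + a1 * exp (\<tau> * w)) * exp (- (w / \<xi>)) * exp (\<tau> * w) * indicator {0..} w)
      = a0 * (1 / (1 / \<xi> - \<tau>)) + a1 * (1 / (1 / \<xi> - 2 * \<tau>))"
    by (simp only: has_bochner_integral_integral_eq)
  have 2: "1 / (1 / \<xi> - \<tau>) = \<xi> / (1 - \<xi> * \<tau>)" "1 / (1 / \<xi> - 2 * \<tau>) = \<xi> / (1 - 2 * (\<xi> * \<tau>))"
    using \<xi> one_minus_pos by (simp_all add: field_simps)
  show ?thesis unfolding 1 2 using \<xi> by (simp add: influence_mean_def influence_def algebra_simps)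
qed

lemma integral_influence_square:
  "(influence a0 a1 0)\<^sup>2 + (LINT w|lborel. (2 * influence a0 a1 w * (a0 + a1 * exp (\<tau> * w))) * exp (- (w / \<xi>)) * indicator {0..} w)
    = influence_var a0 a1"
proof -
  define c where "c = - a0 * \<xi> - a1 * \<xi> / (1 - \<xi> * \<tau>) - a1 / \<tau>"
  define E where "E p w = exp (- p * w) * indicator {0..} w" for p w :: real
  define W where "W p w = w * exp (- p * w) * indicator {0..} w" for p w :: real
  have inf_eq: "influence a0 a1 w = a0 * w + a1 / \<tau> * exp (\<tau> * w) + c" for w
    by (simp add: influence_def c_def algebra_simps diff_divide_distrib)
  have "has_bochner_integral lborel (\<lambda>w. 2 * a0\<^sup>2 * W (1 / \<xi>) w + 2 * a0 * a1 * W (1 / \<xi> - \<tau>) w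
      + 2 * a0 * c * E (1 / \<xi>) w + (2 * a0 * a1 / \<tau> + 2 * a1 * c) * E (1 / \<xi> - \<tau>) w + 2 * a1\<^sup>2 / \<tau> * E (1 / \<xi> - 2 * \<tau>) w)
     (2 * a0\<^sup>2 * (1 / (1 / \<xi>)\<^sup>2) + 2 * a0 * a1 * (1 / (1 / \<xi> - \<tau>)\<^sup>2)
      + 2 * a0 * c * (1 / (1 / \<xi>)) + (2 * a0 * a1 / \<tau> + 2 * a1 * c) * (1 / (1 / \<xi> - \<tau>)) + 2 * a1\<^sup>2 / \<tau> * (1 / (1 / \<xi> - 2 * \<tau>)))"
    unfolding E_def W_def using rate_pos
    by (intro has_bochner_integral_add has_bochner_integral_mult_right has_bochner_integral_exp_Ici has_bochner_integral_id_exp_Ici)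
  moreover have "(2 * influence a0 a1 w * (a0 + a1 * exp (\<tau> * w))) * exp (- (w / \<xi>)) * indicator {0..} w
    = 2 * a0\<^sup>2 * W (1 / \<xi>) w + 2 * a0 * a1 * W (1 / \<xi> - \<tau>) w
      + 2 * a0 * c * E (1 / \<xi>) w + (2 * a0 * a1 / \<tau> + 2 * a1 * c) * E (1 / \<xi> - \<tau>) w + 2 * a1\<^sup>2 / \<tau> * E (1 / \<xi> - 2 * \<tau>) w" for w
  proof -
    define x y where "x = exp (- (w / \<xi>))" and "y = exp (\<tau> * w)"
    have "E (1 / \<xi>) w = x * indicator {0..} w" "E (1 / \<xi> - \<tau>) w = x * y * indicator {0..} w" "E (1 / \<xi> - 2 * \<tau>) w = x * y * y * indicator {0..} w"
      "W (1 / \<xi>) w = w * x * indicator {0..} w" "W (1 / \<xi> - \<tau>) w = w * (x * y) * indicator {0..} w"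
      by (simp_all add: E_def W_def x_def y_def algebra_simps flip: exp_add)
    then show ?thesis
      by (simp only: inf_eq x_def[symmetric] y_def[symmetric]) (simp add: algebra_simps power2_eq_square add_divide_distrib)
  qed
  ultimately have 1: "(LINT w|lborel. (2 * influence a0 a1 w * (a0 + a1 * exp (\<tau> * w))) * exp (- (w / \<xi>)) * indicator {0..} w)
     = 2 * a0\<^sup>2 * (1 / (1 / \<xi>)\<^sup>2) + 2 * a0 * a1 * (1 / (1 / \<xi> - \<tau>)\<^sup>2)
      + 2 * a0 * c * (1 / (1 / \<xi>)) + (2 * a0 * a1 / \<tau> + 2 * a1 * c) * (1 / (1 / \<xi> - \<tau>)) + 2 * a1\<^sup>2 / \<tau> * (1 / (1 / \<xi> - 2 * \<tau>))"
    by (simp only: has_bochner_integral_integral_eq)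
  \<comment> \<open>Expressing \<xi> as (1 - p) / \<tau> and q as 2 * p - 1 leaves a rational
    identity in p, \<tau>, a0 and a1.\<close>
  define p q where "p = 1 - \<xi> * \<tau>" and "q = 1 - 2 * (\<xi> * \<tau>)"
  have pq: "p \<noteq> 0" "q \<noteq> 0" "q = 2 * p - 1" using one_minus_pos by (simp_all add: p_def q_def)
  have 2: "1 / (1 / \<xi> - \<tau>) = \<xi> / p" "1 / (1 / \<xi> - 2 * \<tau>) = \<xi> / q"
    using \<xi> one_minus_pos by (simp_all add: p_def q_def field_simps)
  have 3: "1 / (1 / \<xi> - \<tau>)\<^sup>2 = \<xi>\<^sup>2 / p\<^sup>2" using 2(1) by (metis power_divide power_one)
  have \<xi>_eq: "\<xi> = (1 - p) / \<tau>" using \<tau> by (simp add: p_def)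
  have i0: "influence a0 a1 0 = - a0 * \<xi> - a1 * \<xi> / p" by (simp add: influence_def p_def)
  have c_eq: "c = - a0 * \<xi> - a1 * \<xi> / p - a1 / \<tau>" by (simp add: c_def p_def)
  show ?thesis
    unfolding influence_var_def 1 2 3 i0 c_eq p_def[symmetric] q_def[symmetric]
    using pq(1,2) \<tau> unfolding \<xi>_eq pq(3)
    by (simp add: field_simps) algebra
qed

text \<open>Each summand is the influence function on exceedances, divided by sqrt k, and n / k
  turns its moments into those of the exponential law. The first moment vanishes in the limit and
  leaves the bias, the second gives the variance, and the third is of order 1 / sqrt k.\<close>

lemma char_exceedance_sum:
  "(\<lambda>n. char (distr M borel (exceedance_sum (influence a0 a1) n)) \<theta>) \<longlonglongrightarrow>
    exp (\<i> * \<theta> * complex_of_real (influence_mean a0 a1) - (complex_of_real \<theta>)\<^sup>2 * complex_of_real (influence_var a0 a1) / 2)"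
proof -
  define h where "h = influence a0 a1"
  obtain B where B: "B \<ge> 0" "\<And>w. w \<ge> 0 \<Longrightarrow> \<bar>h w\<bar> \<le> B * exp (w / (4 * \<xi>))"
    using influence_bound unfolding h_def by blast
  have h_deriv: "(h has_real_derivative a0 + a1 * exp (\<tau> * w)) (at w)" for w
    unfolding h_def by (rule influence_deriv)
  have h_cont: "isCont h w" for w using h_deriv by (rule DERIV_isCont)
  have [measurable]: "h \<in> borel_measurable borel"
    using h_cont by (intro borel_measurable_continuous_onI) (simp add: continuous_on_eq_continuous_at)
  define D where "D = \<bar>a0\<bar> + \<bar>a1\<bar>"
  have D: "D \<ge> 0" by (simp add: D_def)
  \<comment> \<open>Zero unless \<open>good n\<close>, so that the third moments are finite for
    every n.\<close>
  define f where "f n x = (if good n then h (ln (x / t n)) * indicator {t n<..} x / root_k n else 0)" for n x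
  have f_meas: "f n \<in> borel_measurable borel" for n unfolding f_def by measurable
  have h_bound: "\<bar>a0 + a1 * exp (\<tau> * w)\<bar> \<le> D * exp (0 * w)" if "w \<ge> 0" for w
    using influence_deriv_bound[OF that, of a0 a1] by (simp add: D_def)
  have mean: "(\<lambda>n. root_k n * (real n / real (k n) * (LINT x|N. h (ln (x / t n)) * indicator {t n<..} x))) \<longlonglongrightarrow> influence_mean a0 a1"
    using exceedance_moment_bias(2)[OF h_deriv influence_cont h_bound rate_pos(1)]
    unfolding h_def integral_influence_mean integral_influence_bias by simp
  have sq_deriv: "((\<lambda>w. (h w)\<^sup>2) has_real_derivative 2 * h w * (a0 + a1 * exp (\<tau> * w))) (at w)" for w
    using h_deriv[of w] by (auto intro!: derivative_eq_intros)
  have sq_cont: "isCont (\<lambda>w. 2 * h w * (a0 + a1 * exp (\<tau> * w))) w" for w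
    using h_cont[of w] by simp
  have sq_bound: "\<bar>2 * h w * (a0 + a1 * exp (\<tau> * w))\<bar> \<le> 2 * B * D * exp (1 / (4 * \<xi>) * w)" if "w \<ge> 0" for w
  proof -
    have "\<bar>h w\<bar> * \<bar>a0 + a1 * exp (\<tau> * w)\<bar> \<le> (B * exp (w / (4 * \<xi>))) * D"
      using B(2)[OF that] influence_deriv_bound[OF that, of a0 a1] by (intro mult_mono) (auto simp: D_def)
    moreover have "\<bar>2 * h w * (a0 + a1 * exp (\<tau> * w))\<bar> = 2 * (\<bar>h w\<bar> * \<bar>a0 + a1 * exp (\<tau> * w)\<bar>)"
      unfolding abs_mult by simp
    moreover have "2 * B * D * exp (1 / (4 * \<xi>) * w) = 2 * ((B * exp (w / (4 * \<xi>))) * D)" by simp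
    ultimately show ?thesis by linarith
  qed
  have var: "(\<lambda>n. real n / real (k n) * (LINT x|N. (h (ln (x / t n)))\<^sup>2 * indicator {t n<..} x)) \<longlonglongrightarrow> influence_var a0 a1"
  proof -
    have "1 / (4 * \<xi>) = 1 / 4 * (1 / \<xi>)" by simp
    then have "1 / (4 * \<xi>) < 1 / \<xi>" using rate_pos(1) by linarith
    from exceedance_moment_lim[OF sq_deriv sq_cont sq_bound this] show ?thesis
      unfolding h_def integral_influence_square .
  qed
  \<comment> \<open>An exponential majorant of the cubed influence function, up to the factor
    \<open>B ^ 3\<close>.\<close>
  define G where "G w = exp (3 / (4 * \<xi>) * w)" for w
  have G_deriv: "(G has_real_derivative 3 / (4 * \<xi>) * exp (3 / (4 * \<xi>) * w)) (at w)" for w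
    unfolding G_def using \<xi> by (auto intro!: derivative_eq_intros)
  have G_cont: "isCont (\<lambda>w. 3 / (4 * \<xi>) * exp (3 / (4 * \<xi>) * w)) w" for w
    using \<xi> by (auto intro!: continuous_intros)
  have G_bound: "\<bar>3 / (4 * \<xi>) * exp (3 / (4 * \<xi>) * w)\<bar> \<le> 3 / (4 * \<xi>) * exp (3 / (4 * \<xi>) * w)" for w
    using \<xi> by simp
  have "3 / (4 * \<xi>) = 3 / 4 * (1 / \<xi>)" by simp
  then have G_rate: "3 / (4 * \<xi>) < 1 / \<xi>" using rate_pos(1) by linarith
  note G_lim = exceedance_moment_lim[OF G_deriv G_cont G_bound G_rate]
  note G_int = exceedance_moment_bias(1)[OF G_deriv G_cont G_bound G_rate]
  have cube_le: "\<bar>f n x\<bar> ^ 3 \<le> B ^ 3 / root_k n ^ 3 * (G (ln (x / t n)) * indicator {t n<..} x)" if "good n" for n x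
  proof (cases "x > t n")
    case True
    then have u: "ln (x / t n) \<ge> 0" using good_pos[OF that] by simp
    have "\<bar>h (ln (x / t n))\<bar> ^ 3 \<le> (B * exp (ln (x / t n) / (4 * \<xi>))) ^ 3"
      using B(2)[OF u] by (intro power_mono) auto
    also have "\<dots> = B ^ 3 * G (ln (x / t n))"
      by (simp add: G_def power_mult_distrib flip: exp_of_nat_mult)
    finally show ?thesis
      using True that by (simp add: f_def power_divide power_mult_distrib abs_mult divide_right_mono)
  qed (use that in \<open>simp add: f_def\<close>)
  have cube: "integrable N (\<lambda>x. \<bar>f n x\<bar> ^ 3)" for n
  proof (cases "good n")
    case True
    show ?thesis
    proof (rule Bochner_Integration.integrable_bound)
      show "integrable N (\<lambda>x. B ^ 3 / root_k n ^ 3 * (G (ln (x / t n)) * indicator {t n<..} x))"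
        using G_int[OF True] by (rule integrable_mult_right)
      show "(\<lambda>x. \<bar>f n x\<bar> ^ 3) \<in> borel_measurable N"
        using measurable_N[OF f_meas[of n]] by measurable
      show "AE x in N. norm (\<bar>f n x\<bar> ^ 3) \<le> norm (B ^ 3 / root_k n ^ 3 * (G (ln (x / t n)) * indicator {t n<..} x))"
      proof (intro always_eventually allI)
        fix x
        have "norm (\<bar>f n x\<bar> ^ 3) = \<bar>f n x\<bar> ^ 3" by simp
        also note cube_le[OF True]
        also have "y \<le> norm y" for y :: real by simp
        finally show "norm (\<bar>f n x\<bar> ^ 3) \<le> norm (B ^ 3 / root_k n ^ 3 * (G (ln (x / t n)) * indicator {t n<..} x))" .
      qed
    qed
  qed (simp add: f_def)
  have "(\<lambda>n. char (distr M borel (\<lambda>\<omega>. \<Sum>i=1..n. f n (X i \<omega>))) \<theta>) \<longlonglongrightarrow> exp (\<i> * \<theta> * complex_of_real (influence_mean a0 a1) - (complex_of_real \<theta>)\<^sup>2 * complex_of_real (influence_var a0 a1) / 2)"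
  proof (rule char_sum_tendsto_normal[OF f_meas cube])
    show "(\<lambda>n. real n * (LINT x|N. f n x)) \<longlonglongrightarrow> influence_mean a0 a1"
    proof (rule Lim_transform_eventually[OF mean], use eventually_good in eventually_elim)
      case (elim n)
      have "(LINT x|N. f n x) = (LINT x|N. h (ln (x / t n)) * indicator {t n<..} x) / root_k n"
        using elim by (simp add: f_def)
      moreover have "root_k n * (real n / real (k n) * y) = real n * (y / root_k n)" for y
      proof -
        define s where "s = root_k n"
        have s: "s > 0" "real (k n) = s * s" using good_pos[OF elim] by (simp_all add: s_def)
        show ?thesis unfolding s_def[symmetric] s(2) using s(1) by (simp add: field_simps)
      qed
      ultimately show ?case by simp
    qed
    show "(\<lambda>n. real n * (LINT x|N. (f n x)\<^sup>2)) \<longlonglongrightarrow> influence_var a0 a1"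
    proof (rule Lim_transform_eventually[OF var], use eventually_good in eventually_elim)
      case (elim n)
      have "(f n x)\<^sup>2 = (h (ln (x / t n)))\<^sup>2 * indicator {t n<..} x / real (k n)" for x
        using elim by (simp add: f_def power_divide power_mult_distrib indicator_def)
      then show ?case by (simp add: field_simps)
    qed
    show "(\<lambda>n. real n * (LINT x|N. \<bar>f n x\<bar> ^ 3)) \<longlonglongrightarrow> 0"
    proof (rule Lim_null_comparison)
      have "(\<lambda>n. B ^ 3 * (inverse (root_k n) * (real n / real (k n) * (LINT x|N. G (ln (x / t n)) * indicator {t n<..} x)))) \<longlonglongrightarrow>
         B ^ 3 * (0 * (G 0 + (LINT w|lborel. 3 / (4 * \<xi>) * exp (3 / (4 * \<xi>) * w) * exp (- (w / \<xi>)) * indicator {0..} w)))"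
        by (intro tendsto_mult tendsto_const tendsto_inverse_0_at_top sqrt_k G_lim)
      then show "(\<lambda>n. B ^ 3 * (inverse (root_k n) * (real n / real (k n) * (LINT x|N. G (ln (x / t n)) * indicator {t n<..} x)))) \<longlonglongrightarrow> 0"
        by simp
      show "\<forall>\<^sub>F n in sequentially. norm (real n * (LINT x|N. \<bar>f n x\<bar> ^ 3))
          \<le> B ^ 3 * (inverse (root_k n) * (real n / real (k n) * (LINT x|N. G (ln (x / t n)) * indicator {t n<..} x)))"
        using eventually_good
      proof eventually_elim
        case (elim n)
        have "(LINT x|N. \<bar>f n x\<bar> ^ 3) \<le> (LINT x|N. B ^ 3 / root_k n ^ 3 * (G (ln (x / t n)) * indicator {t n<..} x))"
          using cube G_int[OF elim] cube_le[OF elim] by (intro integral_mono integrable_mult_right) auto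
        also have "\<dots> = B ^ 3 / root_k n ^ 3 * (LINT x|N. G (ln (x / t n)) * indicator {t n<..} x)"
          by (rule integral_mult_right_zero)
        finally have "real n * (LINT x|N. \<bar>f n x\<bar> ^ 3) \<le> real n * (B ^ 3 / root_k n ^ 3 * (LINT x|N. G (ln (x / t n)) * indicator {t n<..} x))"
          by (intro mult_left_mono) auto
        also have "\<dots> = B ^ 3 * (inverse (root_k n) * (real n / real (k n) * (LINT x|N. G (ln (x / t n)) * indicator {t n<..} x)))"
          using good_pos[OF elim] by (simp add: power3_eq_cube field_simps)
        finally show ?case by simp
      qed
    qed
  qed
  then show ?thesis
  proof (rule Lim_transform_eventually, use eventually_good in eventually_elim)
    case (elim n)
    have "(\<lambda>\<omega>. \<Sum>i=1..n. f n (X i \<omega>)) = exceedance_sum (influence a0 a1) n"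
      by (intro ext) (simp only: f_def elim if_True exceedance_sum_def h_def sum_divide_distrib)
    then show ?case by simp
  qed
qed

end

subsection \<open>The tail empirical process\<close>

text \<open>The integral of \<open>exp (s * v)\<close> over v from 0 to u, including s = 0. A log
  excess is its own value at s = 0, and \<open>y powr s = 1 + s * exp_primitive s (ln y)\<close> for
  y > 0, so the Hill estimator and \<open>E_stat\<close> belong to one family.\<close>

definition exp_primitive :: "real \<Rightarrow> real \<Rightarrow> real" where
  "exp_primitive s u = (if s = 0 then u else (exp (s * u) - 1) / s)"

lemma exp_primitive_0 [simp]: "exp_primitive s 0 = 0" "exp_primitive 0 u = u"
  by (simp_all add: exp_primitive_def)

lemma exp_primitive_deriv: "(exp_primitive s has_real_derivative exp (s * w)) (at w)"
proof (cases "s = 0")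
  case True
  then have "exp_primitive s = (\<lambda>u. u)" by (simp add: exp_primitive_def fun_eq_iff)
  then show ?thesis using True by simp
next
  case False
  then have "exp_primitive s = (\<lambda>u. (exp (s * u) - 1) / s)" by (simp add: exp_primitive_def fun_eq_iff)
  then show ?thesis using False by (auto intro!: derivative_eq_intros)
qed

context tail_sample
begin

definition count :: "nat \<Rightarrow> real \<Rightarrow> 'a \<Rightarrow> real" where
  "count n w \<omega> = (\<Sum>i=1..n. indicator {t n * exp w<..} (X i \<omega>))"

text \<open>Centred by the observed number of exceedances of the threshold, not by the expectation:
  this centring integrates to sums over exceedances with a constant subtracted from each
  term.\<close>

definition tail_process :: "nat \<Rightarrow> real \<Rightarrow> 'a \<Rightarrow> real" where
  "tail_process n w \<omega> = (count n w \<omega> - exp (- (w / \<xi>)) * count n 0 \<omega>) / root_k n"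

definition exceedance_exp :: "real \<Rightarrow> nat \<Rightarrow> 'a \<Rightarrow> real" where
  "exceedance_exp s = exceedance_sum (\<lambda>u. exp_primitive s u - \<xi> / (1 - \<xi> * s))"

definition process_norm :: "nat \<Rightarrow> 'a \<Rightarrow> real" where
  "process_norm n \<omega> = (LINT w|lborel. \<bar>tail_process n w \<omega>\<bar> * indicator {0..} w)"

lemma exceedance_sum_influence:
  "exceedance_sum (influence a0 a1) n \<omega> = a0 * exceedance_exp 0 n \<omega> + a1 * exceedance_exp \<tau> n \<omega>"
proof -
  have eq: "influence a0 a1 u = a0 * (exp_primitive 0 u - \<xi> / (1 - \<xi> * 0)) + a1 * (exp_primitive \<tau> u - \<xi> / (1 - \<xi> * \<tau>))" for u
    using \<tau> by (simp add: influence_def exp_primitive_def)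
  show ?thesis
    unfolding exceedance_exp_def exceedance_sum_def eq
    by (simp only: distrib_right sum.distrib add_divide_distrib sum_distrib_left times_divide_eq_right mult.assoc)
qed

text \<open>Termwise, the indicator part integrates to \<open>exp_primitive s (ln (x / t n))\<close>
  and the exponential part to \<open>\<xi> / (1 - \<xi> * s)\<close>. In this form s enters only
  through a deterministic kernel, so bounds in s hold for each \<omega> and a random s can be
  inserted.\<close>

lemma exceedance_exp_eq_integral:
  assumes n: "good n" and s: "s \<le> 0"
  shows "has_bochner_integral lborel (\<lambda>w. exp (s * w) * tail_process n w \<omega> * indicator {0..} w) (exceedance_exp s n \<omega>)"
proof -
  define c where "c x w = exp (s * w) * (indicator {t n * exp w<..} x - exp (- (w / \<xi>)) * indicator {t n<..} x) * indicator {0..} w" for x w :: real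
  have rate: "1 / \<xi> - s > 0" using rate_pos(1) s by linarith
  have c_int: "has_bochner_integral lborel (c x)
      ((exp_primitive s (ln (x / t n)) - \<xi> / (1 - \<xi> * s)) * indicator {t n<..} x)" for x
  proof (cases "x > t n")
    case True
    then have x: "x > 0" "ln (x / t n) \<ge> 0" using good_pos(3)[OF n] by auto
    have "(t n * exp w < x) = (w < ln (x / t n))" for w
      using good_pos(3)[OF n] x(1) by (metis divide_pos_pos exp_less_cancel_iff exp_ln mult.commute pos_less_divide_eq)
    then have "c x = (\<lambda>w. exp (s * w) * indicator {0..<ln (x / t n)} w - exp (- (1 / \<xi> - s) * w) * indicator {0..} w)"
      using True by (auto simp: c_def indicator_def algebra_simps fun_eq_iff simp flip: exp_add)
    moreover have "has_bochner_integral lborel (\<lambda>w. exp (s * w) * indicator {0..<ln (x / t n)} w - exp (- (1 / \<xi> - s) * w) * indicator {0..} w)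
      ((exp_primitive s (ln (x / t n)) - exp_primitive s 0) - 1 / (1 / \<xi> - s))"
      using x rate by (intro has_bochner_integral_diff integral_FTC_Ico exp_primitive_deriv has_bochner_integral_exp_Ici) auto
    moreover have "1 / (1 / \<xi> - s) = \<xi> / (1 - \<xi> * s)"
    proof -
      have "1 / \<xi> - s = (1 - \<xi> * s) / \<xi>" using \<xi> by (simp add: diff_divide_distrib)
      then show ?thesis by simp
    qed
    ultimately show ?thesis using True by simp
  next
    case False
    have "\<not> t n * exp w < x" if "w \<ge> 0" for w
    proof -
      have "t n * 1 \<le> t n * exp w" using that good_pos(3)[OF n] by (intro mult_left_mono) auto
      then show ?thesis using False by simp
    qed
    then have "c x = (\<lambda>w. 0)" using False by (auto simp: c_def indicator_def fun_eq_iff)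
    then show ?thesis using False by (simp add: has_bochner_integral_zero)
  qed
  have "has_bochner_integral lborel (\<lambda>w. (\<Sum>i=1..n. c (X i \<omega>) w) / root_k n) (exceedance_exp s n \<omega>)"
    unfolding exceedance_exp_def exceedance_sum_def
    by (intro has_bochner_integral_divide_zero has_bochner_integral_sum c_int)
  moreover have "(\<Sum>i=1..n. c (X i \<omega>) w) / root_k n = exp (s * w) * tail_process n w \<omega> * indicator {0..} w" for w
  proof -
    have "(\<Sum>i=1..n. c (X i \<omega>) w) = exp (s * w) * (count n w \<omega> - exp (- (w / \<xi>)) * count n 0 \<omega>) * indicator {0..} w"
      unfolding c_def count_def sum_distrib_right[symmetric] sum_distrib_left[symmetric] sum_subtractf exp_zero mult_1_right ..
    then show ?thesis by (simp add: tail_process_def)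
  qed
  ultimately show ?thesis by simp
qed

lemma integrable_tail_process:
  assumes "good n"
  shows "integrable lborel (\<lambda>w. \<bar>tail_process n w \<omega>\<bar> * indicator {0..} w)"
proof -
  have "integrable lborel (\<lambda>w. tail_process n w \<omega> * indicator {0..} w)"
    using exceedance_exp_eq_integral[OF assms, of 0 \<omega>] by (simp add: has_bochner_integral_iff)
  then have "integrable lborel (\<lambda>w. \<bar>tail_process n w \<omega> * indicator {0..} w\<bar>)" by (rule integrable_abs)
  then show ?thesis by (simp add: abs_mult)
qed

lemma abs_integral_tail_process:
  assumes n: "good n" and f: "has_bochner_integral lborel (\<lambda>w. f w * tail_process n w \<omega> * indicator {0..} w) I"
    and c: "\<And>w. w \<ge> 0 \<Longrightarrow> \<bar>f w\<bar> \<le> c"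
  shows "\<bar>I\<bar> \<le> c * process_norm n \<omega>"
proof -
  have "\<bar>I\<bar> = \<bar>LINT w|lborel. f w * tail_process n w \<omega> * indicator {0..} w\<bar>"
    using has_bochner_integral_integral_eq[OF f] by simp
  also have "\<dots> \<le> (LINT w|lborel. c * (\<bar>tail_process n w \<omega>\<bar> * indicator {0..} w))"
  proof (rule integral_abs_bound[THEN order_trans], rule integral_mono)
    show "integrable lborel (\<lambda>w. \<bar>f w * tail_process n w \<omega> * indicator {0..} w\<bar>)"
      using f by (auto simp: has_bochner_integral_iff)
    show "integrable lborel (\<lambda>w. c * (\<bar>tail_process n w \<omega>\<bar> * indicator {0..} w))"
      by (intro integrable_mult_right integrable_tail_process n)
    show "\<bar>f w * tail_process n w \<omega> * indicator {0..} w\<bar> \<le> c * (\<bar>tail_process n w \<omega>\<bar> * indicator {0..} w)" for w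
      using c[of w] by (auto simp: abs_mult indicator_def mult_right_mono)
  qed
  also have "\<dots> = c * process_norm n \<omega>"
    unfolding process_norm_def by (rule integral_mult_right_zero)
  finally show ?thesis .
qed

lemma exceedance_exp_bound:
  assumes "good n" "s \<le> 0"
  shows "\<bar>exceedance_exp s n \<omega>\<bar> \<le> process_norm n \<omega>"
  using abs_integral_tail_process[OF assms(1) exceedance_exp_eq_integral[OF assms], of 1] assms(2)
  by (simp add: mult_nonpos_nonneg)

text \<open>The derivative in s is \<open>w * exp (s * w)\<close>, at most 1 / c when
  \<open>s \<le> - c\<close>; keeping s away from 0 makes the bound uniform in w.\<close>

lemma exp_diff_bound:
  fixes s s' c w :: real
  assumes "s \<le> - c" "s' \<le> - c" "c > 0" "w \<ge> 0"
  shows "\<bar>exp (s * w) - exp (s' * w)\<bar> \<le> \<bar>s - s'\<bar> / c"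
proof -
  have *: "exp (s * w) - exp (s' * w) \<le> (s - s') / c" if "s' \<le> s" "s \<le> - c" for s s'
  proof -
    have "exp (s * w) * (1 + (s' - s) * w) \<le> exp (s * w) * exp ((s' - s) * w)"
      using exp_ge_add_one_self[of "(s' - s) * w"] by (intro mult_left_mono) auto
    also have "\<dots> = exp (s' * w)" by (simp add: algebra_simps flip: exp_add)
    finally have "exp (s * w) - exp (s' * w) \<le> (s - s') * (w * exp (s * w))" by (simp add: algebra_simps)
    also have "w * exp (s * w) \<le> w * exp (- (c * w))"
      using that assms by (intro mult_left_mono) (auto intro: mult_right_mono[of s "-c" w, simplified])
    also have "w * exp (- (c * w)) \<le> 1 / c"
    proof -
      have "c * w \<le> exp (c * w)" using exp_ge_add_one_self[of "c * w"] by linarith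
      then show ?thesis using assms by (simp add: exp_minus field_simps)
    qed
    finally show ?thesis using that by (simp add: mult_left_mono)
  qed
  have "exp (s * w) - exp (s' * w) \<le> \<bar>s - s'\<bar> / c \<and> exp (s' * w) - exp (s * w) \<le> \<bar>s - s'\<bar> / c"
  proof (cases "s' \<le> s")
    case True
    then have "exp (s' * w) \<le> exp (s * w)" using assms(4) by (simp add: mult_right_mono)
    then show ?thesis using *[of s' s] True assms by (auto intro: order_trans[of _ 0])
  next
    case False
    then have "exp (s * w) \<le> exp (s' * w)" using assms(4) by (simp add: mult_right_mono)
    then show ?thesis using *[of s s'] False assms by (auto intro: order_trans[of _ 0])
  qed
  then show ?thesis by (simp add: abs_le_iff)
qed

lemma exceedance_exp_lipschitz:
  assumes "good n" "s \<le> - c" "s' \<le> - c" "c > 0"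
  shows "\<bar>exceedance_exp s n \<omega> - exceedance_exp s' n \<omega>\<bar> \<le> \<bar>s - s'\<bar> / c * process_norm n \<omega>"
proof (rule abs_integral_tail_process[OF assms(1)])
  show "has_bochner_integral lborel (\<lambda>w. (exp (s * w) - exp (s' * w)) * tail_process n w \<omega> * indicator {0..} w)
      (exceedance_exp s n \<omega> - exceedance_exp s' n \<omega>)"
    using has_bochner_integral_diff[OF exceedance_exp_eq_integral[OF assms(1), of s \<omega>] exceedance_exp_eq_integral[OF assms(1), of s' \<omega>]] assms
    by (simp add: algebra_simps)
  show "\<bar>exp (s * w) - exp (s' * w)\<bar> \<le> \<bar>s - s'\<bar> / c" if "w \<ge> 0" for w
    by (rule exp_diff_bound[OF assms(2,3,4) that])
qed

lemma integral_indicator_N: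
  "(LINT x|N. indicator {t n * exp w<..} x) = 1 - cdf N (t n * exp w)" "integrable N (indicat_real {y<..})"
proof -
  interpret N': real_distribution N by (rule N)
  have "{t n * exp w<..} = UNIV - {..t n * exp w}" by auto
  then show "(LINT x|N. indicator {t n * exp w<..} x) = 1 - cdf N (t n * exp w)"
    using N'.prob_compl[of "{..t n * exp w}"] by (simp add: cdf_def)
  show "integrable N (indicat_real {y<..})"
    by (intro N'.integrable_const_bound[of _ 1]) (auto simp: indicator_def)
qed

text \<open>The decay in w is the point: the square root of the bound is integrable over w, which
  gives the process a bounded expected norm.\<close>

lemma tail_process_second_moment:
  assumes n: "good n" and w: "w \<ge> 0"
  shows "integrable M (\<lambda>\<omega>. (tail_process n w \<omega>)\<^sup>2)"
    and "expectation (\<lambda>\<omega>. (tail_process n w \<omega>)\<^sup>2) \<le> (2 * (1 + tail_const) + (2 * tail_const)\<^sup>2) * exp (- (w / \<xi>))"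
proof -
  interpret N': real_distribution N by (rule N)
  define s where "s = root_k n"
  have s: "s > 0" "s\<^sup>2 = real (k n)" using good_pos[OF n] by (simp_all add: s_def)
  define e where "e = exp (- (w / \<xi>))"
  have e: "0 < e" "e \<le> 1" using w \<xi> by (simp_all add: e_def)
  define f where "f x = (indicator {t n * exp w<..} x - e * indicator {t n * exp 0<..} x) / s" for x :: real
  have f [measurable]: "f \<in> borel_measurable borel" unfolding f_def by measurable
  have f_sq_int: "integrable N (\<lambda>x. (f x)\<^sup>2)"
  proof (rule N'.integrable_const_bound[of _ "(1 / s)\<^sup>2"])
    have "\<bar>f x\<bar> \<le> 1 / s" for x
      using s e by (auto simp: f_def indicator_def abs_divide divide_right_mono)
    then show "AE x in N. norm ((f x)\<^sup>2) \<le> (1 / s)\<^sup>2"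
      using s by (auto intro!: always_eventually power_mono simp flip: abs_le_square_iff)
  qed (use measurable_N[OF f] in measurable)
  have process_eq: "tail_process n w \<omega> = (\<Sum>i=1..n. f (X i \<omega>)) - 0" for \<omega>
    by (simp add: tail_process_def count_def f_def e_def s_def sum_subtractf sum_distrib_left sum_divide_distrib[symmetric] diff_divide_distrib)
  show "integrable M (\<lambda>\<omega>. (tail_process n w \<omega>)\<^sup>2)"
    unfolding process_eq by (rule second_moment_sum(1)[OF f f_sq_int])
  have nk: "real n / s\<^sup>2 * (1 - cdf N (t n * exp v)) = scaled_tail n v" for v
    by (simp add: scaled_tail_def s)
  have r: "0 \<le> scaled_tail n w" "scaled_tail n w \<le> (1 + tail_const) * e" "0 \<le> scaled_tail n 0" "scaled_tail n 0 \<le> 1 + tail_const"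
    using good_bound[OF n w] good_bound[OF n, of 0] by (simp_all add: e_def)
  have m2: "real n * (LINT x|N. (f x)\<^sup>2) \<le> 2 * (1 + tail_const) * e"
  proof -
    have "(LINT x|N. (f x)\<^sup>2) \<le> (LINT x|N. (indicator {t n * exp w<..} x + e * indicator {t n * exp 0<..} x) / s\<^sup>2)"
    proof (rule integral_mono[OF f_sq_int])
      show "integrable N (\<lambda>x. (indicator {t n * exp w<..} x + e * indicator {t n * exp 0<..} x) / s\<^sup>2)"
        using integral_indicator_N(2) by auto
      have "(a - e * b)\<^sup>2 \<le> a + e * b" if "a = 0 \<or> a = 1" "b = 0 \<or> b = 1" for a b :: real
        using that e by (auto simp: power2_eq_square algebra_simps mult_le_one mult_left_le)
      then show "(f x)\<^sup>2 \<le> (indicator {t n * exp w<..} x + e * indicator {t n * exp 0<..} x) / s\<^sup>2" for x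
        unfolding f_def power_divide by (intro divide_right_mono) (auto simp: indicator_def)
    qed
    also have "\<dots> = ((1 - cdf N (t n * exp w)) + e * (1 - cdf N (t n * exp 0))) / s\<^sup>2"
      using integral_indicator_N by (simp del: integral_indicator exp_zero)
    finally have "real n * (LINT x|N. (f x)\<^sup>2) \<le> real n * (((1 - cdf N (t n * exp w)) + e * (1 - cdf N (t n * exp 0))) / s\<^sup>2)"
      by (intro mult_left_mono) auto
    also have "\<dots> = scaled_tail n w + e * scaled_tail n 0"
      unfolding nk[symmetric] using s(1) by (simp add: field_simps)
    also have "\<dots> \<le> (1 + tail_const) * e + e * (1 + tail_const)"
      using r e by (intro add_mono mult_left_mono) auto
    finally show ?thesis by (simp add: algebra_simps)
  qed
  have m1: "\<bar>real n * (LINT x|N. f x)\<bar> \<le> 2 * tail_const * e"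
  proof -
    have "(LINT x|N. f x) = ((1 - cdf N (t n * exp w)) - e * (1 - cdf N (t n * exp 0))) / s"
      unfolding f_def using integral_indicator_N by (simp del: integral_indicator exp_zero)
    moreover have "real n * ((a - e * b) / s) = s * (real n / s\<^sup>2 * a - e * (real n / s\<^sup>2 * b))" for a b
      using s(1) by (simp add: field_simps power2_eq_square)
    ultimately have "real n * (LINT x|N. f x) = s * (scaled_tail n w - e * scaled_tail n 0)"
      unfolding nk[symmetric] by simp
    \<comment> \<open>The mean is a combination of two deviations of the tail from the exponential,
      at w and at 0; both contributions decay like e.\<close>
    also have "\<dots> = s * (scaled_tail n w - e) - e * (s * (scaled_tail n 0 - 1))"
      by (simp add: algebra_simps)
    finally have "\<bar>real n * (LINT x|N. f x)\<bar> \<le> \<bar>s * (scaled_tail n w - e)\<bar> + e * \<bar>s * (scaled_tail n 0 - 1)\<bar>"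
      using e abs_triangle_ineq4[of "s * (scaled_tail n w - e)" "e * (s * (scaled_tail n 0 - 1))"] by (simp add: abs_mult)
    also have "\<dots> \<le> tail_const * e + e * tail_const"
      using good_dev[OF n w] good_dev[OF n, of 0] e by (intro add_mono mult_left_mono) (auto simp: e_def s_def)
    finally show ?thesis by (simp add: algebra_simps)
  qed
  have "(real n * (LINT x|N. f x) - 0)\<^sup>2 \<le> (2 * tail_const * e)\<^sup>2"
    using m1 by (simp add: abs_le_square_iff[symmetric])
  also have "\<dots> \<le> (2 * tail_const)\<^sup>2 * e"
  proof -
    have "e\<^sup>2 \<le> e" using e by (simp add: power2_eq_square mult_left_le)
    from mult_left_mono[OF this, of "(2 * tail_const)\<^sup>2"] show ?thesis by (simp add: power_mult_distrib)
  qed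
  finally have "real n * (LINT x|N. (f x)\<^sup>2) + (real n * (LINT x|N. f x) - 0)\<^sup>2 \<le> (2 * (1 + tail_const) + (2 * tail_const)\<^sup>2) * e"
    using m2 by (simp add: distrib_right)
  then show "expectation (\<lambda>\<omega>. (tail_process n w \<omega>)\<^sup>2) \<le> (2 * (1 + tail_const) + (2 * tail_const)\<^sup>2) * exp (- (w / \<xi>))"
    unfolding process_eq e_def[symmetric] using second_moment_sum(2)[OF f f_sq_int, of n 0] by linarith
qed

lemma measurable_tail_process [measurable]:
  "(\<lambda>(\<omega>, w). tail_process n w \<omega>) \<in> borel_measurable (M \<Otimes>\<^sub>M lborel)"
proof -
  have "(\<lambda>p. indicat_real {p. t n * exp (snd p) < X i (fst p)} p) \<in> borel_measurable (M \<Otimes>\<^sub>M lborel)" if "i \<in> {1..n}" for i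
  proof -
    have [measurable]: "X i \<in> borel_measurable M" using that by (intro measurable_X) simp
    show ?thesis by measurable
  qed
  then have 1: "(\<lambda>p. \<Sum>i=1..n. indicat_real {p. t n * exp (snd p) < X i (fst p)} p) \<in> borel_measurable (M \<Otimes>\<^sub>M lborel)"
    by (intro borel_measurable_sum) auto
  have "(\<lambda>p. indicat_real {p. t n < X i (fst p)} p) \<in> borel_measurable (M \<Otimes>\<^sub>M lborel)" if "i \<in> {1..n}" for i
  proof -
    have [measurable]: "X i \<in> borel_measurable M" using that by (intro measurable_X) simp
    show ?thesis by measurable
  qed
  then have 2: "(\<lambda>p. \<Sum>i=1..n. indicat_real {p. t n < X i (fst p)} p) \<in> borel_measurable (M \<Otimes>\<^sub>M lborel)"
    by (intro borel_measurable_sum) auto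
  have "(\<lambda>(\<omega>, w). tail_process n w \<omega>) = (\<lambda>p. ((\<Sum>i=1..n. indicat_real {p. t n * exp (snd p) < X i (fst p)} p)
      - exp (- (snd p / \<xi>)) * (\<Sum>i=1..n. indicat_real {p. t n < X i (fst p)} p)) / root_k n)"
    by (auto simp: tail_process_def count_def fun_eq_iff indicator_def)
  then show ?thesis using 1 2 by simp
qed

text \<open>Tonelli reduces the claim to first absolute moments integrated over w. These are
  obtained from the second moments by a weighted arithmetic-geometric mean inequality.\<close>

lemma tight_process_norm: "tight_in_prob M (\<lambda>p. process_norm (fst p) (snd p))"
proof -
  define c where "c = 2 * (1 + tail_const) + (2 * tail_const)\<^sup>2"
  have c: "c \<ge> 0" using tail_const by (simp add: c_def)
  define \<kappa> where "\<kappa> = 1 / (2 * \<xi>)"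
  have \<kappa>: "\<kappa> > 0" "1 / \<xi> = 2 * \<kappa>" using \<xi> by (simp_all add: \<kappa>_def)
  interpret P: pair_sigma_finite M lborel ..
  show ?thesis
  proof (rule tight_in_probI_nn_integral[where K = "ennreal ((1 + c) / 2 * (1 / \<kappa>))"])
    show "process_norm n \<in> borel_measurable M" for n
      unfolding process_norm_def by measurable
    show "process_norm n \<omega> \<ge> 0" for n \<omega>
      unfolding process_norm_def by (intro Bochner_Integration.integral_nonneg) auto
    show "\<forall>\<^sub>F n in sequentially. (\<integral>\<^sup>+\<omega>. ennreal (process_norm n \<omega>) \<partial>M) \<le> ennreal ((1 + c) / 2 * (1 / \<kappa>))"
      using eventually_good
    proof eventually_elim
      case (elim n)
      have inner: "(\<integral>\<^sup>+\<omega>. ennreal (\<bar>tail_process n w \<omega>\<bar> * indicator {0..} w) \<partial>M)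
          \<le> ennreal ((1 + c) / 2 * (exp (- \<kappa> * w) * indicator {0..} w))" for w
      proof (cases "w \<ge> 0")
        case True
        note sq = tail_process_second_moment[OF elim True]
        \<comment> \<open>The weight in \<open>a \<le> (1 / E + E * a\<^sup>2) / 2\<close>. With
          \<kappa> half of the tail rate, both terms have order \<open>exp (- \<kappa> * w)\<close>
          after taking expectations.\<close>
        define E where "E = exp (\<kappa> * w)"
        have E: "E > 0" by (simp add: E_def)
        have e_eq: "exp (- (w / \<xi>)) = 1 / E\<^sup>2" "exp (- \<kappa> * w) = 1 / E"
        proof -
          have "w / \<xi> = 2 * (\<kappa> * w)" using \<kappa>(2) by (metis mult.assoc mult.commute mult.right_neutral times_divide_eq_right)
          then show "exp (- (w / \<xi>)) = 1 / E\<^sup>2" by (simp add: E_def exp_minus power2_eq_square inverse_eq_divide flip: exp_add)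
        qed (simp add: E_def exp_minus inverse_eq_divide)
        have "(\<integral>\<^sup>+\<omega>. ennreal (\<bar>tail_process n w \<omega>\<bar> * indicator {0..} w) \<partial>M)
            \<le> (\<integral>\<^sup>+\<omega>. ennreal ((1 / E + E * (tail_process n w \<omega>)\<^sup>2) / 2) \<partial>M)"
        proof (intro nn_integral_mono ennreal_leI)
          fix \<omega>
          define a where "a = \<bar>tail_process n w \<omega>\<bar>"
          have "0 \<le> (1 - E * a)\<^sup>2" by simp
          then have "2 * (E * a) \<le> 1 + E * (E * a\<^sup>2)" by (simp add: power2_eq_square algebra_simps)
          then have "a \<le> (1 / E + E * a\<^sup>2) / 2" using E by (simp add: field_simps)
          then show "\<bar>tail_process n w \<omega>\<bar> * indicator {0..} w \<le> (1 / E + E * (tail_process n w \<omega>)\<^sup>2) / 2"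
            using True by (simp add: a_def)
        qed
        also have "\<dots> = ennreal (expectation (\<lambda>\<omega>. (1 / E + E * (tail_process n w \<omega>)\<^sup>2) / 2))"
          using sq(1) E by (intro nn_integral_eq_integral) auto
        also have "expectation (\<lambda>\<omega>. (1 / E + E * (tail_process n w \<omega>)\<^sup>2) / 2) = (1 / E + E * expectation (\<lambda>\<omega>. (tail_process n w \<omega>)\<^sup>2)) / 2"
          using sq(1) by (simp add: prob_space)
        also have "ennreal \<dots> \<le> ennreal ((1 / E + E * (c * (1 / E\<^sup>2))) / 2)"
          using sq(2) E unfolding e_eq c_def by (intro ennreal_leI divide_right_mono add_mono mult_left_mono) auto
        also have "(1 / E + E * (c * (1 / E\<^sup>2))) / 2 = (1 + c) / 2 * (exp (- \<kappa> * w) * indicator {0..} w)"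
          using E True unfolding e_eq by (simp add: power2_eq_square field_simps)
        finally show ?thesis .
      qed simp
      have "(\<integral>\<^sup>+\<omega>. ennreal (process_norm n \<omega>) \<partial>M) = (\<integral>\<^sup>+\<omega>. (\<integral>\<^sup>+w. ennreal (\<bar>tail_process n w \<omega>\<bar> * indicator {0..} w) \<partial>lborel) \<partial>M)"
        unfolding process_norm_def
        using integrable_tail_process[OF elim] by (intro nn_integral_cong nn_integral_eq_integral[symmetric]) auto
      also have "\<dots> = (\<integral>\<^sup>+w. (\<integral>\<^sup>+\<omega>. ennreal (\<bar>tail_process n w \<omega>\<bar> * indicator {0..} w) \<partial>M) \<partial>lborel)"
        by (intro P.Fubini'[symmetric]) measurable
      also have "\<dots> \<le> (\<integral>\<^sup>+w. ennreal ((1 + c) / 2 * (exp (- \<kappa> * w) * indicator {0..} w)) \<partial>lborel)"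
        by (intro nn_integral_mono inner)
      also have "\<dots> = ennreal ((1 + c) / 2 * (1 / \<kappa>))"
      proof -
        have "has_bochner_integral lborel (\<lambda>w. (1 + c) / 2 * (exp (- \<kappa> * w) * indicator {0..} w)) ((1 + c) / 2 * (1 / \<kappa>))"
          by (intro has_bochner_integral_mult_right has_bochner_integral_exp_Ici \<kappa>)
        then have I: "integrable lborel (\<lambda>w. (1 + c) / 2 * (exp (- \<kappa> * w) * indicator {0..} w))"
          and V: "(LINT w|lborel. (1 + c) / 2 * (exp (- \<kappa> * w) * indicator {0..} w)) = (1 + c) / 2 * (1 / \<kappa>)"
          unfolding has_bochner_integral_iff by blast+
        show ?thesis
          unfolding V[symmetric] using c by (intro nn_integral_eq_integral[OF I]) auto
      qed
      finally show ?case .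
    qed
  qed simp
qed

end

subsection \<open>Order statistics\<close>

lemma exp_primitive_mono: "u \<le> v \<Longrightarrow> exp_primitive s u \<le> exp_primitive s v"
  by (rule DERIV_nonneg_imp_nondecreasing) (use exp_primitive_deriv in \<open>auto intro!: exI exp_ge_zero\<close>)

text \<open>A threshold moved by h on the log scale lowers each log excess by h. The new value
  depends affinely on the old one, which makes the comparison of thresholds exact for observations
  above both.\<close>

lemma exp_primitive_diff: "exp (s * h) * exp_primitive s (u - h) = exp_primitive s u - exp_primitive s h"
  by (cases "s = 0") (auto simp: exp_primitive_def field_simps simp flip: exp_add)

text \<open>The quotient \<open>(exp y - 1) / y\<close>, continued by 1 at y = 0. It exposes the
  factor h in \<open>exp_primitive s h\<close> also when s or h is 0.\<close>

definition expm1_quot :: "real \<Rightarrow> real" where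
  "expm1_quot y = exp_primitive y 1"

lemma expm1_quot:
  shows "exp_primitive s h = h * expm1_quot (s * h)" and "exp y - 1 = y * expm1_quot y"
  by (auto simp: expm1_quot_def exp_primitive_def)

lemma isCont_expm1_quot: "isCont expm1_quot 0"
proof -
  have "((\<lambda>y::real. (exp y - exp 0) / (y - 0)) \<longlongrightarrow> exp 0) (at 0)"
    using DERIV_exp[of "0::real"] unfolding has_field_derivative_iff by simp
  then have "((\<lambda>y::real. (exp y - 1) / y) \<longlongrightarrow> 1) (at 0)" by simp
  then have "(expm1_quot \<longlongrightarrow> 1) (at 0)"
    by (rule Lim_transform_within[of _ _ _ _ 1]) (auto simp: expm1_quot_def exp_primitive_def)
  then show ?thesis by (simp add: isCont_def expm1_quot_def exp_primitive_def)
qed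

context
  fixes x :: "nat \<Rightarrow> real" and n k :: nat
  assumes k: "0 < k" "k < n"
begin

definition sorted_sample :: "real list" where
  "sorted_sample = sort (map x [1..<n + 1])"

lemma sorted_sample: "sorted sorted_sample" "length sorted_sample = n"
  by (simp_all add: sorted_sample_def)

lemma sum_sorted_sample: "(\<Sum>i=1..n. f (x i)) = (\<Sum>m<n. f (sorted_sample ! m))" for f :: "real \<Rightarrow> real"
proof -
  have "(\<Sum>i=1..n. f (x i)) = sum_list (map f (map x [1..<n + 1]))"
    using sum_list_distinct_conv_sum_set[of "[1..<n + 1]" "\<lambda>i. f (x i)"]
    by (simp add: atLeastLessThanSuc_atLeastAtMost comp_def del: upt_Suc)
  also have "\<dots> = sum_mset (image_mset f (mset sorted_sample))"
    by (simp add: sorted_sample_def flip: mset_map sum_mset_sum_list)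
  also have "\<dots> = sum_list (map f sorted_sample)"
    by (simp flip: mset_map sum_mset_sum_list)
  also have "\<dots> = (\<Sum>m<n. f (sorted_sample ! m))"
    by (simp add: sum_list_sum_nth sorted_sample atLeast0LessThan)
  finally show ?thesis .
qed

abbreviation (input) thr where "thr \<equiv> order_stat x n (n - k)"

text \<open>\<open>order_stat\<close> counts from 1 and list positions from 0: the threshold sits at
  position \<open>n - k - 1\<close>, directly below the top k positions \<open>n - k..<n\<close>,
  and belongs to both ranges.\<close>

lemma sorted_sample_nth:
  "m < n - k \<Longrightarrow> sorted_sample ! m \<le> thr" "n - k - 1 \<le> m \<Longrightarrow> m < n \<Longrightarrow> thr \<le> sorted_sample ! m"
  using k sorted_sample sorted_nth_mono[of sorted_sample]
  unfolding order_stat_def sorted_sample_def[symmetric] by auto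

lemma sum_split_sample:
  "(\<Sum>m<n. f (sorted_sample ! m)) = (\<Sum>m<n - k. f (sorted_sample ! m)) + (\<Sum>m=n - k..<n. f (sorted_sample ! m))" for f :: "real \<Rightarrow> real"
proof -
  have "{..<n} = {..<n - k} \<union> {n - k..<n}" using k by auto
  then show ?thesis by (simp add: sum.union_disjoint ivl_disj_int)
qed

text \<open>Ties with the threshold can only lower the strict count below k and raise the weak count
  above k + 1.\<close>

lemma count_exceed_threshold:
  "(\<Sum>i=1..n. indicator {thr<..} (x i)) \<le> real k" "(\<Sum>i=1..n. indicator {thr..} (x i)) \<ge> real k + 1"
proof -
  have "(\<Sum>m<n - k. indicat_real {thr<..} (sorted_sample ! m)) = 0"
    using sorted_sample_nth(1) by (intro sum.neutral) (auto simp: indicator_def not_less)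
  moreover have "(\<Sum>m=n - k..<n. indicat_real {thr<..} (sorted_sample ! m)) \<le> (\<Sum>m=n - k..<n. 1)"
    by (intro sum_mono) (auto simp: indicator_def)
  ultimately show "(\<Sum>i=1..n. indicator {thr<..} (x i)) \<le> real k"
    using k unfolding sum_sorted_sample sum_split_sample by simp
  have "(\<Sum>m=n - k..<n. indicat_real {thr..} (sorted_sample ! m)) = (\<Sum>m=n - k..<n. 1)"
    using sorted_sample_nth(2) by (intro sum.cong) (auto simp: indicator_def)
  moreover have "(\<Sum>m<n - k. indicat_real {thr..} (sorted_sample ! m)) \<ge> (\<Sum>m\<in>{n - k - 1}. indicat_real {thr..} (sorted_sample ! m))"
    using k by (intro sum_mono2) auto
  moreover have "(\<Sum>m\<in>{n - k - 1}. indicat_real {thr..} (sorted_sample ! m)) = 1"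
    using sorted_sample_nth(2)[of "n - k - 1"] k by simp
  ultimately show "(\<Sum>i=1..n. indicator {thr..} (x i)) \<ge> real k + 1"
    using k unfolding sum_sorted_sample sum_split_sample by simp
qed

lemma threshold_le_iff: "thr \<le> y \<longleftrightarrow> (\<Sum>i=1..n. indicator {y<..} (x i)) \<le> real k"
proof
  assume "thr \<le> y"
  then have "(\<Sum>i=1..n. indicat_real {y<..} (x i)) \<le> (\<Sum>i=1..n. indicator {thr<..} (x i))"
    by (intro sum_mono) (auto simp: indicator_def)
  with count_exceed_threshold(1) show "(\<Sum>i=1..n. indicat_real {y<..} (x i)) \<le> real k" by linarith
next
  assume *: "(\<Sum>i=1..n. indicat_real {y<..} (x i)) \<le> real k"
  show "thr \<le> y"
  proof (rule ccontr)
    assume "\<not> thr \<le> y"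
    then have "(\<Sum>i=1..n. indicat_real {thr..} (x i)) \<le> (\<Sum>i=1..n. indicator {y<..} (x i))"
      by (intro sum_mono) (auto simp: indicator_def)
    with * count_exceed_threshold(2) show False by linarith
  qed
qed

text \<open>The top k positions may contain values tied with the threshold, which are not strict
  exceedances; their log excess is 0, so \<open>f 0 = 0\<close> makes the two sums agree.\<close>

lemma sum_rel_excess:
  fixes f :: "real \<Rightarrow> real"
  assumes "f 0 = 0" and thr: "thr > 0"
  shows "(\<Sum>j=1..k. f (ln (rel_excess x n k j))) = (\<Sum>i=1..n. f (ln (x i / thr)) * indicator {thr<..} (x i))"
proof -
  have "(\<Sum>j=1..k. f (ln (rel_excess x n k j))) = (\<Sum>m=n - k..<n. f (ln (sorted_sample ! m / thr)))"
  proof (rule sum.reindex_bij_witness[of _ "\<lambda>m. n - m" "\<lambda>j. n - j"])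
    show "f (ln (sorted_sample ! (n - j) / thr)) = f (ln (rel_excess x n k j))" for j
      by (simp add: rel_excess_def order_stat_def sorted_sample_def)
  qed (use k in auto)
  also have "\<dots> = (\<Sum>m=n - k..<n. f (ln (sorted_sample ! m / thr)) * indicator {thr<..} (sorted_sample ! m))"
  proof (intro sum.cong refl)
    fix m assume "m \<in> {n - k..<n}"
    then have "thr \<le> sorted_sample ! m" by (intro sorted_sample_nth) auto
    then show "f (ln (sorted_sample ! m / thr)) = f (ln (sorted_sample ! m / thr)) * indicator {thr<..} (sorted_sample ! m)"
      using assms by (cases "thr = sorted_sample ! m") (auto simp: indicator_def)
  qed
  also have "\<dots> = (\<Sum>m<n. f (ln (sorted_sample ! m / thr)) * indicator {thr<..} (sorted_sample ! m))"
  proof -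
    have "(\<Sum>m<n - k. f (ln (sorted_sample ! m / thr)) * indicator {thr<..} (sorted_sample ! m)) = 0"
      using sorted_sample_nth(1) by (intro sum.neutral) (auto simp: indicator_def not_less)
    then show ?thesis
      using sum_split_sample[of "\<lambda>y. f (ln (y / thr)) * indicator {thr<..} y"] by simp
  qed
  also have "\<dots> = (\<Sum>i=1..n. f (ln (x i / thr)) * indicator {thr<..} (x i))"
    by (rule sum_sorted_sample[symmetric])
  finally show ?thesis .
qed

lemma rel_excess_pos:
  assumes "thr > 0" "j \<in> {1..k}"
  shows "rel_excess x n k j > 0"
proof -
  have "thr \<le> sorted_sample ! (n - j)" using assms(2) k by (intro sorted_sample_nth) auto
  moreover have "rel_excess x n k j = sorted_sample ! (n - j) / thr"
    by (simp add: rel_excess_def order_stat_def sorted_sample_def)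
  ultimately show ?thesis using assms(1) by simp
qed

lemma hill_eq: "hill x n k = (\<Sum>j=1..k. exp_primitive 0 (ln (rel_excess x n k j))) / real k"
  by (simp add: hill_def)

lemma E_stat_eq:
  assumes "thr > 0"
  shows "E_stat x n k s = 1 + s * ((\<Sum>j=1..k. exp_primitive s (ln (rel_excess x n k j))) / real k)"
proof -
  have "rel_excess x n k j powr s = 1 + s * exp_primitive s (ln (rel_excess x n k j))" if "j \<in> {1..k}" for j
    using rel_excess_pos[OF assms that] by (simp add: powr_def exp_primitive_def)
  then have "E_stat x n k s = (\<Sum>j=1..k. 1 + s * exp_primitive s (ln (rel_excess x n k j))) / real k"
    by (simp add: E_stat_def)
  also have "\<dots> = 1 + s * ((\<Sum>j=1..k. exp_primitive s (ln (rel_excess x n k j))) / real k)"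
    using k by (simp add: sum.distrib add_divide_distrib flip: sum_distrib_left)
  finally show ?thesis .
qed

text \<open>The observations between the two thresholds are \<open>\<bar>count - k\<bar>\<close> many, and each of them changes the
  sum by at most \<open>\<bar>exp_primitive s h\<bar>\<close>.\<close>
lemma threshold_shift:
  fixes s y :: real
  assumes thr: "thr > 0" and y: "y > 0"
  defines "h \<equiv> ln (thr / y)"
  defines "R \<equiv> (\<Sum>i=1..n. exp_primitive s (ln (x i / y)) * indicator {y<..} (x i))
    - exp (s * h) * (\<Sum>j=1..k. exp_primitive s (ln (rel_excess x n k j)))"
  shows "\<bar>R - real k * exp_primitive s h\<bar> \<le> \<bar>((\<Sum>i=1..n. indicator {y<..} (x i)) - real k) * exp_primitive s h\<bar>"
proof -
  \<comment> \<open>The contribution of a single observation z to R. It is c above both thresholds,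
    0 below both, and between 0 and c otherwise.\<close>
  define r where "r z = exp_primitive s (ln (z / y)) * indicator {y<..} z
      - exp (s * h) * (exp_primitive s (ln (z / thr)) * indicator {thr<..} z)" for z
  define c where "c = exp_primitive s h"
  have R: "R = (\<Sum>i=1..n. r (x i))"
    unfolding R_def r_def sum_rel_excess[of "exp_primitive s", OF exp_primitive_0(1) thr]
      sum_subtractf sum_distrib_left ..
  have shift: "exp (s * h) * exp_primitive s (ln (z / thr)) = exp_primitive s (ln (z / y)) - c" if "z > 0" for z
  proof -
    have "ln (z / thr) = ln (z / y) - h" using that thr y by (simp add: h_def ln_div)
    then show ?thesis using exp_primitive_diff by (simp add: c_def)
  qed
  have r1: "r z = c" if "z > y" "z > thr" for z
    using that shift[of z] thr by (simp add: r_def)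
  have r0: "r z = 0" if "z \<le> y" "z \<le> thr" for z
    using that by (simp add: r_def)
  show ?thesis
  proof (cases "thr \<ge> y")
    case True
    then have h: "h \<ge> 0" using y by (simp add: h_def)
    then have c: "c \<ge> 0" using exp_primitive_mono[of 0 h s] by (simp add: c_def)
    have mid: "0 \<le> r z \<and> r z \<le> c" if "y < z" "z \<le> thr" for z
    proof -
      have "0 \<le> ln (z / y)" "ln (z / y) \<le> h" using that y by (auto simp: h_def divide_right_mono)
      then show ?thesis
        using that exp_primitive_mono[of 0 "ln (z / y)" s] exp_primitive_mono[of "ln (z / y)" h s] by (simp add: r_def c_def)
    qed
    \<comment> \<open>With the threshold itself included, the lower bound runs over
      \<open>{thr..}\<close>, where the count is at least k; the strict count may fall short of k
      under ties.\<close>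
    have eqT: "r thr = c"
    proof (cases "thr = y")
      case True
      then show ?thesis using y by (simp add: r_def c_def h_def)
    next
      case False
      then show ?thesis using True by (simp add: r_def c_def h_def)
    qed
    have up: "r z \<le> c * indicator {y<..} z" for z
      using r1[of z] r0[of z] mid[of z] True by (cases "z \<le> y"; cases "z \<le> thr") auto
    have lo: "c * indicator {thr..} z \<le> r z" for z
      using r1[of z] r0[of z] mid[of z] True eqT by (cases "z = thr"; cases "z \<le> y"; cases "z < thr") auto
    have "R \<le> c * (\<Sum>i=1..n. indicator {y<..} (x i))"
      unfolding R sum_distrib_left by (intro sum_mono up)
    moreover have "c * (\<Sum>i=1..n. indicator {thr..} (x i)) \<le> R"
      unfolding R sum_distrib_left by (intro sum_mono lo)
    moreover have "c * real k \<le> c * (\<Sum>i=1..n. indicator {thr..} (x i))"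
      using count_exceed_threshold(2) c by (intro mult_left_mono) auto
    ultimately show ?thesis unfolding c_def[symmetric] by (simp add: algebra_simps abs_if)
  next
    case False
    then have h: "h \<le> 0" using y thr by (simp add: h_def ln_le_zero_iff)
    then have c: "c \<le> 0" using exp_primitive_mono[of h 0 s] by (simp add: c_def)
    have mid: "c \<le> r z \<and> r z \<le> 0" if "thr < z" "z \<le> y" for z
    proof -
      have "ln (z / y) \<le> 0" "h \<le> ln (z / y)" using that y thr by (auto simp: h_def divide_right_mono ln_le_zero_iff)
      then show ?thesis
        using that thr shift[of z] exp_primitive_mono[of "ln (z / y)" 0 s] exp_primitive_mono[of h "ln (z / y)" s] by (simp add: r_def c_def)
    qed
    have up: "r z \<le> c * indicator {y<..} z" for z
      using r1[of z] r0[of z] mid[of z] False by (cases "z \<le> y"; cases "z \<le> thr") auto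
    \<comment> \<open>Now c is nonpositive and the lower bound requires a count of at most k, hence
      strict exceedances.\<close>
    have lo: "c * indicator {thr<..} z \<le> r z" for z
      using r1[of z] r0[of z] mid[of z] False by (cases "z \<le> y"; cases "z \<le> thr") auto
    have "R \<le> c * (\<Sum>i=1..n. indicator {y<..} (x i))"
      unfolding R sum_distrib_left by (intro sum_mono up)
    moreover have "c * (\<Sum>i=1..n. indicator {thr<..} (x i)) \<le> R"
      unfolding R sum_distrib_left by (intro sum_mono lo)
    moreover have "c * real k \<le> c * (\<Sum>i=1..n. indicator {thr<..} (x i))"
      using count_exceed_threshold(1) c by (intro mult_left_mono_neg) auto
    ultimately show ?thesis unfolding c_def[symmetric] by (simp add: algebra_simps abs_if)
  qed
qed

end

context tail_sample
begin

definition excess_count :: "nat \<Rightarrow> 'a \<Rightarrow> real" where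
  "excess_count n \<omega> = (count n 0 \<omega> - real (k n)) / root_k n"

text \<open>The two events are nested, so the difference of indicators is an indicator up to sign,
  and its square is its modulus. The second moment therefore lacks the factor sqrt k that the mean
  carries.\<close>

lemma indicator_diff_moments:
  fixes x :: real
  defines "f \<equiv> \<lambda>n z. (indicator {t n * exp (x / root_k n)<..} z - indicator {t n * exp 0<..} z) / root_k n :: real"
  assumes n: "good n"
  shows "real n * (LINT z|N. f n z) = root_k n * (scaled_tail n (x / root_k n) - scaled_tail n 0)"
    and "real n * (LINT z|N. (f n z)\<^sup>2) = \<bar>scaled_tail n (x / root_k n) - scaled_tail n 0\<bar>"
proof -
  define s where "s = root_k n"
  have s: "s > 0" "real (k n) = s * s" using good_pos[OF n] by (simp_all add: s_def)
  define p where "p w = 1 - cdf N (t n * exp w)" for w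
  have int_ind: "(LINT z|N. indicat_real {t n * exp w<..} z) = p w" for w
    unfolding p_def by (rule integral_indicator_N)
  have mean: "(LINT z|N. indicat_real {t n * exp v<..} z - indicator {t n * exp w<..} z) = p v - p w" for v w
    by (subst Bochner_Integration.integral_diff) (simp_all only: int_ind integral_indicator_N(2))
  have tail: "scaled_tail n w = real n / (s * s) * p w" for w by (simp add: scaled_tail_def s p_def)
  show "real n * (LINT z|N. f n z) = root_k n * (scaled_tail n (x / root_k n) - scaled_tail n 0)"
    unfolding f_def s_def[symmetric] integral_divide_zero mean tail using s(1) by (simp add: field_simps)
  have t: "t n > 0" by (rule good_pos(3)[OF n])
  have "(LINT z|N. (f n z)\<^sup>2) = \<bar>p (x / s) - p 0\<bar> / (s * s)"
  proof (cases "x \<ge> 0")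
    case True
    then have le: "t n * exp 0 \<le> t n * exp (x / s)" using s t by (intro mult_left_mono) auto
    have "(f n z)\<^sup>2 = (indicator {t n * exp 0<..} z - indicator {t n * exp (x / s)<..} z) / (s * s)" for z
      using le by (auto simp: f_def s_def[symmetric] indicator_def power2_eq_square)
    then have "(LINT z|N. (f n z)\<^sup>2) = (p 0 - p (x / s)) / (s * s)"
      by (simp only: integral_divide_zero mean)
    moreover have "p 0 - p (x / s) \<ge> 0"
      unfolding mean[symmetric] using le by (intro Bochner_Integration.integral_nonneg) (auto simp: indicator_def)
    ultimately show ?thesis by simp
  next
    case False
    then have le: "t n * exp (x / s) \<le> t n * exp 0" using s t by (intro mult_left_mono) (auto simp: divide_nonpos_pos)
    have "(f n z)\<^sup>2 = (indicator {t n * exp (x / s)<..} z - indicator {t n * exp 0<..} z) / (s * s)" for z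
      using le by (auto simp: f_def s_def[symmetric] indicator_def power2_eq_square)
    then have "(LINT z|N. (f n z)\<^sup>2) = (p (x / s) - p 0) / (s * s)"
      by (simp only: integral_divide_zero mean)
    moreover have "p (x / s) - p 0 \<ge> 0"
      unfolding mean[symmetric] using le by (intro Bochner_Integration.integral_nonneg) (auto simp: indicator_def)
    ultimately show ?thesis by simp
  qed
  then show "real n * (LINT z|N. (f n z)\<^sup>2) = \<bar>scaled_tail n (x / root_k n) - scaled_tail n 0\<bar>"
    unfolding s_def[symmetric] tail right_diff_distrib[symmetric] abs_mult by simp
qed

text \<open>Across a window of width 1 / sqrt k the normalised count changes by an asymptotically
  deterministic amount: its mean has slope \<open>- 1 / \<xi>\<close>, while its variance is of
  order 1 / sqrt k.\<close>

lemma count_local: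
  "((\<lambda>p. (count (fst p) (x / root_k (fst p)) (snd p) - count (fst p) 0 (snd p)) / root_k (fst p) + x / \<xi>) \<longlongrightarrow> 0) (in_prob M)"
proof -
  interpret N': real_distribution N by (rule N)
  define f where "f n z = (indicator {t n * exp (x / root_k n)<..} z - indicator {t n * exp 0<..} z) / root_k n" for n and z :: real
  have f_meas: "f n \<in> borel_measurable borel" for n unfolding f_def by measurable
  have f_bound: "\<bar>f n z\<bar> \<le> 1 / root_k n" for n z
    by (auto simp: f_def indicator_def abs_divide)
  have f_int: "integrable N (\<lambda>z. (f n z)\<^sup>2)" for n
  proof (rule N'.integrable_const_bound[of _ "(1 / root_k n)\<^sup>2"])
    show "AE z in N. norm ((f n z)\<^sup>2) \<le> (1 / root_k n)\<^sup>2"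
      using f_bound[of n] by (auto intro!: always_eventually power_mono simp flip: abs_le_square_iff)
  qed (use measurable_N[OF f_meas[of n]] in measurable)
  have diff: "(\<lambda>n. root_k n * (scaled_tail n (x / root_k n) - scaled_tail n 0)) \<longlonglongrightarrow> - (x / \<xi>)"
    using tendsto_diff[OF scaled_tail_local[of x] scaled_tail_local[of 0]] by (simp add: algebra_simps diff_divide_distrib)
  have mean: "(\<lambda>n. real n * (LINT z|N. f n z)) \<longlonglongrightarrow> - (x / \<xi>)"
    by (rule Lim_transform_eventually[OF diff])
       (use eventually_good in eventually_elim, simp only: f_def indicator_diff_moments(1))
  have var: "(\<lambda>n. real n * (LINT z|N. (f n z)\<^sup>2)) \<longlonglongrightarrow> \<bar>0\<bar>"
    by (rule Lim_transform_eventually[OF tendsto_rabs[OF tendsto_0_of_scaled[OF diff sqrt_k]]])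
       (use eventually_good in eventually_elim, simp only: f_def indicator_diff_moments(2))
  have "((\<lambda>p. (\<Sum>i=1..fst p. f (fst p) (X i (snd p))) - - (x / \<xi>)) \<longlongrightarrow> 0) (in_prob M)"
    using var by (intro sum_tendsto_0_in_prob[OF f_meas f_int _ LIM_zero[OF mean]]) simp
  moreover have "(\<Sum>i=1..n. f n (X i \<omega>)) = (count n (x / root_k n) \<omega> - count n 0 \<omega>) / root_k n" for n \<omega>
    unfolding f_def count_def sum_divide_distrib[symmetric] sum_subtractf ..
  ultimately show ?thesis by simp
qed

text \<open>Second moments make the square tight, and
  \<open>2 * \<bar>y\<bar> \<le> 1 + y\<^sup>2\<close> passes from the square to the variable; the
  square fills both slots of \<open>tight_combine\<close>.\<close>

lemma tight_excess_count: "tight_in_prob M (\<lambda>p. excess_count (fst p) (snd p))"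
proof (rule tight_combine)
  interpret N': real_distribution N by (rule N)
  have count_meas [measurable]: "count n 0 \<in> borel_measurable M" for n
    using measurable_sum_X[of "indicator {t n * exp 0<..}" n] by (simp add: count_def[abs_def])
  have second: "integrable M (\<lambda>\<omega>. (excess_count n \<omega>)\<^sup>2)"
    "expectation (\<lambda>\<omega>. (excess_count n \<omega>)\<^sup>2) \<le> (1 + tail_const) + tail_const\<^sup>2" if n: "good n" for n
  proof -
    define s where "s = root_k n"
    have s: "s > 0" "real (k n) = s * s" using good_pos[OF n] by (simp_all add: s_def)
    define f where "f z = indicator {t n * exp 0<..} z / s" for z :: real
    have f: "f \<in> borel_measurable borel" unfolding f_def by measurable
    have f_sq: "(f z)\<^sup>2 = indicator {t n * exp 0<..} z / (s * s)" for z
      by (simp add: f_def power_divide power2_eq_square indicator_def)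
    have f_int: "integrable N (\<lambda>z. (f z)\<^sup>2)" unfolding f_sq using integral_indicator_N(2) by simp
    have eq: "excess_count n \<omega> = (\<Sum>i=1..n. f (X i \<omega>)) - s" for \<omega>
      using s(1) by (simp only: excess_count_def count_def f_def s_def[symmetric] s(2) sum_divide_distrib[symmetric] diff_divide_distrib) simp
    show "integrable M (\<lambda>\<omega>. (excess_count n \<omega>)\<^sup>2)"
      unfolding eq by (rule second_moment_sum(1)[OF f f_int])
    have tail: "scaled_tail n 0 = real n / (s * s) * (1 - cdf N (t n * exp 0))" by (simp only: scaled_tail_def s)
    have "real n * (LINT z|N. (f z)\<^sup>2) = scaled_tail n 0"
      unfolding f_sq integral_divide_zero integral_indicator_N(1) tail by simp
    moreover have "real n * (LINT z|N. f z) - s = s * (scaled_tail n 0 - exp (- (0 / \<xi>)))"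
      unfolding f_def integral_divide_zero integral_indicator_N(1) tail using s(1) by (simp add: field_simps)
    moreover have "(s * (scaled_tail n 0 - exp (- (0 / \<xi>))))\<^sup>2 \<le> tail_const\<^sup>2"
      using good_dev[OF n, of 0] tail_const by (intro abs_le_square_iff[THEN iffD1]) (simp add: s_def)
    ultimately show "expectation (\<lambda>\<omega>. (excess_count n \<omega>)\<^sup>2) \<le> (1 + tail_const) + tail_const\<^sup>2"
      unfolding eq using second_moment_sum(2)[OF f f_int, of n s] good_bound(2)[OF n, of 0] by simp
  qed
  show sq: "tight_in_prob M (\<lambda>p. (excess_count (fst p) (snd p))\<^sup>2)"
  proof (rule tight_in_probI_nn_integral[where K = "ennreal ((1 + tail_const) + tail_const\<^sup>2)"])
    show "\<forall>\<^sub>F n in sequentially. (\<integral>\<^sup>+\<omega>. ennreal ((excess_count n \<omega>)\<^sup>2) \<partial>M) \<le> ennreal ((1 + tail_const) + tail_const\<^sup>2)"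
      using eventually_good
    proof eventually_elim
      case (elim n)
      have "(\<integral>\<^sup>+\<omega>. ennreal ((excess_count n \<omega>)\<^sup>2) \<partial>M) = ennreal (expectation (\<lambda>\<omega>. (excess_count n \<omega>)\<^sup>2))"
        using second(1)[OF elim] by (intro nn_integral_eq_integral) auto
      then show ?case using second(2)[OF elim] by (simp add: ennreal_leI)
    qed
  qed (auto simp: excess_count_def)
  show "tight_in_prob M (\<lambda>p. (excess_count (fst p) (snd p))\<^sup>2)" by (rule sq)
  show "\<exists>K. \<forall>p. \<bar>(excess_count (fst p) (snd p))\<^sup>2\<bar> \<le> a \<longrightarrow> \<bar>(excess_count (fst p) (snd p))\<^sup>2\<bar> \<le> b \<longrightarrow> \<bar>excess_count (fst p) (snd p)\<bar> \<le> K" for a b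
  proof (intro exI[of _ "1 + a"] allI impI)
    fix p :: "nat \<times> 'a" assume "\<bar>(excess_count (fst p) (snd p))\<^sup>2\<bar> \<le> a"
    moreover have "2 * \<bar>y\<bar> \<le> 1 + y\<^sup>2" for y :: real
      using zero_le_power2[of "1 - \<bar>y\<bar>"] by (simp add: power2_diff)
    from this[of "excess_count (fst p) (snd p)"] have "\<bar>excess_count (fst p) (snd p)\<bar> \<le> 1 + (excess_count (fst p) (snd p))\<^sup>2"
      by (smt (verit) abs_ge_zero)
    ultimately show "\<bar>excess_count (fst p) (snd p)\<bar> \<le> 1 + a" by simp
  qed
qed

end

subsection \<open>Replacing the random threshold\<close>

context prob_space
begin

text \<open>A random coefficient and a negligible error are replaced together; tightness of Y
  absorbs the error of the coefficient.\<close>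

lemma tight_null_approx:
  assumes Y: "tight_in_prob M Y" and YZ: "((\<lambda>p. Z p - Y p) \<longlongrightarrow> 0) (in_prob M)"
    and c: "(c \<longlongrightarrow> c0) (in_prob M)"
  shows "((\<lambda>p. c p * Z p - c0 * Y p) \<longlongrightarrow> 0) (in_prob M)"
proof -
  have "((\<lambda>p. Y p * (c p - c0)) \<longlongrightarrow> 0) (in_prob M)"
    by (rule tight_mult_null[OF Y LIM_zero[OF c]])
  from tendsto_add[OF tendsto_mult[OF c YZ] this] show ?thesis
    by (simp add: algebra_simps)
qed

lemma tight_null_diff:
  assumes Y: "tight_in_prob M Y" and YZ: "((\<lambda>p. Z p - Y p) \<longlongrightarrow> 0) (in_prob M)"
  shows "tight_in_prob M Z"
  using tight_add[OF Y tight_of_tendsto[OF YZ]] by simp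

end

context tail_sample
begin

definition top_threshold :: "nat \<Rightarrow> 'a \<Rightarrow> real" where
  "top_threshold n \<omega> = order_stat (\<lambda>i. X i \<omega>) n (n - k n)"

definition top_mean :: "real \<Rightarrow> nat \<Rightarrow> 'a \<Rightarrow> real" where
  "top_mean s n \<omega> = (\<Sum>j=1..k n. exp_primitive s (ln (rel_excess (\<lambda>i. X i \<omega>) n (k n) j))) / real (k n)"

lemma top_threshold_le_iff:
  "good n \<Longrightarrow> top_threshold n \<omega> \<le> t n * exp w \<longleftrightarrow> count n w \<omega> \<le> real (k n)"
  unfolding top_threshold_def count_def by (rule threshold_le_iff) (simp_all add: good_def)

text \<open>The rescaled log threshold is caught between two points of a grid of mesh e. Tightness
  makes the relevant part of the grid finite, so \<open>count_local\<close> holds at all its points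
  at once, and the sign of count minus k at a point tells on which side of it the threshold
  lies.\<close>

lemma top_threshold_near:
  assumes e: "e > 0"
  shows "\<forall>\<^sub>F p in in_prob M. top_threshold (fst p) (snd p) > 0 \<and>
    \<bar>root_k (fst p) * ln (top_threshold (fst p) (snd p) / t (fst p)) - \<xi> * excess_count (fst p) (snd p)\<bar> \<le> 2 * e"
proof (rule tight_eventually[OF tight_excess_count])
  fix K :: real
  \<comment> \<open>In units of e, the centre of the search is within
    \<open>\<xi> * \<bar>K\<bar> / e\<close> of 0; the grid points used lie at most 2 further
    out.\<close>
  define m where "m = \<lceil>\<xi> * \<bar>K\<bar> / e\<rceil> + 3"
  have "\<forall>\<^sub>F p in in_prob M. \<forall>j\<in>{- m..m}. \<bar>(count (fst p) (real_of_int j * e / root_k (fst p)) (snd p) - count (fst p) 0 (snd p)) / root_k (fst p)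
      + real_of_int j * e / \<xi>\<bar> < e / \<xi>"
  proof (rule eventually_ball_finite)
    show "\<forall>j\<in>{- m..m}. \<forall>\<^sub>F p in in_prob M. \<bar>(count (fst p) (real_of_int j * e / root_k (fst p)) (snd p) - count (fst p) 0 (snd p)) / root_k (fst p)
      + real_of_int j * e / \<xi>\<bar> < e / \<xi>"
      using tendstoD[OF count_local, of "e / \<xi>"] e \<xi> by (auto simp: dist_real_def)
  qed simp
  then show "\<forall>\<^sub>F p in in_prob M. \<bar>excess_count (fst p) (snd p)\<bar> \<le> K \<longrightarrow> top_threshold (fst p) (snd p) > 0 \<and>
    \<bar>root_k (fst p) * ln (top_threshold (fst p) (snd p) / t (fst p)) - \<xi> * excess_count (fst p) (snd p)\<bar> \<le> 2 * e"
    using eventually_fst_in_prob[OF eventually_good]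
  proof eventually_elim
    case (elim p)
    obtain n \<omega> where p: "p = (n, \<omega>)" by (cases p)
    define r where "r = root_k n"
    have n: "good n" using elim p by simp
    have r: "r > 0" "real (k n) = r * r" using good_pos[OF n] by (simp_all add: r_def)
    have t: "t n > 0" by (rule good_pos(3)[OF n])
    show ?case
    proof
      assume "\<bar>excess_count (fst p) (snd p)\<bar> \<le> K"
      then have K: "\<bar>excess_count n \<omega>\<bar> \<le> K" by (simp add: p)
      define a where "a = \<xi> * excess_count n \<omega>"
      have "\<bar>a\<bar> \<le> \<xi> * \<bar>K\<bar>"
        using K \<xi> unfolding a_def abs_mult by (intro mult_mono) auto
      then have "\<bar>a / e\<bar> \<le> \<xi> * \<bar>K\<bar> / e" using e by (simp add: abs_divide divide_right_mono)
      then have a_bound: "\<bar>a / e\<bar> \<le> real_of_int m - 3" unfolding m_def using le_of_int_ceiling[of "\<xi> * \<bar>K\<bar> / e"] by linarith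
      have key: "count n (real_of_int j * e / r) \<omega> - real (k n) = r / \<xi> * (\<xi> * y + a - real_of_int j * e) \<and> \<bar>\<xi> * y\<bar> < e"
        if "j \<in> {- m..m}" "y = (count n (real_of_int j * e / r) \<omega> - count n 0 \<omega>) / r + real_of_int j * e / \<xi>" for j y
      proof
        have "\<bar>y\<bar> < e / \<xi>" using elim that by (simp add: p r_def)
        then show "\<bar>\<xi> * y\<bar> < e" using \<xi> by (simp add: abs_mult field_simps)
        show "count n (real_of_int j * e / r) \<omega> - real (k n) = r / \<xi> * (\<xi> * y + a - real_of_int j * e)"
          unfolding that(2) a_def excess_count_def r_def[symmetric] r(2) using r(1) \<xi> by (simp add: field_simps)
      qed
      \<comment> \<open>Grid points at distance more than e and at most 2 e on either side of a. The
        counts are known up to an error below e on this scale, so the sign of count minus k is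
        certain there.\<close>
      define j1 where "j1 = \<lfloor>a / e\<rfloor> + 2"
      define j0 where "j0 = \<lceil>a / e\<rceil> - 2"
      have j1_bounds: "a / e + 1 < real_of_int j1" "real_of_int j1 \<le> a / e + 2"
        and j0_bounds: "real_of_int j0 < a / e - 1" "a / e - 2 \<le> real_of_int j0"
        unfolding j1_def j0_def by linarith+
      have j1_e: "a + e < real_of_int j1 * e" "real_of_int j1 * e \<le> a + 2 * e"
        and j0_e: "real_of_int j0 * e < a - e" "a - 2 * e \<le> real_of_int j0 * e"
        using mult_strict_right_mono[OF j1_bounds(1) e] mult_right_mono[OF j1_bounds(2), of e]
          mult_strict_right_mono[OF j0_bounds(1) e] mult_right_mono[OF j0_bounds(2), of e] e
        by (simp_all add: distrib_right left_diff_distrib)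
      have "real_of_int j1 \<le> real_of_int m" "real_of_int (- m) \<le> real_of_int j1"
        "real_of_int j0 \<le> real_of_int m" "real_of_int (- m) \<le> real_of_int j0"
        using a_bound[unfolded abs_le_iff] j1_bounds j0_bounds unfolding of_int_minus by linarith+
      then have j_in: "j1 \<in> {- m..m}" "j0 \<in> {- m..m}" by (simp_all only: of_int_le_iff atLeastAtMost_iff)
      have "count n (real_of_int j1 * e / r) \<omega> - real (k n) \<le> 0"
      proof -
        obtain y where y: "count n (real_of_int j1 * e / r) \<omega> - real (k n) = r / \<xi> * (\<xi> * y + a - real_of_int j1 * e)" "\<bar>\<xi> * y\<bar> < e"
          using key[OF j_in(1) refl] by blast
        have "\<xi> * y + a - real_of_int j1 * e \<le> 0" using y(2) j1_e by (simp add: abs_less_iff)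
        then show ?thesis unfolding y(1) using r \<xi> by (intro mult_nonneg_nonpos) auto
      qed
      then have up: "top_threshold n \<omega> \<le> t n * exp (real_of_int j1 * e / r)"
        by (simp add: top_threshold_le_iff[OF n])
      have "count n (real_of_int j0 * e / r) \<omega> - real (k n) > 0"
      proof -
        obtain y where y: "count n (real_of_int j0 * e / r) \<omega> - real (k n) = r / \<xi> * (\<xi> * y + a - real_of_int j0 * e)" "\<bar>\<xi> * y\<bar> < e"
          using key[OF j_in(2) refl] by blast
        have "\<xi> * y + a - real_of_int j0 * e > 0" using y(2) j0_e by (simp add: abs_less_iff)
        then show ?thesis unfolding y(1) using r \<xi> by (intro mult_pos_pos) auto
      qed
      then have lo: "t n * exp (real_of_int j0 * e / r) < top_threshold n \<omega>"
        using top_threshold_le_iff[OF n, of \<omega> "real_of_int j0 * e / r"] by simp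
      have pos: "top_threshold n \<omega> > 0"
        using lo t by (rule_tac less_trans[OF _ lo]) simp
      have "ln (top_threshold n \<omega> / t n) \<le> real_of_int j1 * e / r"
        using up t pos ln_le_cancel_iff[of "top_threshold n \<omega> / t n" "exp (real_of_int j1 * e / r)"]
        by (simp add: divide_le_eq mult.commute)
      moreover have "real_of_int j0 * e / r \<le> ln (top_threshold n \<omega> / t n)"
        using lo t pos by (subst ln_ge_iff) (simp_all add: le_divide_eq mult.commute)
      ultimately have "r * ln (top_threshold n \<omega> / t n) \<le> real_of_int j1 * e" "real_of_int j0 * e \<le> r * ln (top_threshold n \<omega> / t n)"
        using r by (simp_all add: field_simps)
      then have "\<bar>r * ln (top_threshold n \<omega> / t n) - a\<bar> \<le> 2 * e"
        using j1_e j0_e by (simp add: abs_le_iff)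
      with pos show "top_threshold (fst p) (snd p) > 0 \<and>
        \<bar>root_k (fst p) * ln (top_threshold (fst p) (snd p) / t (fst p)) - \<xi> * excess_count (fst p) (snd p)\<bar> \<le> 2 * e"
        by (simp add: p a_def r_def)
    qed
  qed
qed

lemma top_threshold_pos: "\<forall>\<^sub>F p in in_prob M. top_threshold (fst p) (snd p) > 0"
  using top_threshold_near[of 1] by (auto elim: eventually_mono)

lemma top_threshold_expansion:
  "((\<lambda>p. root_k (fst p) * ln (top_threshold (fst p) (snd p) / t (fst p)) - \<xi> * excess_count (fst p) (snd p)) \<longlongrightarrow> 0) (in_prob M)"
proof (rule tendstoI)
  fix e :: real assume e: "e > 0"
  then have "e / 4 > 0" by simp
  from top_threshold_near[OF this]
  show "\<forall>\<^sub>F p in in_prob M. dist (root_k (fst p) * ln (top_threshold (fst p) (snd p) / t (fst p)) - \<xi> * excess_count (fst p) (snd p)) 0 < e"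
    by eventually_elim (use e in \<open>auto simp: dist_real_def\<close>)
qed

lemma tight_exceedance_exp:
  assumes s: "\<forall>\<^sub>F p in in_prob M. s p \<le> 0"
  shows "tight_in_prob M (\<lambda>p. exceedance_exp (s p) (fst p) (snd p))"
proof -
  define Y where "Y p = (if good (fst p) \<and> s p \<le> 0 then exceedance_exp (s p) (fst p) (snd p) else 0)" for p
  have "tight_in_prob M Y"
    by (rule tight_mono[OF tight_process_norm])
       (auto simp: Y_def intro: order_trans[OF exceedance_exp_bound])
  moreover have "((\<lambda>p. exceedance_exp (s p) (fst p) (snd p) - Y p) \<longlongrightarrow> 0) (in_prob M)"
  proof (rule Lim_transform_eventually[OF tendsto_const])
    show "\<forall>\<^sub>F p in in_prob M. 0 = exceedance_exp (s p) (fst p) (snd p) - Y p"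
      using s eventually_fst_in_prob[OF eventually_good] by eventually_elim (simp add: Y_def)
  qed
  ultimately show ?thesis by (rule tight_null_diff)
qed

text \<open>Exact algebra, with E the error from \<open>threshold_shift\<close> divided by
  \<open>root_k n\<close>. The right-hand side is arranged as tight factors with coefficients that
  will vanish, plus the already negligible difference
  \<open>root_k n * h - \<xi> * excess_count n \<omega>\<close> and a multiple of E.\<close>

lemma top_mean_identity:
  fixes s :: real
  assumes n: "good n" and thr: "top_threshold n \<omega> > 0" and s: "s \<le> 0"
  defines "h \<equiv> ln (top_threshold n \<omega> / t n)" and "c \<equiv> \<xi> / (1 - \<xi> * s)"
    and "g1 \<equiv> expm1_quot (s * ln (top_threshold n \<omega> / t n))" and "g2 \<equiv> expm1_quot (- s * ln (top_threshold n \<omega> / t n))"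
  shows "\<exists>E. \<bar>E\<bar> \<le> \<bar>excess_count n \<omega> * (h * g1)\<bar> \<and>
    root_k n * (top_mean s n \<omega> - c) - exceedance_exp s n \<omega>
    = exceedance_exp s n \<omega> * (- s * h * g2)
      + excess_count n \<omega> * (exp (- s * h) * c - \<xi> * exp (- s * h) * g1 - c * s * \<xi> * g2)
      + (root_k n * h - \<xi> * excess_count n \<omega>) * (- c * s * g2 - exp (- s * h) * g1) - exp (- s * h) * E"
proof -
  define r where "r = root_k n"
  have r: "r > 0" "real (k n) = r * r" using good_pos[OF n] by (simp_all add: r_def)
  have kn: "0 < k n" "k n < n" using n by (simp_all add: good_def)
  define S where "S = (\<Sum>i=1..n. exp_primitive s (ln (X i \<omega> / t n)) * indicator {t n<..} (X i \<omega>))"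
  define N0 where "N0 = (\<Sum>i=1..n. indicat_real {t n<..} (X i \<omega>))"
  define J where "J = top_mean s n \<omega>"
  define A where "A = exceedance_exp s n \<omega>"
  define P where "P = excess_count n \<omega>"
  define E where "E = (S - exp (s * h) * (r * r * J) - r * r * exp_primitive s h) / r"
  have N0: "N0 = r * r + r * P"
    using r by (simp add: P_def excess_count_def count_def N0_def r_def[symmetric] field_simps)
  have "A = (S - N0 * c) / r"
    unfolding A_def exceedance_exp_def exceedance_sum_def S_def N0_def r_def c_def sum_distrib_right sum_subtractf[symmetric]
    by (intro arg_cong2[where f = "(/)"] sum.cong refl) (simp add: algebra_simps)
  then have S: "S = r * A + (r * r + r * P) * c" using r N0 by (simp add: field_simps)
  have "(\<Sum>j=1..k n. exp_primitive s (ln (rel_excess (\<lambda>i. X i \<omega>) n (k n) j))) = r * r * J"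
    using r by (simp add: J_def top_mean_def)
  then have "\<bar>S - exp (s * h) * (r * r * J) - r * r * exp_primitive s h\<bar> \<le> \<bar>(N0 - r * r) * exp_primitive s h\<bar>"
    using threshold_shift[OF kn, of "\<lambda>i. X i \<omega>" "t n" s] thr good_pos(3)[OF n]
    unfolding S_def N0_def h_def top_threshold_def r(2) by simp
  then have "\<bar>E\<bar> \<le> \<bar>r * P * exp_primitive s h\<bar> / r"
    unfolding E_def N0 using r by (simp add: abs_divide divide_right_mono)
  also have "\<dots> = \<bar>P * exp_primitive s h\<bar>" using r by (simp add: abs_mult)
  finally have E_bound: "\<bar>E\<bar> \<le> \<bar>P * (h * g1)\<bar>" unfolding expm1_quot(1) g1_def h_def .
  have ex: "exp (- s * h) * exp (s * h) = 1" by (simp flip: exp_add)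
  have "exp (s * h) * (r * J) = A + r * c + P * c - E - r * (h * g1)"
    using r unfolding E_def S expm1_quot(1)[of s h] g1_def h_def[symmetric] by (simp add: field_simps)
  then have "r * J = exp (- s * h) * (A + r * c + P * c - E - r * (h * g1))"
    using ex by (metis mult.assoc mult_1)
  then have rJ: "r * J - r * c - A = exp (- s * h) * (A + r * c + P * c - E - r * (h * g1)) - r * c - A"
    by simp
  have e: "exp (- s * h) = 1 - s * h * g2"
    using expm1_quot(2)[of "- s * h"] by (simp add: g2_def h_def)
  have "r * (J - c) - A = A * (- s * h * g2)
      + P * (exp (- s * h) * c - \<xi> * exp (- s * h) * g1 - c * s * \<xi> * g2)
      + (r * h - \<xi> * P) * (- c * s * g2 - exp (- s * h) * g1) - exp (- s * h) * E"
    unfolding right_diff_distrib[of r J c] rJ unfolding e by (simp add: algebra_simps)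
  with E_bound show ?thesis unfolding J_def A_def P_def r_def by blast
qed

text \<open>The random threshold leaves no trace at first order. The coefficient of the excess count
  tends to \<open>c0 - \<xi> - c0 * s0 * \<xi>\<close>, which is 0 since
  \<open>c0 * (1 - \<xi> * s0) = \<xi>\<close>. This is the lack of memory: the log excess over a
  different level has the same exponential law.\<close>

lemma top_mean_expansion:
  assumes s: "(s \<longlongrightarrow> s0) (in_prob M)" and s_neg: "\<forall>\<^sub>F p in in_prob M. s p \<le> 0" and s0: "s0 \<le> 0"
  shows "((\<lambda>p. root_k (fst p) * (top_mean (s p) (fst p) (snd p) - \<xi> / (1 - \<xi> * s p)) - exceedance_exp (s p) (fst p) (snd p)) \<longlongrightarrow> 0) (in_prob M)"
proof -
  let ?G = "in_prob M"
  define h where "h p = ln (top_threshold (fst p) (snd p) / t (fst p))" for p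
  define P where "P p = excess_count (fst p) (snd p)" for p
  define A where "A p = exceedance_exp (s p) (fst p) (snd p)" for p
  define c where "c p = \<xi> / (1 - \<xi> * s p)" for p
  define Q where "Q p = root_k (fst p) * h p" for p
  define c0 where "c0 = \<xi> / (1 - \<xi> * s0)"
  have den: "1 - \<xi> * s0 > 0" using \<xi> s0 by (smt (verit) mult_nonneg_nonpos)
  have P: "tight_in_prob M P" unfolding P_def by (rule tight_excess_count)
  have A: "tight_in_prob M A" unfolding A_def by (rule tight_exceedance_exp[OF s_neg])
  have QP: "((\<lambda>p. Q p - \<xi> * P p) \<longlongrightarrow> 0) ?G"
    using top_threshold_expansion by (simp add: Q_def P_def h_def)
  have Q: "tight_in_prob M Q"
    using tight_null_diff[OF tight_mult[OF tight_of_tendsto[OF tendsto_const[of \<xi>]] P] QP] .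
  have "((\<lambda>p. inverse (root_k (fst p))) \<longlongrightarrow> 0) ?G"
    by (intro tendsto_fst_in_prob tendsto_inverse_0_at_top sqrt_k)
  from tight_mult_null[OF Q this] have "((\<lambda>p. Q p * inverse (root_k (fst p))) \<longlongrightarrow> 0) ?G" .
  then have h: "(h \<longlongrightarrow> 0) ?G"
  proof (rule Lim_transform_eventually)
    show "\<forall>\<^sub>F p in ?G. Q p * inverse (root_k (fst p)) = h p"
      using eventually_fst_in_prob[OF k_pos] by eventually_elim (simp add: Q_def)
  qed
  have c: "(c \<longlongrightarrow> c0) ?G" unfolding c_def c0_def using den by (intro tendsto_intros s) auto
  have quot1: "((\<lambda>p. expm1_quot (y p)) \<longlongrightarrow> 1) ?G" if "(y \<longlongrightarrow> 0) ?G" for y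
    using isCont_tendsto_compose[OF isCont_expm1_quot that] by (simp add: expm1_quot_def exp_primitive_def)
  define g1 where "g1 p = expm1_quot (s p * h p)" for p
  define g2 where "g2 p = expm1_quot (- s p * h p)" for p
  have g1: "(g1 \<longlongrightarrow> 1) ?G" and g2: "(g2 \<longlongrightarrow> 1) ?G"
    unfolding g1_def g2_def by (intro quot1; use tendsto_mult[OF s h] tendsto_minus[OF tendsto_mult[OF s h]] in simp)+
  define e where "e p = exp (- s p * h p)" for p
  have e: "(e \<longlongrightarrow> 1) ?G"
    using tendsto_exp[OF tendsto_minus[OF tendsto_mult[OF s h]]] by (simp add: e_def[abs_def])
  define D where "D p = root_k (fst p) * (top_mean (s p) (fst p) (snd p) - c p) - A p" for p
  define M1 where "M1 p = A p * (- s p * h p * g2 p) + P p * (e p * c p - \<xi> * e p * g1 p - c p * s p * \<xi> * g2 p)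
     + (Q p - \<xi> * P p) * (- c p * s p * g2 p - e p * g1 p)" for p
  define M2 where "M2 p = e p * (P p * (h p * g1 p))" for p
  have M1: "(M1 \<longlongrightarrow> 0) ?G"
  proof -
    have "((\<lambda>p. - s p * h p * g2 p) \<longlongrightarrow> - s0 * 0 * 1) ?G" by (intro tendsto_intros s h g2)
    then have a: "((\<lambda>p. A p * (- s p * h p * g2 p)) \<longlongrightarrow> 0) ?G" by (intro tight_mult_null[OF A]) simp
    have "((\<lambda>p. e p * c p - \<xi> * e p * g1 p - c p * s p * \<xi> * g2 p) \<longlongrightarrow> 1 * c0 - \<xi> * 1 * 1 - c0 * s0 * \<xi> * 1) ?G"
      by (intro tendsto_intros e c g1 s g2)
    also have "1 * c0 - \<xi> * 1 * 1 - c0 * s0 * \<xi> * 1 = 0" using den by (simp add: c0_def field_simps)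
    finally have b: "((\<lambda>p. P p * (e p * c p - \<xi> * e p * g1 p - c p * s p * \<xi> * g2 p)) \<longlongrightarrow> 0) ?G"
      by (rule tight_mult_null[OF P])
    have "((\<lambda>p. (Q p - \<xi> * P p) * (- c p * s p * g2 p - e p * g1 p)) \<longlongrightarrow> 0 * (- c0 * s0 * 1 - 1 * 1)) ?G"
      by (intro tendsto_intros QP c s g2 e g1)
    from tendsto_add[OF tendsto_add[OF a b] this] show ?thesis by (simp add: M1_def[abs_def])
  qed
  have M2: "(M2 \<longlongrightarrow> 0) ?G"
  proof -
    have "((\<lambda>p. h p * g1 p) \<longlongrightarrow> 0 * 1) ?G" by (intro tendsto_intros h g1)
    then have "((\<lambda>p. P p * (h p * g1 p)) \<longlongrightarrow> 0) ?G" by (intro tight_mult_null[OF P]) simp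
    from tendsto_mult[OF e this] show ?thesis by (simp add: M2_def[abs_def])
  qed
  have "((\<lambda>p. D p - M1 p) \<longlongrightarrow> 0) ?G"
  proof (rule Lim_null_comparison)
    show "((\<lambda>p. \<bar>M2 p\<bar>) \<longlongrightarrow> 0) ?G" using tendsto_rabs[OF M2] by simp
    show "\<forall>\<^sub>F p in ?G. norm (D p - M1 p) \<le> \<bar>M2 p\<bar>"
      using eventually_fst_in_prob[OF eventually_good] top_threshold_pos s_neg
    proof eventually_elim
      case (elim p)
      from top_mean_identity[OF elim] obtain E where E: "\<bar>E\<bar> \<le> \<bar>P p * (h p * g1 p)\<bar>" "D p = M1 p - e p * E"
        unfolding D_def M1_def P_def h_def g1_def g2_def A_def c_def Q_def e_def by blast
      have "\<bar>D p - M1 p\<bar> = e p * \<bar>E\<bar>" using E(2) by (simp add: abs_mult e_def)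
      also have "\<dots> \<le> e p * \<bar>P p * (h p * g1 p)\<bar>" using E(1) by (intro mult_left_mono) (simp_all add: e_def)
      also have "\<dots> = \<bar>M2 p\<bar>" by (simp add: M2_def abs_mult e_def)
      finally show ?case by simp
    qed
  qed
  from tendsto_add[OF this M1] show ?thesis by (simp add: D_def A_def c_def)
qed

end

subsection \<open>The estimator\<close>

definition D_slope :: "real \<Rightarrow> (nat \<Rightarrow> real) \<Rightarrow> nat \<Rightarrow> nat \<Rightarrow> real \<Rightarrow> real" where
  "D_slope s2 x n k \<tau> = 1 / (real k * s2) - 2 * \<tau> * E_stat x n k \<tau> + (2 * \<tau> + \<tau>\<^sup>2) * E_stat x n k (2 * \<tau>)"

definition d_numerator :: "(nat \<Rightarrow> real) \<Rightarrow> nat \<Rightarrow> nat \<Rightarrow> real \<Rightarrow> real" where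
  "d_numerator x n k \<tau> = (1 - hill x n k * \<tau>) * (E_stat x n k \<tau> - 1 / (1 - hill x n k * \<tau>))"

lemma D_B_affine: "D_B s2 x n k \<tau> z = D_B s2 x n k \<tau> z0 + D_slope s2 x n k \<tau> * (z - z0)"
  by (simp add: D_B_def D_slope_def algebra_simps diff_divide_distrib)

text \<open>The smaller root of the quadratic equation \<open>B c d\<^sup>2 + D d = N\<close>, where \<open>D\<close> is the value of
  \<open>D_B\<close> at the Hill estimator.\<close>
lemma EPD_small_solution:
  fixes s2 \<tau> :: real
  assumes D: "D_B s2 x n k \<tau> (hill x n k) > 0"
    and small: "8 * \<bar>D_slope s2 x n k \<tau> * (1 - E_stat x n k \<tau>) * d_numerator x n k \<tau>\<bar> \<le> (D_B s2 x n k \<tau> (hill x n k))\<^sup>2"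
  shows "\<exists>z d. EPD_system s2 x n k \<tau> z d \<and> \<bar>d\<bar> \<le> 2 * \<bar>d_numerator x n k \<tau>\<bar> / D_B s2 x n k \<tau> (hill x n k)"
proof -
  define N where "N = d_numerator x n k \<tau>"
  define D0 where "D0 = D_B s2 x n k \<tau> (hill x n k)"
  define m where "m = D_slope s2 x n k \<tau> * (1 - E_stat x n k \<tau>)"
  define S where "S = sqrt (D0\<^sup>2 + 4 * m * N)"
  have D0: "D0 > 0" using D by (simp add: D0_def)
  have "8 * \<bar>m * N\<bar> \<le> D0\<^sup>2" using small by (simp add: m_def N_def D0_def)
  then have disc: "D0\<^sup>2 + 4 * m * N \<ge> 0" by linarith
  then have S: "S \<ge> 0" "S * S = D0 * D0 + 4 * m * N" by (simp_all add: S_def flip: power2_eq_square)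
  \<comment> \<open>A root of \<open>m * d\<^sup>2 + D0 * d = N\<close> in rationalised form: it
    remains valid for m = 0, and as \<open>S \<ge> 0\<close> and \<open>D0 > 0\<close> it is the
    small root.\<close>
  define d where "d = 2 * N / (D0 + S)"
  define z where "z = hill x n k + d * (1 - E_stat x n k \<tau>)"
  have pos: "D0 + S > 0" using D0 S by simp
  have "D_B s2 x n k \<tau> z = D0 + m * d"
    using D_B_affine[of s2 x n k \<tau> z "hill x n k"] by (simp add: D0_def m_def z_def algebra_simps)
  also have "\<dots> = (D0 + S) / 2"
  proof -
    have "D0 + m * d = (D0 * D0 + D0 * S + 2 * m * N) / (D0 + S)" using pos by (simp add: d_def field_simps)
    also have "D0 * D0 + D0 * S + 2 * m * N = (D0 + S) * (D0 + S) / 2" using S(2) by (simp add: algebra_simps)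
    also have "w * w / 2 / w = w / 2" if "w > 0" for w :: real using that by simp
    from this[OF pos] have "(D0 + S) * (D0 + S) / 2 / (D0 + S) = (D0 + S) / 2" .
    finally show ?thesis .
  qed
  finally have Dz: "D_B s2 x n k \<tau> z = (D0 + S) / 2" .
  have "D_B s2 x n k \<tau> z \<noteq> 0" unfolding Dz using pos by simp
  moreover have "d = (1 - hill x n k * \<tau>) / D_B s2 x n k \<tau> z * (E_stat x n k \<tau> - 1 / (1 - hill x n k * \<tau>))"
    unfolding Dz d_def N_def d_numerator_def by simp
  ultimately have "EPD_system s2 x n k \<tau> z d"
    unfolding EPD_system_def by (intro conjI z_def)
  moreover have "\<bar>d\<bar> \<le> 2 * \<bar>N\<bar> / D0"
    using D0 S(1) pos by (simp add: d_def abs_mult frac_le)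
  ultimately show ?thesis unfolding N_def D0_def by blast
qed

text \<open>The estimate need not be identified with the constructed root: minimality of
  \<open>\<bar>d\<bar>\<close> passes the bound for that root on to it. The last equation is a
  fixed-point equation in d, ready to be linearised.\<close>

lemma EPD_bayes_estimateD:
  fixes s2 \<tau> :: real
  assumes "EPD_bayes_estimate s2 x n k \<tau> z d"
    and "D_B s2 x n k \<tau> (hill x n k) > 0"
    and "8 * \<bar>D_slope s2 x n k \<tau> * (1 - E_stat x n k \<tau>) * d_numerator x n k \<tau>\<bar> \<le> (D_B s2 x n k \<tau> (hill x n k))\<^sup>2"
  shows "\<bar>d\<bar> \<le> 2 * \<bar>d_numerator x n k \<tau>\<bar> / D_B s2 x n k \<tau> (hill x n k)"
    and "z = hill x n k + d * (1 - E_stat x n k \<tau>)"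
    and "d = d_numerator x n k \<tau> / (D_B s2 x n k \<tau> (hill x n k) + D_slope s2 x n k \<tau> * (d * (1 - E_stat x n k \<tau>)))"
proof -
  show "\<bar>d\<bar> \<le> 2 * \<bar>d_numerator x n k \<tau>\<bar> / D_B s2 x n k \<tau> (hill x n k)"
  proof -
    obtain z' d' where "EPD_system s2 x n k \<tau> z' d'" and d': "\<bar>d'\<bar> \<le> 2 * \<bar>d_numerator x n k \<tau>\<bar> / D_B s2 x n k \<tau> (hill x n k)"
      using EPD_small_solution[OF assms(2,3)] by (elim exE conjE)
    then have "\<bar>d\<bar> \<le> \<bar>d'\<bar>" using assms(1) unfolding EPD_bayes_estimate_def by simp
    then show ?thesis using d' by (rule order_trans)
  qed
  have sys: "EPD_system s2 x n k \<tau> z d"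
    using assms(1) unfolding EPD_bayes_estimate_def by (rule conjunct1)
  show z: "z = hill x n k + d * (1 - E_stat x n k \<tau>)"
    by (rule sys[unfolded EPD_system_def, THEN conjunct2, THEN conjunct1])
  note sys[unfolded EPD_system_def, THEN conjunct2, THEN conjunct2]
  also have "(1 - hill x n k * \<tau>) / D_B s2 x n k \<tau> z * (E_stat x n k \<tau> - 1 / (1 - hill x n k * \<tau>))
      = d_numerator x n k \<tau> / D_B s2 x n k \<tau> z"
    by (simp add: d_numerator_def)
  also have "D_B s2 x n k \<tau> z = D_B s2 x n k \<tau> (hill x n k) + D_slope s2 x n k \<tau> * (d * (1 - E_stat x n k \<tau>))"
    unfolding D_B_affine[of s2 x n k \<tau> z "hill x n k"] unfolding z by simp
  finally show "d = d_numerator x n k \<tau> / (D_B s2 x n k \<tau> (hill x n k) + D_slope s2 x n k \<tau> * (d * (1 - E_stat x n k \<tau>)))" .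
qed

context tail_sample
begin

lemma top_mean_lim:
  assumes s: "(s \<longlongrightarrow> s0) (in_prob M)" and s_neg: "\<forall>\<^sub>F p in in_prob M. s p \<le> 0" and s0: "s0 \<le> 0"
  shows "((\<lambda>p. top_mean (s p) (fst p) (snd p)) \<longlongrightarrow> \<xi> / (1 - \<xi> * s0)) (in_prob M)"
proof -
  have den: "1 - \<xi> * s0 > 0" using mult_nonneg_nonpos[of \<xi> s0] \<xi> s0 by simp
  have tight: "tight_in_prob M (\<lambda>p. root_k (fst p) * (top_mean (s p) (fst p) (snd p) - \<xi> / (1 - \<xi> * s p)))"
    by (rule tight_null_diff[OF tight_exceedance_exp[OF s_neg] top_mean_expansion[OF s s_neg s0]])
  have "((\<lambda>p. inverse (root_k (fst p))) \<longlongrightarrow> 0) (in_prob M)"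
    by (intro tendsto_fst_in_prob tendsto_inverse_0_at_top sqrt_k)
  from tight_mult_null[OF tight this]
  have "((\<lambda>p. top_mean (s p) (fst p) (snd p) - \<xi> / (1 - \<xi> * s p)) \<longlongrightarrow> 0) (in_prob M)"
  proof (rule Lim_transform_eventually)
    show "\<forall>\<^sub>F p in in_prob M. root_k (fst p) * (top_mean (s p) (fst p) (snd p) - \<xi> / (1 - \<xi> * s p)) * inverse (root_k (fst p))
        = top_mean (s p) (fst p) (snd p) - \<xi> / (1 - \<xi> * s p)"
      using eventually_fst_in_prob[OF k_pos] by eventually_elim simp
  qed
  moreover have "((\<lambda>p. \<xi> / (1 - \<xi> * s p)) \<longlongrightarrow> \<xi> / (1 - \<xi> * s0)) (in_prob M)"
    using den by (intro tendsto_intros s) auto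
  ultimately have "((\<lambda>p. (top_mean (s p) (fst p) (snd p) - \<xi> / (1 - \<xi> * s p)) + \<xi> / (1 - \<xi> * s p)) \<longlongrightarrow> 0 + \<xi> / (1 - \<xi> * s0)) (in_prob M)"
    by (rule tendsto_add)
  then show ?thesis by simp
qed

lemma hill_eq_top_mean: "good n \<Longrightarrow> hill (\<lambda>i. X i \<omega>) n (k n) = top_mean 0 n \<omega>"
  unfolding top_mean_def by (rule hill_eq) (simp_all add: good_def)

lemma E_stat_eq_top_mean:
  "good n \<Longrightarrow> top_threshold n \<omega> > 0 \<Longrightarrow> E_stat (\<lambda>i. X i \<omega>) n (k n) s = 1 + s * top_mean s n \<omega>"
  unfolding top_mean_def top_threshold_def by (rule E_stat_eq) (simp_all add: good_def)

text \<open>Eventually \<open>s p < \<tau> / 2\<close>, so the Lipschitz constant in s is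
  \<open>- 2 / \<tau>\<close> times the norm of the tail process, which is tight.\<close>

lemma exceedance_exp_lim:
  assumes s: "(s \<longlongrightarrow> \<tau>) (in_prob M)"
  shows "((\<lambda>p. exceedance_exp (s p) (fst p) (snd p) - exceedance_exp \<tau> (fst p) (snd p)) \<longlongrightarrow> 0) (in_prob M)"
proof (rule Lim_null_comparison)
  have "((\<lambda>p. \<bar>s p - \<tau>\<bar> / (- \<tau> / 2)) \<longlongrightarrow> \<bar>\<tau> - \<tau>\<bar> / (- \<tau> / 2)) (in_prob M)"
    using \<tau> by (intro tendsto_intros s) auto
  then show "((\<lambda>p. process_norm (fst p) (snd p) * (\<bar>s p - \<tau>\<bar> / (- \<tau> / 2))) \<longlongrightarrow> 0) (in_prob M)"
    by (intro tight_mult_null[OF tight_process_norm]) simp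
  have "\<forall>\<^sub>F p in in_prob M. s p < \<tau> / 2" using \<tau> by (intro order_tendstoD(2)[OF s]) auto
  then show "\<forall>\<^sub>F p in in_prob M. norm (exceedance_exp (s p) (fst p) (snd p) - exceedance_exp \<tau> (fst p) (snd p))
      \<le> process_norm (fst p) (snd p) * (\<bar>s p - \<tau>\<bar> / (- \<tau> / 2))"
    using eventually_fst_in_prob[OF eventually_good]
  proof eventually_elim
    case (elim p)
    then show ?case
      using exceedance_exp_lipschitz[of "fst p" "s p" "- \<tau> / 2" \<tau> "snd p"] \<tau> by (simp add: mult.commute)
  qed
qed

text \<open>The estimator is the Hill estimator plus d (1 - E), where d is
  \<open>d_numerator\<close> over a denominator tending to D. The limit
  \<open>- \<rho> / (1 - \<rho>)\<close> of 1 - E, divided by D, multiplies the coefficients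
  \<open>- \<tau> / (1 - \<rho>)\<close> and \<open>(1 - \<rho>) * \<tau>\<close> of the linearised
  numerator; the summand 1 in the first coefficient is the error of the Hill estimator.\<close>

lemma estimator_expansion:
  fixes R zh dh :: "nat \<times> 'a \<Rightarrow> real" and s2 :: "nat \<Rightarrow> real" and \<mu> :: real
  defines "T \<equiv> \<lambda>p. R p / hill (\<lambda>i. X i (snd p)) (fst p) (k (fst p))"
    and "\<rho> \<equiv> \<xi> * \<tau>"
  assumes R: "(R \<longlongrightarrow> \<rho>) (in_prob M)" and s2: "(\<lambda>n. real (k n) * s2 n) \<longlonglongrightarrow> \<mu>" and \<mu>: "\<mu> > 0"
    and est: "\<And>p. snd p \<in> space M \<Longrightarrow> \<exists>z d. EPD_system (s2 (fst p)) (\<lambda>i. X i (snd p)) (fst p) (k (fst p)) (T p) z d \<Longrightarrow>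
      EPD_bayes_estimate (s2 (fst p)) (\<lambda>i. X i (snd p)) (fst p) (k (fst p)) (T p) (zh p) (dh p)"
  defines "D \<equiv> \<xi> / \<mu> + \<rho> ^ 4 / (\<xi> * (1 - 2 * \<rho>) * (1 - \<rho>)\<^sup>2)"
  shows "((\<lambda>p. root_k (fst p) * (zh p - \<xi>) -
    exceedance_sum (influence (1 + \<rho> * \<tau> / ((1 - \<rho>)\<^sup>2 * D)) (- (\<rho> * \<tau> / D))) (fst p) (snd p)) \<longlongrightarrow> 0) (in_prob M)"
proof -
  let ?G = "in_prob M"
  define rk where "rk p = root_k (fst p)" for p :: "nat \<times> 'a"
  define H where "H p = hill (\<lambda>i. X i (snd p)) (fst p) (k (fst p))" for p
  define E where "E s p = E_stat (\<lambda>i. X i (snd p)) (fst p) (k (fst p)) s" for s p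
  define A where "A s p = exceedance_exp s (fst p) (snd p)" for s p
  define tm where "tm s p = top_mean s (fst p) (snd p)" for s p
  have p1: "1 - \<rho> > 0" and p2: "1 - 2 * \<rho> > 0" using one_minus_pos by (simp_all add: \<rho>_def)
  have \<rho>0: "\<rho> < 0" unfolding \<rho>_def by (rule mult_pos_neg[OF \<xi> \<tau>])
  have D_pos: "D > 0"
    unfolding D_def using \<xi> \<mu> p1 p2 by (intro add_pos_nonneg divide_pos_pos divide_nonneg_nonneg mult_nonneg_nonneg) auto
  have rk_inv: "((\<lambda>p. inverse (rk p)) \<longlongrightarrow> 0) ?G"
    unfolding rk_def by (intro tendsto_fst_in_prob tendsto_inverse_0_at_top sqrt_k)
  have ev: "\<forall>\<^sub>F p in ?G. good (fst p) \<and> top_threshold (fst p) (snd p) > 0 \<and> rk p > 0 \<and> snd p \<in> space M"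
    using eventually_fst_in_prob[OF eventually_good] top_threshold_pos eventually_fst_in_prob[OF k_pos] eventually_snd_in_prob
    by eventually_elim (simp add: rk_def)
  have E_eq: "\<forall>\<^sub>F p in ?G. E (s p) p = 1 + s p * tm (s p) p" for s
    using ev by eventually_elim (simp add: E_def tm_def E_stat_eq_top_mean)
  have H_eq: "\<forall>\<^sub>F p in ?G. tm 0 p = H p"
    using ev by eventually_elim (simp add: H_def tm_def hill_eq_top_mean)
  have H: "(H \<longlongrightarrow> \<xi>) ?G"
  proof -
    have "((\<lambda>p. tm 0 p) \<longlongrightarrow> \<xi> / (1 - \<xi> * 0)) ?G"
      unfolding tm_def by (rule top_mean_lim) auto
    from Lim_transform_eventually[OF this H_eq] show ?thesis by simp
  qed
  have T: "(T \<longlongrightarrow> \<tau>) ?G"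
    using tendsto_divide[OF R H] \<xi> by (simp add: T_def H_def \<rho>_def)
  have T_neg: "\<forall>\<^sub>F p in ?G. T p \<le> 0"
    using order_tendstoD(2)[OF T \<tau>] by eventually_elim simp
  have T2: "((\<lambda>p. 2 * T p) \<longlongrightarrow> 2 * \<tau>) ?G" by (intro tendsto_intros T)
  have T2_neg: "\<forall>\<^sub>F p in ?G. 2 * T p \<le> 0" using T_neg by eventually_elim simp
  define \<Gamma> where "\<Gamma> p = rk p * (H p - \<xi>)" for p
  have \<Gamma>: "((\<lambda>p. \<Gamma> p - A 0 p) \<longlongrightarrow> 0) ?G"
  proof (rule Lim_transform_eventually)
    show "((\<lambda>p. rk p * (tm 0 p - \<xi> / (1 - \<xi> * 0)) - A 0 p) \<longlongrightarrow> 0) ?G"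
      unfolding rk_def tm_def A_def by (rule top_mean_expansion) auto
    show "\<forall>\<^sub>F p in ?G. rk p * (tm 0 p - \<xi> / (1 - \<xi> * 0)) - A 0 p = \<Gamma> p - A 0 p"
      using H_eq by eventually_elim (simp add: \<Gamma>_def)
  qed
  have A0: "tight_in_prob M (A 0)" and A\<tau>: "tight_in_prob M (A \<tau>)"
    unfolding A_def[abs_def] using \<tau> by (intro tight_exceedance_exp; simp)+
  define Z where "Z p = rk p * (tm (T p) p - \<xi> / (1 - \<xi> * T p))" for p
  have Z: "((\<lambda>p. Z p - A \<tau> p) \<longlongrightarrow> 0) ?G"
    using tendsto_add[OF top_mean_expansion[OF T T_neg] exceedance_exp_lim[OF T]] \<tau>
    by (simp add: Z_def A_def tm_def rk_def)
  have E_lim: "((\<lambda>p. E (s p) p) \<longlongrightarrow> 1 / (1 - \<xi> * s0)) ?G"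
    if "(s \<longlongrightarrow> s0) ?G" "\<forall>\<^sub>F p in ?G. s p \<le> 0" "s0 \<le> 0" for s s0
  proof (rule Lim_transform_eventually)
    have den: "1 - \<xi> * s0 > 0" using mult_nonneg_nonpos[of \<xi> s0] \<xi> that by simp
    have "((\<lambda>p. 1 + s p * tm (s p) p) \<longlongrightarrow> 1 + s0 * (\<xi> / (1 - \<xi> * s0))) ?G"
      unfolding tm_def by (intro tendsto_intros that top_mean_lim)
    also have "1 + s0 * (\<xi> / (1 - \<xi> * s0)) = 1 / (1 - \<xi> * s0)" using den by (simp add: field_simps)
    finally show "((\<lambda>p. 1 + s p * tm (s p) p) \<longlongrightarrow> 1 / (1 - \<xi> * s0)) ?G" .
    show "\<forall>\<^sub>F p in ?G. 1 + s p * tm (s p) p = E (s p) p" using E_eq[of s] by eventually_elim simp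
  qed
  have E1: "((\<lambda>p. E (T p) p) \<longlongrightarrow> 1 / (1 - \<rho>)) ?G"
    using E_lim[OF T T_neg] \<tau> by (simp add: \<rho>_def)
  have E2: "((\<lambda>p. E (2 * T p) p) \<longlongrightarrow> 1 / (1 - 2 * \<rho>)) ?G"
    using E_lim[OF T2 T2_neg] \<tau> by (simp add: \<rho>_def mult.left_commute)
  define N where "N p = d_numerator (\<lambda>i. X i (snd p)) (fst p) (k (fst p)) (T p)" for p
  define W where "W p = (1 - \<rho>) * \<tau> * A \<tau> p + (- \<tau> / (1 - \<rho>)) * A 0 p" for p
  have W: "tight_in_prob M W"
    unfolding W_def by (intro tight_add tight_mult A0 A\<tau> tight_of_tendsto[OF tendsto_const])
  have NW: "((\<lambda>p. rk p * N p - W p) \<longlongrightarrow> 0) ?G"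
  proof (rule Lim_transform_eventually)
    have c1: "((\<lambda>p. (1 - R p) * T p) \<longlongrightarrow> (1 - \<rho>) * \<tau>) ?G" by (intro tendsto_intros R T)
    have c2: "((\<lambda>p. - T p / (1 - \<xi> * T p)) \<longlongrightarrow> - \<tau> / (1 - \<rho>)) ?G"
      unfolding \<rho>_def using one_minus_pos by (intro tendsto_intros T) auto
    show "((\<lambda>p. ((1 - R p) * T p * Z p - (1 - \<rho>) * \<tau> * A \<tau> p) + (- T p / (1 - \<xi> * T p) * \<Gamma> p - - \<tau> / (1 - \<rho>) * A 0 p)) \<longlongrightarrow> 0) ?G"
      using tendsto_add[OF tight_null_approx[OF A\<tau> Z c1] tight_null_approx[OF A0 \<Gamma> c2]] by simp
    have "\<forall>\<^sub>F p in ?G. R p < 1" "\<forall>\<^sub>F p in ?G. H p > 0"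
      using \<rho>0 \<xi> by (intro order_tendstoD(2)[OF R] order_tendstoD(1)[OF H]; simp)+
    then show "\<forall>\<^sub>F p in ?G. ((1 - R p) * T p * Z p - (1 - \<rho>) * \<tau> * A \<tau> p) + (- T p / (1 - \<xi> * T p) * \<Gamma> p - - \<tau> / (1 - \<rho>) * A 0 p)
        = rk p * N p - W p"
      using T_neg E_eq[of T] ev
    proof eventually_elim
      case (elim p)
      \<comment> \<open>This exact identity removes the error of R: what remains in the numerator
        are \<open>H p - \<xi>\<close> and the centred mean at \<open>T p\<close>, so no rate of
        convergence of R enters.\<close>
      have HT: "H p * T p = R p" using elim by (simp add: T_def H_def)
      define q where "q = 1 - \<xi> * T p"
      have q: "q > 0" using mult_nonneg_nonpos[of \<xi> "T p"] \<xi> elim by (simp add: q_def)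
      have "N p = (1 - R p) * (1 + T p * tm (T p) p - 1 / (1 - R p))"
        unfolding N_def d_numerator_def using HT elim by (simp add: H_def E_def)
      also have "\<dots> = (1 - R p) * (1 + T p * tm (T p) p) - 1"
        using elim by (simp add: right_diff_distrib)
      also have "\<dots> = (1 - R p) * (T p * (tm (T p) p - \<xi> / q)) + ((1 - R p) / q - 1)"
      proof -
        have "T p * (\<xi> / q) = 1 / q - 1" using q by (simp add: q_def field_simps)
        then have i: "T p * (tm (T p) p - \<xi> / q) = T p * tm (T p) p - (1 / q - 1)" by (simp only: right_diff_distrib)
        show ?thesis unfolding i by (simp add: algebra_simps diff_divide_distrib)
      qed
      also have "(1 - R p) / q - 1 = - T p / q * (H p - \<xi>)"
      proof -
        have "1 - R p - q = - T p * (H p - \<xi>)" using HT by (simp add: q_def algebra_simps)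
        moreover have "(1 - R p) / q - 1 = (1 - R p - q) / q" using q by (simp add: diff_divide_distrib)
        ultimately show ?thesis by simp
      qed
      finally have N_eq: "N p = (1 - R p) * (T p * (tm (T p) p - \<xi> / q)) + - T p / q * (H p - \<xi>)" .
      have "rk p * N p = (1 - R p) * T p * Z p + (- T p / q * \<Gamma> p)"
        unfolding N_eq Z_def \<Gamma>_def q_def[symmetric] by (simp only: distrib_left ac_simps)
      then show ?case by (simp add: W_def q_def)
    qed
  qed
  have N0: "(N \<longlongrightarrow> 0) ?G"
  proof (rule Lim_transform_eventually[OF tight_mult_null[OF tight_null_diff[OF W NW] rk_inv]])
    show "\<forall>\<^sub>F p in ?G. rk p * N p * inverse (rk p) = N p" using ev by eventually_elim simp
  qed
  define D0 where "D0 p = D_B (s2 (fst p)) (\<lambda>i. X i (snd p)) (fst p) (k (fst p)) (T p) (H p)" for p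
  define B where "B p = D_slope (s2 (fst p)) (\<lambda>i. X i (snd p)) (fst p) (k (fst p)) (T p)" for p
  have ks: "((\<lambda>p. real (k (fst p)) * s2 (fst p)) \<longlongrightarrow> \<mu>) ?G" by (rule tendsto_fst_in_prob[OF s2])
  \<comment> \<open>The bracket in \<open>D_B\<close> tends to minus the second summand of D. Both
    summands of D are then nonnegative and the first is positive, which keeps the denominator away
    from 0.\<close>
  have D0: "(D0 \<longlongrightarrow> D) ?G"
  proof -
    have "((\<lambda>p. H p / (real (k (fst p)) * s2 (fst p)) - (1 - 2 * (1 - H p * T p) * E (T p) p
        + (1 - 2 * H p * T p - H p * (T p)\<^sup>2) * E (2 * T p) p - T p * (1 - E (T p) p) * E (T p) p)) \<longlongrightarrow>
       \<xi> / \<mu> - (1 - 2 * (1 - \<xi> * \<tau>) * (1 / (1 - \<rho>)) + (1 - 2 * \<xi> * \<tau> - \<xi> * \<tau>\<^sup>2) * (1 / (1 - 2 * \<rho>))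
          - \<tau> * (1 - 1 / (1 - \<rho>)) * (1 / (1 - \<rho>)))) ?G"
      using \<mu> by (intro tendsto_intros H T E1 E2 ks) auto
    also have "\<xi> / \<mu> - (1 - 2 * (1 - \<xi> * \<tau>) * (1 / (1 - \<rho>)) + (1 - 2 * \<xi> * \<tau> - \<xi> * \<tau>\<^sup>2) * (1 / (1 - 2 * \<rho>))
          - \<tau> * (1 - 1 / (1 - \<rho>)) * (1 / (1 - \<rho>))) = D"
    proof -
      have \<tau>_eq: "\<tau> = \<rho> / \<xi>" using \<xi> by (simp add: \<rho>_def)
      define a b where "a = 1 - \<rho>" and "b = 1 - 2 * \<rho>"
      have ab: "a \<noteq> 0" "b \<noteq> 0" "\<rho> = 1 - a" "b = 2 * a - 1" using p1 p2 by (simp_all add: a_def b_def)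
      have e1: "\<xi> * \<tau> = \<rho>" "2 * \<xi> * \<tau> = 2 * \<rho>" "\<xi> * \<tau>\<^sup>2 = \<rho> * \<tau>" by (simp_all add: \<rho>_def power2_eq_square)
      have "1 - 2 * (1 - \<xi> * \<tau>) * (1 / (1 - \<rho>)) + (1 - 2 * \<xi> * \<tau> - \<xi> * \<tau>\<^sup>2) * (1 / (1 - 2 * \<rho>)) - \<tau> * (1 - 1 / (1 - \<rho>)) * (1 / (1 - \<rho>))
        = \<tau> * (- \<rho> / b - (1 - 1 / a) * (1 / a))"
        unfolding e1 a_def[symmetric] b_def[symmetric] using ab(1,2) by (simp add: field_simps)
      also have "- \<rho> / b - (1 - 1 / a) * (1 / a) = - (\<rho> ^ 3 / (b * a\<^sup>2))"
        using ab(1,2) unfolding ab(3,4) by (simp add: field_simps power2_eq_square power3_eq_cube)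
      also have "\<tau> * - (\<rho> ^ 3 / (b * a\<^sup>2)) = - (\<rho> ^ 4 / (\<xi> * b * a\<^sup>2))"
        unfolding \<tau>_eq by (simp add: power4_eq_xxxx power3_eq_cube)
      finally show ?thesis unfolding D_def a_def b_def by simp
    qed
    finally show ?thesis by (simp add: D0_def[abs_def] D_B_def E_def)
  qed
  define b0 where "b0 = 1 / \<mu> - 2 * \<tau> * (1 / (1 - \<rho>)) + (2 * \<tau> + \<tau>\<^sup>2) * (1 / (1 - 2 * \<rho>))"
  have B: "(B \<longlongrightarrow> b0) ?G"
  proof -
    have "((\<lambda>p. 1 / (real (k (fst p)) * s2 (fst p)) - 2 * T p * E (T p) p + (2 * T p + (T p)\<^sup>2) * E (2 * T p) p) \<longlongrightarrow> b0) ?G"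
      unfolding b0_def using \<mu> by (intro tendsto_intros T E1 E2 ks) auto
    then show ?thesis by (simp add: B_def[abs_def] D_slope_def E_def)
  qed
  define c where "c p = 1 - E (T p) p" for p
  have c: "(c \<longlongrightarrow> 1 - 1 / (1 - \<rho>)) ?G" unfolding c_def by (intro tendsto_intros E1)
  \<comment> \<open>The numerator is null while the limit of \<open>D0\<close> is positive, so the
    smallness condition on the quadratic holds eventually.\<close>
  have small: "\<forall>\<^sub>F p in ?G. 8 * \<bar>B p * c p * N p\<bar> < (D0 p)\<^sup>2"
  proof -
    have "((\<lambda>p. (D0 p)\<^sup>2 - 8 * \<bar>B p * c p * N p\<bar>) \<longlongrightarrow> D\<^sup>2 - 8 * \<bar>b0 * (1 - 1 / (1 - \<rho>)) * 0\<bar>) ?G"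
      by (intro tendsto_intros D0 B c N0)
    then have "\<forall>\<^sub>F p in ?G. (D0 p)\<^sup>2 - 8 * \<bar>B p * c p * N p\<bar> > 0"
      by (rule order_tendstoD(1)) (use D_pos in simp)
    then show ?thesis by eventually_elim simp
  qed
  \<comment> \<open>The small root shows that the system is solvable, which is the premise under
    which \<open>est\<close> speaks about the estimator.\<close>
  have sol: "\<forall>\<^sub>F p in ?G. \<bar>dh p\<bar> \<le> 2 * \<bar>N p\<bar> / D0 p \<and> zh p = H p + dh p * c p \<and> dh p = N p / (D0 p + B p * (dh p * c p))"
    using ev small order_tendstoD(1)[OF D0 D_pos]
  proof eventually_elim
    case (elim p)
    have sm: "8 * \<bar>D_slope (s2 (fst p)) (\<lambda>i. X i (snd p)) (fst p) (k (fst p)) (T p) * (1 - E_stat (\<lambda>i. X i (snd p)) (fst p) (k (fst p)) (T p))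
        * d_numerator (\<lambda>i. X i (snd p)) (fst p) (k (fst p)) (T p)\<bar>
      \<le> (D_B (s2 (fst p)) (\<lambda>i. X i (snd p)) (fst p) (k (fst p)) (T p) (hill (\<lambda>i. X i (snd p)) (fst p) (k (fst p))))\<^sup>2"
      and pos: "D_B (s2 (fst p)) (\<lambda>i. X i (snd p)) (fst p) (k (fst p)) (T p) (hill (\<lambda>i. X i (snd p)) (fst p) (k (fst p))) > 0"
      using elim unfolding B_def c_def E_def N_def D0_def H_def by simp_all
    have "EPD_bayes_estimate (s2 (fst p)) (\<lambda>i. X i (snd p)) (fst p) (k (fst p)) (T p) (zh p) (dh p)"
    proof (rule est)
      show "snd p \<in> space M" using elim by simp
      show "\<exists>z d. EPD_system (s2 (fst p)) (\<lambda>i. X i (snd p)) (fst p) (k (fst p)) (T p) z d"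
        using EPD_small_solution[OF pos sm] by (elim exE conjE) (intro exI)
    qed
    note D = EPD_bayes_estimateD[OF this pos sm]
    show ?case
      unfolding B_def c_def E_def N_def D0_def H_def by (intro conjI D)
  qed
  have dh: "(dh \<longlongrightarrow> 0) ?G"
  proof (rule Lim_null_comparison)
    show "\<forall>\<^sub>F p in ?G. norm (dh p) \<le> 2 * \<bar>N p\<bar> / D0 p"
      unfolding real_norm_def using sol by (rule eventually_mono) (erule conjunct1)
    have "((\<lambda>p. 2 * \<bar>N p\<bar> / D0 p) \<longlongrightarrow> 2 * \<bar>0\<bar> / D) ?G" using D_pos by (intro tendsto_intros N0 D0) auto
    then show "((\<lambda>p. 2 * \<bar>N p\<bar> / D0 p) \<longlongrightarrow> 0) ?G" by simp
  qed
  \<comment> \<open>The feedback \<open>dh p * c p\<close> in the denominator is null, so the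
    implicit equation becomes linear in the limit.\<close>
  define c' where "c' p = c p / (D0 p + B p * (dh p * c p))" for p
  have c': "(c' \<longlongrightarrow> (1 - 1 / (1 - \<rho>)) / D) ?G"
  proof -
    have "(c' \<longlongrightarrow> (1 - 1 / (1 - \<rho>)) / (D + b0 * (0 * (1 - 1 / (1 - \<rho>))))) ?G"
      unfolding c'_def using D_pos by (intro tendsto_intros c D0 B dh) simp
    then show ?thesis by simp
  qed
  have "((\<lambda>p. (\<Gamma> p - A 0 p) + (c' p * (rk p * N p) - (1 - 1 / (1 - \<rho>)) / D * W p)) \<longlongrightarrow> 0) ?G"
    using tendsto_add[OF \<Gamma> tight_null_approx[OF W NW c']] by simp
  then show ?thesis
  proof (rule Lim_transform_eventually)
    show "\<forall>\<^sub>F p in ?G. (\<Gamma> p - A 0 p) + (c' p * (rk p * N p) - (1 - 1 / (1 - \<rho>)) / D * W p)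
      = root_k (fst p) * (zh p - \<xi>) - exceedance_sum (influence (1 + \<rho> * \<tau> / ((1 - \<rho>)\<^sup>2 * D)) (- (\<rho> * \<tau> / D))) (fst p) (snd p)"
      using sol
    proof eventually_elim
      case (elim p)
      have "rk p * (zh p - \<xi>) = \<Gamma> p + rk p * (dh p * c p)"
        using elim[THEN conjunct2, THEN conjunct1] by (simp add: \<Gamma>_def algebra_simps)
      also have "dh p * c p = N p / (D0 p + B p * (dh p * c p)) * c p"
        by (rule arg_cong[OF elim[THEN conjunct2, THEN conjunct2]])
      also have "\<dots> = c' p * N p" by (simp add: c'_def)
      finally have 1: "rk p * (zh p - \<xi>) = \<Gamma> p + c' p * (rk p * N p)" by simp
      have "(1 - 1 / (1 - \<rho>)) / D = - \<rho> / ((1 - \<rho>) * D)" using p1 D_pos by (simp add: field_simps)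
      moreover have "x + - \<rho> / (a * D) * (a * \<tau> * y + - \<tau> / a * x) = (1 + \<rho> * \<tau> / (a\<^sup>2 * D)) * x + - (\<rho> * \<tau> / D) * y"
        if "a \<noteq> 0" for a x y
        using that D_pos by (simp add: field_simps power2_eq_square)
      ultimately have "A 0 p + (1 - 1 / (1 - \<rho>)) / D * W p
          = (1 + \<rho> * \<tau> / ((1 - \<rho>)\<^sup>2 * D)) * A 0 p + - (\<rho> * \<tau> / D) * A \<tau> p"
        unfolding W_def using p1 by simp
      then show ?case
        using 1 unfolding exceedance_sum_influence A_def rk_def by simp
    qed
  qed
qed

end

section \<open>The normal limit and its two parameters\<close>

lemma char_normal_density:
  assumes s: "s > 0"
  shows "real_distribution (density lborel (normal_density m s))"
    and "char (density lborel (normal_density m s)) t = exp (\<i> * complex_of_real t * complex_of_real m - (complex_of_real t)\<^sup>2 * complex_of_real (s\<^sup>2) / 2)"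
proof -
  interpret S: real_distribution std_normal_distribution by (rule real_dist_normal_dist)
  have "distributed std_normal_distribution lborel (\<lambda>x. x) std_normal_density"
    by (simp add: distributed_def distr_id2)
  from S.normal_density_affine[OF this, of s m] s
  have d: "distributed std_normal_distribution lborel (\<lambda>x. m + s * x) (normal_density m s)" by simp
  have eq: "density lborel (normal_density m s) = distr std_normal_distribution borel (\<lambda>x. m + s * x)"
    using d unfolding distributed_def by (simp cong: distr_cong)
  show "real_distribution (density lborel (normal_density m s))"
    unfolding eq by (intro S.real_distribution_distr) simp
  have "char (density lborel (normal_density m s)) t = (CLINT x|std_normal_distribution. iexp (t * (m + s * x)))"
    unfolding eq char_def by (rule integral_distr) auto
  also have "\<dots> = (CLINT x|std_normal_distribution. iexp (t * m) * iexp (t * s * x))"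
    by (intro Bochner_Integration.integral_cong) (auto simp: algebra_simps simp flip: exp_add)
  also have "\<dots> = iexp (t * m) * char std_normal_distribution (t * s)"
    unfolding char_def by (simp add: mult.assoc)
  also have "\<dots> = exp (\<i> * complex_of_real t * complex_of_real m - (complex_of_real t)\<^sup>2 * complex_of_real (s\<^sup>2) / 2)"
    unfolding char_std_normal_distribution
    by (simp add: power_mult_distrib exp_of_real[symmetric] algebra_simps flip: exp_add)
  finally show "char (density lborel (normal_density m s)) t = exp (\<i> * complex_of_real t * complex_of_real m - (complex_of_real t)\<^sup>2 * complex_of_real (s\<^sup>2) / 2)" .
qed

theorem mainTheorem1:
  fixes M :: "'a measure" and X :: "nat \<Rightarrow> 'a \<Rightarrow> real" and F :: "real \<Rightarrow> real"
    and \<xi> \<tau> \<rho> C \<mu> L \<zeta> :: real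
    and k :: "nat \<Rightarrow> nat" and \<sigma>2 :: "nat \<Rightarrow> nat \<Rightarrow> real"
    and \<rho>hat \<tau>hat \<xi>hat \<delta>hat :: "nat \<Rightarrow> 'a \<Rightarrow> real"
  assumes "prob_space M"
    and "\<xi> > 0" and "\<tau> < 0" and "\<rho> = \<xi> * \<tau>"
    and "C > 0" and "F \<in> tail_class \<xi> \<tau> C"
    and "prob_space.indep_vars M (\<lambda>_. borel) X {1..}"
    and "\<And>i. i \<ge> 1 \<Longrightarrow> cdf (distr M borel (X i)) = F"
    and "filterlim k at_top sequentially"
    and "(\<lambda>n. real (k n) / real n) \<longlonglongrightarrow> 0"
    and "\<And>n. \<sigma>2 (k n) n > 0"
    and "(\<lambda>n. real (k n) * \<sigma>2 (k n) n) \<longlonglongrightarrow> \<mu>" and "\<mu> > 0"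
    and "(\<lambda>n. sqrt (real (k n)) * a_fun \<xi> C F (real n / real (k n))) \<longlonglongrightarrow> L"
    and "\<And>n. \<rho>hat n \<in> borel_measurable M"
    and "conv_in_prob M \<rho>hat \<rho>"
    and "\<And>n \<omega>. \<tau>hat n \<omega> = \<rho>hat n \<omega> / hill (\<lambda>i. X i \<omega>) n (k n)"
    and "\<And>n. \<xi>hat n \<in> borel_measurable M"
    and "\<And>n. \<delta>hat n \<in> borel_measurable M"
    \<comment> \<open>wherever the system is solvable; nothing is assumed on the complementary event\<close>
    and "\<And>n \<omega>. \<omega> \<in> space M \<Longrightarrow>
           \<exists>z d. EPD_system (\<sigma>2 (k n) n) (\<lambda>i. X i \<omega>) n (k n) (\<tau>hat n \<omega>) z d \<Longrightarrow>
           EPD_bayes_estimate (\<sigma>2 (k n) n) (\<lambda>i. X i \<omega>) n (k n) (\<tau>hat n \<omega>)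
             (\<xi>hat n \<omega>) (\<delta>hat n \<omega>)"
    and "\<zeta> = \<xi>\<^sup>2 * (1 - 2 * \<rho>) * (1 - \<rho>)\<^sup>2 / \<mu>"
  shows "weak_conv_m
           (\<lambda>n. distr M borel (\<lambda>\<omega>. sqrt (real (k n)) * (\<xi>hat n \<omega> - \<xi>)))
           (density lborel
             (normal_density
               (L * \<rho> / (1 - \<rho>) * (\<zeta> / (\<zeta> + \<rho> ^ 4)))
               (sqrt (\<xi>\<^sup>2 / (1 + \<zeta> / \<rho> ^ 4)\<^sup>2
                 * (((1 - \<rho>) / \<rho>)\<^sup>2 + \<zeta>\<^sup>2 / \<rho> ^ 8 + 2 * (\<zeta> / \<rho> ^ 4))))))"
proof -
  interpret M: prob_space M by (rule assms)
  note \<xi> = assms(2) and \<tau> = assms(3) and \<rho> = assms(4)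
  obtain N where N: "real_distribution N" "F = cdf N"
    using assms(6) by (auto simp: tail_class_def)
  obtain \<delta> l where \<delta>: "slowly_varying l"
    "\<And>x. x > 0 \<Longrightarrow> 1 - F x = C * x powr (- (1 / \<xi>)) * (1 + \<delta> x / \<xi>)"
    "(\<forall>\<^sub>F x in at_top. \<delta> x > 0) \<or> (\<forall>\<^sub>F x in at_top. \<delta> x < 0)"
    "\<And>x. x > 0 \<Longrightarrow> \<bar>\<delta> x\<bar> = x powr \<tau> * l x"
    using assms(6) by (auto simp: tail_class_def)
  have X_meas: "X i \<in> borel_measurable M" if "i \<ge> 1" for i
    using assms(7) that unfolding M.indep_vars_def by auto
  \<comment> \<open>The cdf determines the law, so all observations have distribution N.\<close>
  have distr_X: "distr M borel (X i) = N" if "i \<ge> 1" for i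
    using assms(8)[OF that] N M.real_distribution_distr[OF X_meas[OF that]] by (intro cdf_unique) auto
  interpret N: real_distribution N by (rule N(1))
  interpret tail_sample \<delta> l \<tau> \<xi> C L N k M X
    by unfold_locales (fact \<delta> assms \<delta>(2)[unfolded N(2)] assms(14)[unfolded N(2)] distr_X)+
  define p q where "p = 1 - \<rho>" and "q = 1 - 2 * \<rho>"
  have \<rho>_neg: "\<rho> < 0" unfolding \<rho> by (rule mult_pos_neg[OF \<xi> \<tau>])
  then have pq: "p > 0" "q > 0" by (simp_all add: p_def q_def)
  have \<zeta>: "\<zeta> > 0" unfolding assms(21) using \<xi> \<rho>_neg assms(13) by simp
  \<comment> \<open>D is V divided by \<open>\<xi> * q * p\<^sup>2\<close>, so V is the denominator
    in both asymptotic moments, and \<open>\<zeta> / V\<close> is the factor by which the bias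
    shrinks.\<close>
  define V where "V = \<zeta> + \<rho> ^ 4"
  have V: "V > 0" using \<zeta> \<rho>_neg by (simp add: V_def add_pos_nonneg)
  define D where "D = \<xi> / \<mu> + \<rho> ^ 4 / (\<xi> * (1 - 2 * \<rho>) * (1 - \<rho>)\<^sup>2)"
  have D: "D = V / (\<xi> * q * p\<^sup>2)"
  proof -
    have "\<xi> / \<mu> = \<zeta> / (\<xi> * q * p\<^sup>2)"
      unfolding assms(21) p_def[symmetric] q_def[symmetric] using pq \<xi> assms(13)
      by (simp add: field_simps power2_eq_square)
    then show ?thesis by (simp add: D_def V_def p_def q_def add_divide_distrib)
  qed
  define \<kappa> where "\<kappa> = \<rho>\<^sup>2 * q * p\<^sup>2 / V"
  have \<kappa>: "\<rho> * \<tau> / D = \<kappa>"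
  proof -
    have "\<rho> * \<tau> * (\<xi> * q * p\<^sup>2) = \<rho>\<^sup>2 * q * p\<^sup>2" unfolding \<rho> by (simp add: power2_eq_square)
    then show ?thesis by (simp add: D \<kappa>_def)
  qed
  define a0 where "a0 = 1 + \<rho> * \<tau> / ((1 - \<rho>)\<^sup>2 * D)"
  define a1 where "a1 = - (\<rho> * \<tau> / D)"
  have a0: "a0 = 1 + \<kappa> / p\<^sup>2"
    unfolding a0_def \<kappa>[symmetric] p_def by (simp add: mult.commute)
  have a1: "a1 = - \<kappa>" by (simp add: a1_def \<kappa>)
  have mean: "influence_mean a0 a1 = L * \<rho> / (1 - \<rho>) * (\<zeta> / (\<zeta> + \<rho> ^ 4))"
  proof -
    have "influence_mean a0 a1 = L * ((1 + \<kappa> / p\<^sup>2) * (1 / p - 1) - \<kappa> * (1 / q - 1 / p))"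
      by (simp add: influence_mean_def a0 a1 p_def q_def \<rho>)
    also have "(1 + \<kappa> / p\<^sup>2) * (1 / p - 1) - \<kappa> * (1 / q - 1 / p) = \<rho> / p * (1 - \<kappa> * \<rho>\<^sup>2 / (p\<^sup>2 * q))"
    proof -
      have r: "\<rho> = 1 - p" "q = 2 * p - 1" by (simp_all add: p_def q_def)
      show ?thesis using pq unfolding r by (simp add: field_simps power2_eq_square)
    qed
    also have "\<kappa> * \<rho>\<^sup>2 / (p\<^sup>2 * q) = \<rho> ^ 4 / V"
      using pq V by (simp add: \<kappa>_def field_simps flip: power_add)
    also have "1 - \<rho> ^ 4 / V = \<zeta> / V" using V by (simp add: V_def field_simps)
    finally show ?thesis by (simp add: V_def p_def)
  qed
  define v where "v = \<xi>\<^sup>2 / (1 + \<zeta> / \<rho> ^ 4)\<^sup>2 * (((1 - \<rho>) / \<rho>)\<^sup>2 + \<zeta>\<^sup>2 / \<rho> ^ 8 + 2 * (\<zeta> / \<rho> ^ 4))"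
  have var: "influence_var a0 a1 = v"
  proof -
    have "influence_var a0 a1 = \<xi>\<^sup>2 * ((1 + \<kappa> / p\<^sup>2)\<^sup>2 - 2 * (1 + \<kappa> / p\<^sup>2) * \<kappa> / p\<^sup>2 + \<kappa>\<^sup>2 / (q * p\<^sup>2))"
      by (simp add: influence_var_def a0 a1 p_def q_def \<rho>)
    also have "(1 + \<kappa> / p\<^sup>2)\<^sup>2 - 2 * (1 + \<kappa> / p\<^sup>2) * \<kappa> / p\<^sup>2 + \<kappa>\<^sup>2 / (q * p\<^sup>2) = 1 + \<kappa>\<^sup>2 * \<rho>\<^sup>2 / (q * p ^ 4)"
    proof -
      \<comment> \<open>The terms linear in \<kappa> cancel in the variance, and this relation
        merges the quadratic ones into a single term.\<close>
      have r: "\<rho>\<^sup>2 = p\<^sup>2 - q" by (simp add: p_def q_def power2_eq_square algebra_simps)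
      show ?thesis unfolding r using pq by (simp add: field_simps power2_eq_square power4_eq_xxxx)
    qed
    also have "\<kappa>\<^sup>2 * \<rho>\<^sup>2 / (q * p ^ 4) = \<rho> ^ 6 * q / V\<^sup>2"
      using pq V by (simp add: \<kappa>_def field_simps power2_eq_square power4_eq_xxxx eval_nat_numeral)
    finally have 1: "influence_var a0 a1 = \<xi>\<^sup>2 * (1 + \<rho> ^ 6 * q / V\<^sup>2)" .
    define y where "y = \<rho> ^ 4"
    have y: "y > 0" using \<rho>_neg by (simp add: y_def)
    \<comment> \<open>The summand 1 completes the square \<open>(1 + \<zeta> / y)\<^sup>2\<close>
      together with the two terms in \<zeta>.\<close>
    have "((1 - \<rho>) / \<rho>)\<^sup>2 = 1 + q / \<rho>\<^sup>2"
      using \<rho>_neg by (simp add: q_def field_simps power2_eq_square)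
    then have "((1 - \<rho>) / \<rho>)\<^sup>2 + \<zeta>\<^sup>2 / \<rho> ^ 8 + 2 * (\<zeta> / \<rho> ^ 4) = (1 + \<zeta> / y)\<^sup>2 + q / \<rho>\<^sup>2"
      by (simp add: y_def power2_eq_square algebra_simps flip: power_add)
    then have "v = \<xi>\<^sup>2 / (1 + \<zeta> / y)\<^sup>2 * ((1 + \<zeta> / y)\<^sup>2 + q / \<rho>\<^sup>2)" by (simp add: v_def y_def)
    also have "1 + \<zeta> / y = V / y" using y by (simp add: V_def y_def[symmetric] field_simps)
    also have "\<xi>\<^sup>2 / (V / y)\<^sup>2 * ((V / y)\<^sup>2 + q / \<rho>\<^sup>2) = \<xi>\<^sup>2 * (1 + (q / \<rho>\<^sup>2) * y\<^sup>2 / V\<^sup>2)"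
      using V y by (simp add: field_simps)
    also have "(q / \<rho>\<^sup>2) * y\<^sup>2 = \<rho> ^ 6 * q"
      using \<rho>_neg by (simp add: y_def field_simps flip: power_mult power_add)
    finally show ?thesis using 1 by simp
  qed
  \<comment> \<open>The limit must be a nondegenerate normal law, since
    \<open>normal_density\<close> describes a probability only for a positive standard
    deviation.\<close>
  have v_pos: "v > 0"
  proof -
    have "((1 - \<rho>) / \<rho>)\<^sup>2 > 0" using \<rho>_neg by simp
    moreover have "\<zeta>\<^sup>2 / \<rho> ^ 8 \<ge> 0" "2 * (\<zeta> / \<rho> ^ 4) \<ge> 0" using \<zeta> by simp_all
    moreover have "1 + \<zeta> / \<rho> ^ 4 > 0" using \<zeta> by (simp add: add_pos_nonneg)
    ultimately have "((1 - \<rho>) / \<rho>)\<^sup>2 + \<zeta>\<^sup>2 / \<rho> ^ 8 + 2 * (\<zeta> / \<rho> ^ 4) > 0" "(1 + \<zeta> / \<rho> ^ 4)\<^sup>2 > 0"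
      by (linarith, simp)
    then show ?thesis unfolding v_def using \<xi> by (intro mult_pos_pos divide_pos_pos) auto
  qed
  have expansion: "((\<lambda>p. root_k (fst p) * (\<xi>hat (fst p) (snd p) - \<xi>) - exceedance_sum (influence a0 a1) (fst p) (snd p)) \<longlongrightarrow> 0) (in_prob M)"
    unfolding a0_def a1_def D_def \<rho>
  proof (rule estimator_expansion)
    show "((\<lambda>p. \<rho>hat (fst p) (snd p)) \<longlongrightarrow> \<xi> * \<tau>) (in_prob M)"
      using M.tendsto_in_probI[of \<rho>hat \<rho>] assms by simp
    show "(\<lambda>n. real (k n) * \<sigma>2 (k n) n) \<longlonglongrightarrow> \<mu>" "\<mu> > 0" by (rule assms)+
    show "EPD_bayes_estimate (\<sigma>2 (k (fst p)) (fst p)) (\<lambda>i. X i (snd p)) (fst p) (k (fst p))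
        (\<rho>hat (fst p) (snd p) / hill (\<lambda>i. X i (snd p)) (fst p) (k (fst p))) (\<xi>hat (fst p) (snd p)) (\<delta>hat (fst p) (snd p))"
      if "snd p \<in> space M" "\<exists>z d. EPD_system (\<sigma>2 (k (fst p)) (fst p)) (\<lambda>i. X i (snd p)) (fst p) (k (fst p))
        (\<rho>hat (fst p) (snd p) / hill (\<lambda>i. X i (snd p)) (fst p) (k (fst p))) z d" for p
      using assms(20)[OF that(1), of "fst p"] that(2) unfolding assms(17) by blast
  qed
  have stat_meas: "exceedance_sum (influence a0 a1) n \<in> borel_measurable M" for n
  proof -
    have [measurable]: "influence a0 a1 \<in> borel_measurable borel" unfolding influence_def by measurable
    have "(\<lambda>x. influence a0 a1 (ln (x / t n)) * indicator {t n<..} x) \<in> borel_measurable borel" by measurable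
    from measurable_sum_X[OF this, of n] show ?thesis unfolding exceedance_sum_def[abs_def] by measurable
  qed
  have est_meas: "(\<lambda>\<omega>. sqrt (real (k n)) * (\<xi>hat n \<omega> - \<xi>)) \<in> borel_measurable M" for n
    using assms(18)[of n] by measurable
  show ?thesis
    unfolding v_def[symmetric] mean[symmetric]
  proof (rule levy_continuity)
    show "real_distribution (distr M borel (\<lambda>\<omega>. sqrt (real (k n)) * (\<xi>hat n \<omega> - \<xi>)))" for n
      by (rule M.real_distribution_distr[OF est_meas])
    show "real_distribution (density lborel (normal_density (influence_mean a0 a1) (sqrt v)))"
      using v_pos by (intro char_normal_density) simp
    show "(\<lambda>n. char (distr M borel (\<lambda>\<omega>. sqrt (real (k n)) * (\<xi>hat n \<omega> - \<xi>))) \<theta>)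
        \<longlonglongrightarrow> char (density lborel (normal_density (influence_mean a0 a1) (sqrt v))) \<theta>" for \<theta>
      using M.char_tendsto_of_null_diff[OF stat_meas est_meas expansion char_exceedance_sum] v_pos
      by (subst char_normal_density(2)) (simp_all add: var)
  qed
qed

end
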